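(* Let $L>0$. For any $c\in\mathbb R$ there is exactly one positive single-lobe state $\Theta_c=(\phi_c,\psi_c)\in D_0$ on the tadpole graph $\mathcal G$ that satisfies the NLS-log equation $$-\Delta\Theta+c\Theta-\Theta\log(|\Theta|^2)=0$$ (componentwise) and is monotonically decreasing on $[0,L]$ and on $[L,+\infty)$; and the map $\mathbb R\ni c\mapsto\Theta_c\in D_0$ is $C^1$. Moreover, the mass $\mu(c)=\|\Theta_c\|_{L^2(\mathcal G)}^2$ satisfies $\frac{d}{dc}\mu(c)>0$.
   Context: Tadpole graph: $\mathcal G$ consists of a ring identified with $[-L,L]$ (endpoints $\pm L$ glued) and a half-line $[L,+\infty)$, joined at the single vertex $L$. A function on $\mathcal G$ is a pair $(f,g)$ with $f$ on $[-L,L]$, $g$ on $[L,+\infty)$. $L^2(\mathcal G)=L^2(-L,L)\oplus L^2(L,+\infty)$, $H^n(\mathcal G)=H^n(-L,L)\oplus H^n(L,+\infty)$ with natural norms. $D_0=\{(f,g)\in H^2(\mathcal G): f(L)=f(-L)=g(L),\ f'(L)-f'(-L)=g'(L+)\}$, and $\Delta(f,g)=(f'',g'')$ on $D_0$. For real-valued $(\phi,\psi)\in D_0$ the equation reads $-\phi''+c\phi-\log(\phi^2)\phi=0$ on $(-L,L)$ and $-\psi''+c\psi-\log(\psi^2)\psi=0$ on $(L,+\infty)$. A positive single-lobe state is a real-valued solution $(\phi,\psi)\in D_0$ such that each component is positive on its edge, the maximum of $(\phi,\psi)$ over $\mathcal G$ is attained at a single internal point symmetrically located on $[-L,L]$ (i.e.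 at $x=0$), $\phi$ is monotonically decreasing on $[0,L]$, and $\psi$ is strictly decreasing on $[L,+\infty)$. *)

theory Defs
  imports "HOL-Analysis.Analysis"
begin

definition L2 :: "real set \<Rightarrow> (real \<Rightarrow> 'a::{banach,second_countable_topology}) set" where
  "L2 S = {f \<in> borel_measurable (lebesgue_on S).
             integrable (lebesgue_on S) (\<lambda>x. (norm (f x))\<^sup>2)}"

definition L2_norm :: "real set \<Rightarrow> (real \<Rightarrow> 'a::{banach,second_countable_topology}) \<Rightarrow> real" where
  "L2_norm S f = sqrt (LINT x|lebesgue_on S. (norm (f x))\<^sup>2)"

definition test_functions :: "real set \<Rightarrow> (real \<Rightarrow> real) set" where
  "test_functions S =
     {\<eta>. (\<forall>n x. ((deriv ^^ n) \<eta>) differentiable (at x)) \<and>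
         (\<exists>K. compact K \<and> K \<subseteq> S \<and> (\<forall>x. x \<notin> K \<longrightarrow> \<eta> x = 0))}"

text \<open>Only used for \<open>f\<close>, \<open>g\<close> in \<open>L2 S\<close>, where both integrals exist.\<close>

definition is_weak_deriv ::
  "nat \<Rightarrow> real set \<Rightarrow> (real \<Rightarrow> 'a::{banach,second_countable_topology}) \<Rightarrow> (real \<Rightarrow> 'a) \<Rightarrow> bool" where
  "is_weak_deriv n S f g \<longleftrightarrow>
     (\<forall>\<eta>\<in>test_functions S.
        (LINT x|lebesgue_on S. (deriv ^^ n) \<eta> x *\<^sub>R f x) =
        (- 1) ^ n *\<^sub>R (LINT x|lebesgue_on S. \<eta> x *\<^sub>R g x))"

definition sobolev :: "nat \<Rightarrow> real set \<Rightarrow> (real \<Rightarrow> 'a::{banach,second_countable_topology}) set" where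
  "sobolev n S = {f \<in> L2 S. \<forall>k\<le>n. \<exists>g\<in>L2 S. is_weak_deriv k S f g}"

text \<open>A representative of the weak derivative, which is unique up to null sets on open \<open>S\<close>;
  it is only used in contexts that do not depend on null sets.\<close>

definition weak_deriv ::
  "nat \<Rightarrow> real set \<Rightarrow> (real \<Rightarrow> 'a::{banach,second_countable_topology}) \<Rightarrow> real \<Rightarrow> 'a" where
  "weak_deriv n S f = (SOME g. g \<in> L2 S \<and> is_weak_deriv n S f g)"

definition sobolev_norm ::
  "nat \<Rightarrow> real set \<Rightarrow> (real \<Rightarrow> 'a::{banach,second_countable_topology}) \<Rightarrow> real" where
  "sobolev_norm n S f = sqrt (\<Sum>k\<le>n. (L2_norm S (weak_deriv k S f))\<^sup>2)"

text \<open>A pair \<open>(f, g)\<close>: \<open>f\<close> lives on the ring \<open>[-L, L]\<close> and \<open>g\<close> on the half-line \<open>[L, \<infinity>)\<close>.\<close>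

type_synonym 'a graph_fun = "(real \<Rightarrow> 'a) \<times> (real \<Rightarrow> 'a)"

definition graph_L2_norm :: "real \<Rightarrow> 'a::{banach,second_countable_topology} graph_fun \<Rightarrow> real" where
  "graph_L2_norm L u =
     sqrt ((L2_norm {-L<..<L} (fst u))\<^sup>2 + (L2_norm {L<..} (snd u))\<^sup>2)"

definition graph_sobolev :: "nat \<Rightarrow> real \<Rightarrow> 'a::{banach,second_countable_topology} graph_fun set" where
  "graph_sobolev n L = sobolev n {-L<..<L} \<times> sobolev n {L<..}"

definition graph_sobolev_norm ::
  "nat \<Rightarrow> real \<Rightarrow> 'a::{banach,second_countable_topology} graph_fun \<Rightarrow> real" where
  "graph_sobolev_norm n L u =
     sqrt ((sobolev_norm n {-L<..<L} (fst u))\<^sup>2 + (sobolev_norm n {L<..} (snd u))\<^sup>2)"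

text \<open>Every class in \<open>H\<^sup>2\<close> of an edge has exactly one representative that is continuous on the
  closed edge, and this representative is \<open>C\<^sup>1\<close> up to the end points, so that the one-sided
  derivatives in the vertex condition exist. An element of \<open>D0 L\<close> is given by these
  representatives, extended by zero outside the closed edges. With this convention equality of
  elements of \<open>D0 L\<close> is equality of functions, and \<open>D0 L\<close> is closed under pointwise linear
  combinations.\<close>

definition D0 :: "real \<Rightarrow> 'a::{banach,second_countable_topology} graph_fun set" where
  "D0 L = {(f, g).
     (f, g) \<in> graph_sobolev 2 L \<and>
     continuous_on {-L..L} f \<and> (\<forall>x. x \<notin> {-L..L} \<longrightarrow> f x = 0) \<and>
     continuous_on {L..} g \<and> (\<forall>x. x \<notin> {L..} \<longrightarrow> g x = 0) \<and>
     f L = f (-L) \<and> f (-L) = g L \<and>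
     vector_derivative f (at L within {-L..L}) - vector_derivative f (at (-L) within {-L..L})
       = vector_derivative g (at L within {L..})}"

definition laplacian ::
  "real \<Rightarrow> 'a::{banach,second_countable_topology} graph_fun \<Rightarrow> 'a graph_fun" where
  "laplacian L u = (weak_deriv 2 {-L<..<L} (fst u), weak_deriv 2 {L<..} (snd u))"

definition graph_diff ::
  "'a::{banach,second_countable_topology} graph_fun \<Rightarrow> 'a graph_fun \<Rightarrow> 'a graph_fun" where
  "graph_diff u v = (\<lambda>x. fst u x - fst v x, \<lambda>x. snd u x - snd v x)"

definition graph_scale ::
  "real \<Rightarrow> 'a::{banach,second_countable_topology} graph_fun \<Rightarrow> 'a graph_fun" where
  "graph_scale r u = (\<lambda>x. r *\<^sub>R fst u x, \<lambda>x. r *\<^sub>R snd u x)"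

definition C1_curve_D0 ::
  "real \<Rightarrow> (real \<Rightarrow> 'a::{banach,second_countable_topology} graph_fun) \<Rightarrow> bool" where
  "C1_curve_D0 L \<Theta> \<longleftrightarrow>
     (\<forall>c. \<Theta> c \<in> D0 L) \<and>
     (\<exists>\<Theta>'. (\<forall>c. \<Theta>' c \<in> D0 L) \<and>
        (\<forall>c. ((\<lambda>h. graph_sobolev_norm 2 L
                 (graph_diff (graph_scale (1 / h) (graph_diff (\<Theta> (c + h)) (\<Theta> c))) (\<Theta>' c)))
               \<longlongrightarrow> 0) (at 0)) \<and>
        (\<forall>c. ((\<lambda>s. graph_sobolev_norm 2 L (graph_diff (\<Theta>' s) (\<Theta>' c))) \<longlongrightarrow> 0) (at c)))"

text \<open>The equation is an identity in \<open>L\<^sup>2\<close> of each edge. Note that \<open>ln 0 = 0\<close> in HOL, so that the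
  nonlinearity has its usual value 0 at 0.\<close>

definition NLS_log :: "real \<Rightarrow> real \<Rightarrow> real graph_fun \<Rightarrow> bool" where
  "NLS_log L c u \<longleftrightarrow>
     (AE x in lebesgue_on {-L<..<L}.
        - fst (laplacian L u) x + c * fst u x - fst u x * ln (\<bar>fst u x\<bar>\<^sup>2) = 0) \<and>
     (AE x in lebesgue_on {L<..}.
        - snd (laplacian L u) x + c * snd u x - snd u x * ln (\<bar>snd u x\<bar>\<^sup>2) = 0)"

definition positive_single_lobe_state :: "real \<Rightarrow> real \<Rightarrow> real graph_fun \<Rightarrow> bool" where
  "positive_single_lobe_state L c u \<longleftrightarrow>
     u \<in> D0 L \<and> NLS_log L c u \<and>
     (\<forall>x\<in>{-L..L}. fst u x > 0) \<and> (\<forall>x\<in>{L..}. snd u x > 0) \<and>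
     (\<forall>x\<in>{-L..L}. x \<noteq> 0 \<longrightarrow> fst u x < fst u 0) \<and> (\<forall>x\<in>{L..}. snd u x < fst u 0) \<and>
     antimono_on {0..L} (fst u) \<and> strict_antimono_on {L..} (snd u)"

definition mass :: "real \<Rightarrow> 'a::{banach,second_countable_topology} graph_fun \<Rightarrow> real" where
  "mass L u = (graph_L2_norm L u)\<^sup>2"

end

theory Submission
  imports Defs "HOL-Real_Asymp.Real_Asymp"
begin

text \<open>If \<open>\<Theta>\<close> solves the equation with parameter \<open>0\<close>, then \<open>exp (c / 2) \<Theta>\<close> solves it with parameter
  \<open>c\<close>; hence \<open>\<Theta>\<^sub>c = exp (c / 2) \<Theta>\<^sub>0\<close>, the curve is smooth, and the mass is \<open>exp c\<close> times a positive
  constant. Everything reduces to existence and uniqueness for \<open>c = 0\<close>.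

  On the half-line a decaying solution has zero energy, hence is a Gaussian. On the ring, the energy
  level of radius \<open>\<rho>\<close> is parametrised by an angle \<open>\<theta>\<close> that runs from \<open>0\<close> at the maximum to \<open>b\<close> at the
  vertex. The vertex conditions force \<open>0 < b < pi\<close> and \<open>\<rho> = (1 + 3 sin\<^sup>2 b)\<^bsup>-1/2\<^esup>\<close>, and the half-length of
  the ring on which this orbit fits is an integral over \<open>\<theta>\<close> that increases strictly with \<open>b\<close> from \<open>0\<close>
  to infinity. So \<open>L\<close> determines \<open>b\<close>, and \<open>b\<close> determines the initial value at the maximum.

  Weak solutions are classical because a continuous function whose second weak derivative vanishes
  is affine.\<close>

section \<open>Smooth bump functions and weak derivatives\<close>

text \<open>The usual length integral has integrand 1 / sqrt (energy - potential), which blows up at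
  the maximum and is awkward to compare between energies. With \<open>amp\<close>, the signed root
  of 1 plus the potential, as coordinate, the factor sin \<theta> cancels in the change from
  position to angle and leaves dx / d\<theta> = \<open>transit\<close>, which is monotone and
  bounded below. Origin of the formula for \<rho>: evenness makes the derivative jump at the vertex
  equal to - 2 \<rho> sin b, and a decaying Gaussian through the height exp (- t / 2) has squared
  logarithmic slope 1 + t. So 4 \<rho>^2 sin^2 b = (1 + t) exp (- t) = 1 - \<rho>^2 cos^2 b, that
  is, \<rho>^2 (1 + 3 sin^2 b) = 1. The obstacle is the growth of the half-length for b > pi / 2,
  where \<rho> rises with b and so shortens the start of the orbit. This is why explicit Lipschitz
  constants are tracked, 1 / 6 for \<open>transit\<close> at negative arguments and 3 / 2 for
  \<rho>: between angles a < b the loss is at most (b - a) / 2, the gain at least (b - a) / sqrt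
  2.\<close>

definition bump_term :: "real poly \<Rightarrow> nat \<Rightarrow> real poly \<Rightarrow> real \<Rightarrow> real" where
  "bump_term p k q x =
     (if poly q x > 0 then poly p x / poly q x ^ k * exp (- (1 / poly q x)) else 0)"

lemma power_le_fact_exp:
  fixes x :: real
  assumes "x \<ge> 0"
  shows "x ^ n \<le> fact n * exp x"
proof -
  have "(\<Sum>i\<in>{n}. x ^ i /\<^sub>R fact i) \<le> (\<Sum>i. x ^ i /\<^sub>R fact i)"
    using assms by (intro sum_le_suminf summable_exp_generic) auto
  also have "\<dots> = exp x" by (simp add: exp_def)
  finally show ?thesis by (simp add: field_simps)
qed

text \<open>The exponential series is used at order \<open>k + 2\<close>: \<open>k\<close> powers
  absorb the pole, and the two left over give a bound quadratic in \<open>q\<close>, enough for a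
  vanishing derivative at the zeros of \<open>q\<close>.\<close>

lemma bump_term_bound:
  "\<bar>bump_term p k q x\<bar> \<le> \<bar>poly p x\<bar> * fact (k + 2) * (poly q x)\<^sup>2"
proof (cases "poly q x > 0")
  case True
  define s where "s = poly q x"
  have s: "s > 0" using True by (simp add: s_def)
  have "(1 / s) ^ (k + 2) \<le> fact (k + 2) * exp (1 / s)"
    using s by (intro power_le_fact_exp) auto
  then have "exp (- (1 / s)) / s ^ k \<le> fact (k + 2) * s\<^sup>2"
    using s by (simp add: exp_minus field_simps power_add power2_eq_square)
  then have "\<bar>poly p x\<bar> * (exp (- (1 / s)) / s ^ k) \<le> \<bar>poly p x\<bar> * (fact (k + 2) * s\<^sup>2)"
    by (intro mult_left_mono) auto
  moreover have "\<bar>bump_term p k q x\<bar> = \<bar>poly p x\<bar> * (exp (- (1 / s)) / s ^ k)"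
    using s by (simp add: bump_term_def s_def[symmetric] abs_mult)
  ultimately show ?thesis by (simp add: s_def mult.assoc)
qed (simp add: bump_term_def)

text \<open>Numerator of the derivative of p / q^k * exp (- 1 / q) over the common denominator q^(k
  + 2). It makes the family \<open>bump_term\<close> closed under differentiation, so that
  smoothness is an induction over one derivative rule.\<close>

definition bump_num :: "real poly \<Rightarrow> nat \<Rightarrow> real poly \<Rightarrow> real poly" where
  "bump_num p k q = pderiv p * q\<^sup>2 - of_nat k * p * pderiv q * q + p * pderiv q"

text \<open>Away from the zeros of \<open>q\<close> this is calculus on an open set. At a zero, the
  quadratic bound splits into a factor \<open>q\<close>, which tends to 0, and a difference quotient
  of \<open>q\<close>, which converges.\<close>

lemma DERIV_bump_term:
  "(bump_term p k q has_real_derivative bump_term (bump_num p k q) (k + 2) q x) (at x)"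
proof -
  consider "poly q x > 0" | "poly q x < 0" | "poly q x = 0" by linarith
  then show ?thesis
  proof cases
    case 1
    have "((\<lambda>x. poly p x / poly q x ^ k * exp (- (1 / poly q x))) has_real_derivative
       ((poly (pderiv p) x * poly q x ^ k - poly p x * (real k * poly q x ^ (k - 1) * poly (pderiv q) x))
          / (poly q x ^ k * poly q x ^ k)) * exp (- (1 / poly q x))
        + poly p x / poly q x ^ k * (exp (- (1 / poly q x)) * (poly (pderiv q) x / (poly q x)\<^sup>2))) (at x)"
      using 1 by (auto intro!: derivative_eq_intros simp: power2_eq_square field_simps)
    also have "((poly (pderiv p) x * poly q x ^ k - poly p x * (real k * poly q x ^ (k - 1) * poly (pderiv q) x))
          / (poly q x ^ k * poly q x ^ k)) * exp (- (1 / poly q x))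
        + poly p x / poly q x ^ k * (exp (- (1 / poly q x)) * (poly (pderiv q) x / (poly q x)\<^sup>2))
       = bump_term (bump_num p k q) (k + 2) q x"
      using 1 by (cases k) (simp_all add: bump_term_def bump_num_def field_simps power2_eq_square)
    finally have A: "((\<lambda>x. poly p x / poly q x ^ k * exp (- (1 / poly q x))) has_real_derivative
       bump_term (bump_num p k q) (k + 2) q x) (at x)" .
    have B: "\<forall>\<^sub>F y in nhds x. bump_term p k q y = poly p y / poly q y ^ k * exp (- (1 / poly q y))"
    proof -
      have "open {y. poly q y > 0}" by (intro open_Collect_less continuous_intros)
      then have "\<forall>\<^sub>F y in nhds x. y \<in> {y. poly q y > 0}"
        using 1 by (intro eventually_nhds_in_open) auto
      then show ?thesis by eventually_elim (simp add: bump_term_def)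
    qed
    show ?thesis by (rule DERIV_cong_ev[OF refl B refl, THEN iffD2, OF A])
  next
    case 2
    have "open {y. poly q y < 0}" by (intro open_Collect_less continuous_intros)
    then have "\<forall>\<^sub>F y in nhds x. y \<in> {y. poly q y < 0}"
      using 2 by (intro eventually_nhds_in_open) auto
    then have B: "\<forall>\<^sub>F y in nhds x. bump_term p k q y = 0"
      by eventually_elim (simp add: bump_term_def)
    have "((\<lambda>_. 0) has_real_derivative bump_term (bump_num p k q) (k + 2) q x) (at x)"
      using 2 by (simp add: bump_term_def)
    then show ?thesis by (rule DERIV_cong_ev[OF refl B refl, THEN iffD2])
  next
    case 3
    have A: "((\<lambda>y. (poly q y - poly q x) / (y - x)) \<longlongrightarrow> poly (pderiv q) x) (at x)"
      using poly_DERIV[of q x] by (simp add: has_field_derivative_iff)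
    have B: "((\<lambda>y. \<bar>poly p y\<bar> * fact (k + 2) * poly q y) \<longlongrightarrow>
        \<bar>poly p x\<bar> * fact (k + 2) * poly q x) (at x)"
      by (intro tendsto_intros poly_isCont[unfolded isCont_def])
    have "((\<lambda>y. \<bar>poly p y\<bar> * fact (k + 2) * poly q y * ((poly q y - poly q x) / (y - x))) \<longlongrightarrow>
        \<bar>poly p x\<bar> * fact (k + 2) * poly q x * poly (pderiv q) x) (at x)"
      by (rule tendsto_mult[OF B A])
    then have "((\<lambda>y. \<bar>poly p y\<bar> * fact (k + 2) * poly q y * (poly q y / (y - x))) \<longlongrightarrow> 0) (at x)"
      using 3 by simp
    then have "((\<lambda>y. bump_term p k q y / (y - x)) \<longlongrightarrow> 0) (at x)"
    proof (rule tendsto_0_le[where K = 1], intro always_eventually allI)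
      fix y
      have "\<bar>bump_term p k q y\<bar> / \<bar>y - x\<bar> \<le> \<bar>poly p y\<bar> * fact (k + 2) * (poly q y)\<^sup>2 / \<bar>y - x\<bar>"
        by (intro divide_right_mono bump_term_bound) auto
      also have "\<dots> = \<bar>\<bar>poly p y\<bar> * fact (k + 2) * poly q y * (poly q y / (y - x))\<bar>"
        by (simp add: abs_mult power2_eq_square abs_mult_self_eq)
      finally show "norm (bump_term p k q y / (y - x)) \<le>
          norm (\<bar>poly p y\<bar> * fact (k + 2) * poly q y * (poly q y / (y - x))) * 1" by simp
    qed
    then show ?thesis
      using 3 by (simp add: has_field_derivative_iff bump_term_def[of _ _ _ x])
  qed
qed

lemma deriv_bump_term: "deriv (bump_term p k q) = bump_term (bump_num p k q) (k + 2) q"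
  using DERIV_imp_deriv[OF DERIV_bump_term] by blast

lemma funpow_deriv_bump_term: "\<exists>p' k'. (deriv ^^ n) (bump_term p k q) = bump_term p' k' q"
  by (induction n) (force simp: deriv_bump_term)+

abbreviation bump :: "real poly \<Rightarrow> real \<Rightarrow> real" where
  "bump \<equiv> bump_term 1 0"

lemma bump_nonneg: "bump q x \<ge> 0" and bump_le_1: "bump q x \<le> 1"
  by (auto simp: bump_term_def)

lemma bump_pos: "poly q x > 0 \<Longrightarrow> bump q x > 0"
  by (simp add: bump_term_def)

lemma bump_eq_0: "poly q x \<le> 0 \<Longrightarrow> bump q x = 0"
  by (simp add: bump_term_def)

lemma bump_test_function:
  assumes "compact K" "K \<subseteq> S" "\<And>x. x \<notin> K \<Longrightarrow> poly q x \<le> 0"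
  shows "bump q \<in> test_functions S"
proof -
  have smooth: "(deriv ^^ n) (bump q) differentiable (at x)" for n x
  proof -
    obtain p k where "(deriv ^^ n) (bump q) = bump_term p k q"
      using funpow_deriv_bump_term by blast
    then show ?thesis
      by (simp only: real_differentiable_def) (rule exI, rule DERIV_bump_term)
  qed
  have "bump q x = 0" if "x \<notin> K" for x
    using assms(3)[OF that] by (rule bump_eq_0)
  with smooth assms(1,2) show ?thesis
    unfolding test_functions_def by (intro CollectI conjI allI exI[of _ K]) auto
qed

section \<open>Test functions and their supports\<close>

lemma test_function_DERIV:
  assumes "\<eta> \<in> test_functions S"
  shows "(\<eta> has_real_derivative deriv \<eta> x) (at x)"
proof -
  have "(deriv ^^ 0) \<eta> differentiable (at x)"
    using assms unfolding test_functions_def by blast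
  then show ?thesis by (simp add: DERIV_deriv_iff_real_differentiable)
qed

lemma test_function_continuous:
  assumes "\<eta> \<in> test_functions S"
  shows "continuous_on A \<eta>"
  using test_function_DERIV[OF assms] DERIV_isCont continuous_at_imp_continuous_on by blast

lemma deriv_test_function:
  assumes "\<eta> \<in> test_functions S"
  shows "deriv \<eta> \<in> test_functions S"
proof -
  obtain K where K: "compact K" "K \<subseteq> S" "\<And>x. x \<notin> K \<Longrightarrow> \<eta> x = 0"
    using assms unfolding test_functions_def by blast
  have "deriv \<eta> x = 0" if "x \<notin> K" for x
  proof -
    have "\<forall>\<^sub>F y in nhds x. y \<in> - K"
      using K(1) that by (intro eventually_nhds_in_open) (auto simp: compact_imp_closed open_Compl)
    then have "\<forall>\<^sub>F y in nhds x. \<eta> y = 0" by eventually_elim (use K in auto)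
    then have "(\<eta> has_real_derivative 0) (at x)" by (simp cong: DERIV_cong_ev)
    then show ?thesis by (rule DERIV_imp_deriv)
  qed
  moreover have "(deriv ^^ n) (deriv \<eta>) differentiable (at x)" for n x
  proof -
    have "(deriv ^^ (Suc n)) \<eta> differentiable (at x)"
      using assms unfolding test_functions_def by blast
    then show ?thesis by (simp add: funpow_swap1)
  qed
  ultimately show ?thesis using K unfolding test_functions_def by blast
qed

lemma funpow_deriv_test_function:
  "\<eta> \<in> test_functions S \<Longrightarrow> (deriv ^^ n) \<eta> \<in> test_functions S"
  by (induction n) (auto intro: deriv_test_function)

text \<open>Trades an arbitrary compact support for an interval whose end points lie outside the
  support, so that boundary terms vanish in an integration by parts.\<close>

lemma compact_subset_open_interval:
  fixes S :: "real set"
  assumes "open S" "is_interval S" "S \<noteq> {}" "compact K" "K \<subseteq> S"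
  obtains a b where "a < b" "{a..b} \<subseteq> S" "K \<subseteq> {a<..<b}"
proof -
  \<comment> \<open>An empty support is replaced by a point of \<open>S\<close>, so that minimum and
    maximum exist.\<close>
  define K' where "K' = (if K = {} then {SOME x. x \<in> S} else K)"
  have K': "compact K'" "K' \<subseteq> S" "K' \<noteq> {}" "K \<subseteq> K'"
    using assms some_in_eq[of S] by (auto simp: K'_def)
  obtain l where l: "l \<in> K'" "\<And>x. x \<in> K' \<Longrightarrow> l \<le> x"
    using compact_attains_inf[OF K'(1,3)] by blast
  obtain u where u: "u \<in> K'" "\<And>x. x \<in> K' \<Longrightarrow> x \<le> u"
    using compact_attains_sup[OF K'(1,3)] by blast
  obtain d where d: "d > 0" "cball l d \<subseteq> S"
    using assms(1) l K' open_contains_cball by blast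
  obtain e where e: "e > 0" "cball u e \<subseteq> S"
    using assms(1) u K' open_contains_cball by blast
  have lu: "l - d \<in> S" "u + e \<in> S"
    using d e by (auto simp: dist_real_def subset_iff)
  have "l \<le> u" using l u by auto
  show ?thesis
  proof (rule that[of "l - d" "u + e"])
    show "l - d < u + e" using \<open>l \<le> u\<close> d e by linarith
    show "{l - d..u + e} \<subseteq> S"
      using lu assms(2) by (meson atLeastAtMost_iff mem_is_interval_1_I subsetI)
    show "K \<subseteq> {l - d<..<u + e}"
    proof
      fix x assume "x \<in> K"
      then have "l \<le> x" "x \<le> u" using l u K' by auto
      then show "x \<in> {l - d<..<u + e}" using d e by auto
    qed
  qed
qed

lemma integral_lebesgue_on_support:
  fixes h :: "real \<Rightarrow> real"
  assumes "continuous_on {a..b} h" "{a..b} \<subseteq> S" "S \<in> sets lebesgue"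
    and "\<And>x. x \<in> S \<Longrightarrow> x \<notin> {a..b} \<Longrightarrow> h x = 0"
  shows "integrable (lebesgue_on S) h" "(LINT x|lebesgue_on S. h x) = integral {a..b} h"
proof -
  have eq: "indicator S x * h x = indicator {a..b} x * h x" for x
    using assms(2,4) by (auto simp: indicator_def)
  have int: "set_integrable lebesgue {a..b} h"
    by (rule absolutely_integrable_continuous_real[OF assms(1)])
  show "integrable (lebesgue_on S) h"
    using int assms(3) by (simp add: integrable_restrict_space eq set_integrable_def)
  show "(LINT x|lebesgue_on S. h x) = integral {a..b} h"
    using set_lebesgue_integral_eq_integral(2)[OF int] assms(3)
    by (simp add: integral_restrict_space eq set_lebesgue_integral_def)
qed

section \<open>Weak derivatives: agreement with classical ones and uniqueness\<close>

lemma is_weak_deriv_0: "is_weak_deriv 0 S f f"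
  by (simp add: is_weak_deriv_def)

text \<open>Integration by parts moves one derivative from \<open>\<eta>\<close> to
  \<open>g\<close>; the remaining \<open>n\<close> derivatives fall on \<open>deriv \<eta>\<close>,
  which is again a test function and is covered by the weak derivative of order
  \<open>n\<close>.\<close>

lemma is_weak_deriv_Suc:
  fixes S :: "real set" and f :: "real \<Rightarrow> real"
  assumes S: "open S" "is_interval S" "S \<noteq> {}"
    and w: "is_weak_deriv n S f g"
    and deriv: "\<And>x. x \<in> S \<Longrightarrow> (g has_real_derivative g1 x) (at x)"
    and cont: "continuous_on S g1"
  shows "is_weak_deriv (Suc n) S f g1"
  unfolding is_weak_deriv_def
proof
  fix \<eta> assume \<eta>: "\<eta> \<in> test_functions S"
  obtain K where K: "compact K" "K \<subseteq> S" "\<And>x. x \<notin> K \<Longrightarrow> \<eta> x = 0"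
    using \<eta> unfolding test_functions_def by blast
  obtain K' where K': "compact K'" "K' \<subseteq> S" "\<And>x. x \<notin> K' \<Longrightarrow> deriv \<eta> x = 0"
    using deriv_test_function[OF \<eta>] unfolding test_functions_def by blast
  have "compact (K \<union> K')" "K \<union> K' \<subseteq> S" using K K' by auto
  from compact_subset_open_interval[OF S this]
  obtain a b where ab: "a < b" "{a..b} \<subseteq> S" "K \<union> K' \<subseteq> {a<..<b}" by blast
  have z: "\<eta> x = 0" "deriv \<eta> x = 0" if "x \<notin> {a<..<b}" for x
    using that K K' ab(3) by blast+
  have contg: "continuous_on {a..b} g"
    using deriv ab(2) by (intro continuous_at_imp_continuous_on ballI) (blast intro: DERIV_isCont)
  have contg1: "continuous_on {a..b} g1" using cont ab(2) continuous_on_subset by blast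
  have c\<eta>: "continuous_on {a..b} \<eta>" "continuous_on {a..b} (deriv \<eta>)"
    by (intro test_function_continuous[OF \<eta>] test_function_continuous[OF deriv_test_function[OF \<eta>]])+
  have "((\<lambda>x. deriv \<eta> x * g x + g1 x * \<eta> x) has_integral \<eta> b * g b - \<eta> a * g a) {a..b}"
  proof (rule fundamental_theorem_of_calculus)
    fix x assume "x \<in> {a..b}"
    then have "((\<lambda>x. \<eta> x * g x) has_real_derivative deriv \<eta> x * g x + g1 x * \<eta> x) (at x)"
      using ab(2) by (intro DERIV_mult test_function_DERIV[OF \<eta>] deriv) auto
    then show "((\<lambda>x. \<eta> x * g x) has_vector_derivative deriv \<eta> x * g x + g1 x * \<eta> x) (at x within {a..b})"
      unfolding has_real_derivative_iff_has_vector_derivative[symmetric]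
      by (rule has_field_derivative_at_within)
  qed (use ab in simp)
  then have "integral {a..b} (\<lambda>x. deriv \<eta> x * g x + g1 x * \<eta> x) = 0"
    using z[of a] z[of b] by (simp add: integral_unique)
  moreover have "integral {a..b} (\<lambda>x. deriv \<eta> x * g x + g1 x * \<eta> x) =
      integral {a..b} (\<lambda>x. deriv \<eta> x * g x) + integral {a..b} (\<lambda>x. \<eta> x * g1 x)"
    by (subst Henstock_Kurzweil_Integration.integral_add)
       (auto intro!: integrable_continuous_interval continuous_intros contg contg1 c\<eta> simp: mult.commute)
  moreover have "(LINT x|lebesgue_on S. deriv \<eta> x * g x) = integral {a..b} (\<lambda>x. deriv \<eta> x * g x)"
    using ab z S(1) by (intro integral_lebesgue_on_support continuous_intros contg c\<eta>) auto
  moreover have "(LINT x|lebesgue_on S. \<eta> x * g1 x) = integral {a..b} (\<lambda>x. \<eta> x * g1 x)"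
    using ab z S(1) by (intro integral_lebesgue_on_support continuous_intros contg1 c\<eta>) auto
  ultimately have "(LINT x|lebesgue_on S. deriv \<eta> x * g x) = - (LINT x|lebesgue_on S. \<eta> x * g1 x)"
    by linarith
  moreover have "(LINT x|lebesgue_on S. (deriv ^^ n) (deriv \<eta>) x * f x) =
      (- 1) ^ n * (LINT x|lebesgue_on S. deriv \<eta> x * g x)"
    using w deriv_test_function[OF \<eta>] by (simp add: is_weak_deriv_def)
  ultimately show "(LINT x|lebesgue_on S. (deriv ^^ Suc n) \<eta> x *\<^sub>R f x) =
      (- 1) ^ Suc n *\<^sub>R (LINT x|lebesgue_on S. \<eta> x *\<^sub>R g1 x)"
    by (simp add: funpow_swap1)
qed

text \<open>Open rays are stable under intersection and generate the Borel sets, so Dynkin's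
  argument makes the integral vanish over every Borel set; the total integral serves for
  complements. A Lebesgue set differs from a Borel set by a null set, and a density is determined by
  its integrals.\<close>

lemma AE_zero_if_ray_integrals_zero:
  fixes D :: "real \<Rightarrow> real"
  assumes int: "integrable lebesgue D"
    and rays: "\<And>x. (LINT t:{x<..}|lebesgue. D t) = 0" and total: "(LINT t|lebesgue. D t) = 0"
  shows "AE x in lebesgue. D x = 0"
proof (rule density_unique_real[OF int])
  have sint: "set_integrable lebesgue A D" if "A \<in> sets lebesgue" for A
    using integrable_mult_indicator[OF that int] by (simp add: set_integrable_def)
  have borel: "(LINT t:A|lebesgue. D t) = 0" if "A \<in> sets borel" for A
  proof -
    have sb: "sigma_sets UNIV (range greaterThan :: real set set) = sets borel"
      by (simp add: borel_Ioi)
    have stable: "Int_stable (range greaterThan :: real set set)"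
    proof (rule Int_stableI)
      fix A B :: "real set" assume "A \<in> range greaterThan" "B \<in> range greaterThan"
      then obtain a b where "A = {a<..}" "B = {b<..}" by blast
      then have "A \<inter> B = {max a b<..}" by auto
      then show "A \<inter> B \<in> range greaterThan" by blast
    qed
    have "A \<in> sigma_sets UNIV (range greaterThan)" using that by (simp add: sb)
    with stable subset_UNIV[of "range greaterThan", folded Pow_UNIV] show ?thesis
    proof (induction rule: sigma_sets_induct_disjoint)
      case (compl A)
      then have A: "A \<in> sets lebesgue" by (simp add: sb)
      have "(LINT t:A \<union> (UNIV - A)|lebesgue. D t) =
          (LINT t:A|lebesgue. D t) + (LINT t:UNIV - A|lebesgue. D t)"
        using A by (intro set_integral_Un sint) auto
      then show ?case using compl total by (simp add: set_lebesgue_integral_def)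
    next
      case (union A)
      then have A: "A i \<in> sets lebesgue" for i by (auto simp: sb)
      have "(LINT t:(\<Union>i. A i)|lebesgue. D t) = (\<Sum>i. (LINT t:A i|lebesgue. D t))"
        using union A by (intro lebesgue_integral_countable_add sint) (auto simp: disjoint_family_on_def)
      then show ?case using union by simp
    qed (use rays in \<open>auto simp: set_lebesgue_integral_def\<close>)
  qed
  fix A :: "real set" assume A: "A \<in> sets lebesgue"
  then obtain S N N' where S: "A = S \<union> N" "N \<subseteq> N'" "N' \<in> null_sets lborel" "S \<in> sets borel"
    by (auto elim: sets_completionE)
  have "(LINT t:A|lebesgue. D t) = (LINT t:S|lebesgue. D t)"
  proof (rule set_integral_cong_set)
    have "AE t in lebesgue. t \<notin> N'"
      using S(3) by (intro AE_not_in) (auto simp: null_sets_completion_iff2)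
    then show "AE t in lebesgue. (t \<in> S) = (t \<in> A)"
      by eventually_elim (use S in auto)
    show "set_borel_measurable lebesgue A D" "set_borel_measurable lebesgue S D"
      using sint A S(4)
      by (auto simp: set_borel_measurable_def set_integrable_def intro!: borel_measurable_integrable)
  qed
  then show "(LINT t:A|lebesgue. D t) = (LINT t:A|lebesgue. 0)"
    using borel S(4) by (simp add: set_lebesgue_integral_def)
qed simp

lemma L2_locally_integrable:
  fixes g :: "real \<Rightarrow> real"
  assumes "g \<in> L2 S" "S \<in> sets lebesgue"
  shows "integrable (lebesgue_on S) (\<lambda>x. indicator {a<..<b} x * g x)"
proof (rule Bochner_Integration.integrable_bound)
  have "integrable lebesgue (\<lambda>x. indicat_real (S \<inter> {a<..<b}) x)"
  proof (rule Bochner_Integration.integrable_bound)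
    show "integrable lebesgue (indicat_real {a<..<b})"
      using emeasure_bounded_finite[of "{a<..<b}"] by (intro integrable_real_indicator) auto
    show "indicat_real (S \<inter> {a<..<b}) \<in> borel_measurable lebesgue"
      using assms(2) by (intro borel_measurable_indicator) auto
  qed (auto simp: indicator_def)
  then have "integrable (lebesgue_on S) (indicat_real {a<..<b})"
    using assms(2) by (simp add: integrable_restrict_space indicator_inter_arith)
  moreover have "integrable (lebesgue_on S) (\<lambda>x. (g x)\<^sup>2)"
    using assms(1) by (simp add: L2_def)
  ultimately show "integrable (lebesgue_on S) (\<lambda>x. indicat_real {a<..<b} x + (g x)\<^sup>2)"
    by simp
  have "g \<in> borel_measurable (lebesgue_on S)" using assms(1) by (simp add: L2_def)
  moreover have "indicat_real {a<..<b} \<in> borel_measurable (lebesgue_on S)"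
    by (intro measurable_restrict_space1 borel_measurable_indicator) simp
  ultimately show "(\<lambda>x. indicator {a<..<b} x * g x) \<in> borel_measurable (lebesgue_on S)"
    by simp
  \<comment> \<open>From \<open>(\<bar>g x\<bar> - 1 / 2)\<^sup>2 \<ge> 0\<close>; it is what makes
    a square integrable function integrable on bounded intervals.\<close>
  have "\<bar>g x\<bar> \<le> 1 + (g x)\<^sup>2" for x
    using zero_le_power2[of "\<bar>g x\<bar> - 1 / 2"] by (simp add: power2_diff) (simp add: power2_eq_square)
  then show "AE x in lebesgue_on S. norm (indicator {a<..<b} x * g x) \<le>
      norm (indicat_real {a<..<b} x + (g x)\<^sup>2)"
    by (auto simp: indicator_def)
qed

text \<open>The factor \<open>Suc n\<close> leaves the zeros at \<open>a\<close> and
  \<open>b\<close> fixed but drives the exponent of the bump to 0 inside, so the bumps tend to the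
  indicator of the interval.\<close>

definition interval_poly :: "nat \<Rightarrow> real \<Rightarrow> real \<Rightarrow> real poly" where
  "interval_poly n a b = smult (real (Suc n)) ([:- a, 1:] * [:b, - 1:])"

lemma poly_interval_poly: "poly (interval_poly n a b) x = real (Suc n) * ((x - a) * (b - x))"
  by (simp add: interval_poly_def algebra_simps)

lemma poly_interval_poly_nonpos:
  assumes "x \<notin> {a<..<b}" "a < b" shows "poly (interval_poly n a b) x \<le> 0"
proof -
  have "(x - a) * (b - x) \<le> 0"
  proof (cases "x \<le> a")
    case True
    then show ?thesis using assms by (intro mult_nonpos_nonneg) auto
  next
    case False
    then show ?thesis using assms by (intro mult_nonneg_nonpos) auto
  qed
  then show ?thesis unfolding poly_interval_poly by (rule mult_nonneg_nonpos[rotated]) simp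
qed

lemma bump_interval_tendsto:
  assumes "a < b"
  shows "(\<lambda>n. bump (interval_poly n a b) x) \<longlonglongrightarrow> indicator {a<..<b} x"
proof (cases "x \<in> {a<..<b}")
  case True
  define c where "c = (x - a) * (b - x)"
  have c: "c > 0" using True by (simp add: c_def)
  have "(\<lambda>n. exp (- (1 / (real (Suc n) * c)))) \<longlonglongrightarrow> exp (- 0)"
    using LIMSEQ_inverse_real_of_nat tendsto_mult_right[OF LIMSEQ_inverse_real_of_nat, of "1 / c"]
    by (intro tendsto_intros) (simp add: divide_simps)
  moreover have "bump (interval_poly n a b) x = exp (- (1 / (real (Suc n) * c)))" for n
    using c by (simp add: bump_term_def poly_interval_poly c_def)
  ultimately show ?thesis using True by simp
next
  case False
  then show ?thesis using poly_interval_poly_nonpos[OF False assms] by (simp add: bump_eq_0)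
qed

text \<open>Dominated convergence along bumps approaching an indicator shows that the difference has
  integral 0 over every interval whose closure lies in \<open>S\<close>. Within one such interval,
  cutting by rays gives smaller intervals of the same kind, so the ray criterion applies.\<close>

lemma weak_deriv_unique_AE:
  fixes f g1 g2 :: "real \<Rightarrow> real"
  assumes S: "open S" and L2: "g1 \<in> L2 S" "g2 \<in> L2 S"
    and w: "is_weak_deriv n S f g1" "is_weak_deriv n S f g2"
  shows "AE x in lebesgue_on S. g1 x = g2 x"
proof -
  have Sl: "S \<in> sets lebesgue" using S by auto
  define d where "d x = g1 x - g2 x" for x
  have \<eta>d: "(LINT x|lebesgue_on S. \<eta> x * g1 x) = (LINT x|lebesgue_on S. \<eta> x * g2 x)"
    if "\<eta> \<in> test_functions S" for \<eta>
    using w that by (auto simp: is_weak_deriv_def)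
  have int_d: "integrable (lebesgue_on S) (\<lambda>x. indicator {a<..<b} x * d x)" for a b
    using L2_locally_integrable[OF L2(1) Sl, of a b] L2_locally_integrable[OF L2(2) Sl, of a b]
    by (simp add: d_def right_diff_distrib)
  have zero: "(LINT x|lebesgue_on S. indicator {a<..<b} x * d x) = 0" if "{a..b} \<subseteq> S" for a b
  proof (cases "a < b")
    case True
    let ?\<eta> = "\<lambda>n. bump (interval_poly n a b)"
    have test: "?\<eta> n \<in> test_functions S" for n
      using that True poly_interval_poly_nonpos
      by (intro bump_test_function[of "{a..b}"]) auto
    have meas: "?\<eta> n \<in> borel_measurable (lebesgue_on S)" for n
      using test_function_continuous[OF test, of S] Sl
      by (intro continuous_imp_measurable_on_sets_lebesgue)
    have supp: "?\<eta> n x = 0" if "x \<notin> {a<..<b}" for n x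
      using poly_interval_poly_nonpos[OF that True] by (rule bump_eq_0)
    have bound: "\<bar>?\<eta> n x * g x\<bar> \<le> \<bar>indicator {a<..<b} x * g x\<bar>" for n x and g :: "real \<Rightarrow> real"
      using bump_nonneg bump_le_1 supp[of x n]
      by (cases "x \<in> {a<..<b}") (auto simp: abs_mult intro!: mult_left_le_one_le)
    have int: "integrable (lebesgue_on S) (\<lambda>x. ?\<eta> n x * g x)" if "g \<in> L2 S" for n g
    proof (rule Bochner_Integration.integrable_bound[OF L2_locally_integrable[OF that Sl, of a b]])
      show "(\<lambda>x. ?\<eta> n x * g x) \<in> borel_measurable (lebesgue_on S)"
        using meas that by (auto simp: L2_def)
    qed (use bound in auto)
    have "(\<lambda>n. LINT x|lebesgue_on S. ?\<eta> n x * d x) \<longlonglongrightarrow>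
        (LINT x|lebesgue_on S. indicator {a<..<b} x * d x)"
    proof (rule integral_dominated_convergence)
      show "integrable (lebesgue_on S) (\<lambda>x. \<bar>indicator {a<..<b} x * d x\<bar>)"
        using int_d by (rule integrable_abs)
      show "(\<lambda>x. ?\<eta> n x * d x) \<in> borel_measurable (lebesgue_on S)" for n
        using meas L2 by (auto simp: L2_def d_def)
    qed (use int_d[of a b] bump_interval_tendsto[OF True] bound in
          \<open>auto intro!: tendsto_mult_right\<close>)
    moreover have "(LINT x|lebesgue_on S. ?\<eta> n x * d x) = 0" for n
      using \<eta>d[OF test] int L2 by (simp add: d_def right_diff_distrib)
    ultimately show ?thesis by (simp add: LIMSEQ_const_iff)
  qed simp
  have local: "AE x in lebesgue. x \<in> {a<..<b} \<longrightarrow> d x = 0" if ab: "{a..b} \<subseteq> S" for a b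
  proof -
    have ind: "indicator S x * (indicator {u<..<v} x * d x) = indicator {u<..<v} x * d x"
      if "{u<..<v} \<subseteq> {a<..<b}" for u v x
    proof -
      have "{a<..<b} \<subseteq> S" using ab by (auto simp: subset_iff)
      then have "{u<..<v} \<subseteq> S" using that by (rule order_trans[rotated])
      then show ?thesis by (auto simp: indicator_def)
    qed
    have "AE x in lebesgue. indicator {a<..<b} x * d x = 0"
    proof (rule AE_zero_if_ray_integrals_zero)
      show "integrable lebesgue (\<lambda>x. indicator {a<..<b} x * d x)"
        using int_d[of a b] Sl by (simp add: integrable_restrict_space ind)
      show "(LINT x|lebesgue. indicator {a<..<b} x * d x) = 0"
        using zero[OF ab] Sl by (simp add: integral_restrict_space ind)
      fix y
      have "(\<lambda>x. indicator {y<..} x *\<^sub>R (indicator {a<..<b} x * d x)) =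
          (\<lambda>x. indicator {max a y<..<b} x * d x)"
        by (auto simp: indicator_def fun_eq_iff)
      moreover have "(LINT x|lebesgue. indicator {max a y<..<b} x * d x) = 0"
        using zero[of "max a y" b] ab Sl by (simp add: integral_restrict_space ind subset_iff)
      ultimately show "(LINT x:{y<..}|lebesgue. indicator {a<..<b} x * d x) = 0"
        by (simp only: set_lebesgue_integral_def)
    qed
    then show ?thesis by eventually_elim (auto simp: indicator_def)
  qed
  \<comment> \<open>Intervals with rational end points cover \<open>S\<close> and are countably
    many, so the local null sets can be united.\<close>
  have "AE x in lebesgue. \<forall>p\<in>\<rat>. \<forall>q\<in>\<rat>. {p..q} \<subseteq> S \<longrightarrow> x \<in> {p<..<q} \<longrightarrow> d x = 0"
    using local by (intro AE_ball_countable' countable_rat) auto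
  then have "AE x in lebesgue. x \<in> S \<longrightarrow> d x = 0"
  proof eventually_elim
    case (elim x)
    show ?case
    proof
      assume "x \<in> S"
      then obtain e where e: "e > 0" "cball x e \<subseteq> S"
        using S open_contains_cball by blast
      obtain p where p: "p \<in> \<rat>" "x - e < p" "p < x" using Rats_dense_in_real[of "x - e" x] e by auto
      obtain q where q: "q \<in> \<rat>" "x < q" "q < x + e" using Rats_dense_in_real[of x "x + e"] e by auto
      have "{p..q} \<subseteq> S" using e(2) p q by (auto simp: dist_real_def subset_iff)
      then show "d x = 0" using elim p q by auto
    qed
  qed
  then show ?thesis
    using Sl by (simp add: AE_restrict_space_iff d_def)
qed

section \<open>Continuous functions with vanishing second weak derivative\<close>

lemma integral_shift_real:
  fixes f :: "real \<Rightarrow> real"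
  assumes "continuous_on {a + c..b + c} f"
  shows "integral {a + c..b + c} f = integral {a..b} (\<lambda>x. f (x + c))"
proof -
  have "(f has_integral integral {a + c..b + c} f) (cbox (a + c) (b + c))"
    using integrable_integral[OF integrable_continuous_interval[OF assms]] by simp
  from has_integral_affinity'[OF this, of 1 c] show ?thesis by (simp add: integral_unique)
qed

lemma continuous_positive_near:
  fixes e :: "real \<Rightarrow> real"
  assumes "continuous_on {- r..r} e" "r > 0" "e 0 > 0"
  obtains d where "0 < d" "d \<le> r" "\<And>u. \<bar>u\<bar> \<le> d \<Longrightarrow> e u > 0"
proof -
  have "isCont e 0" using assms by (intro continuous_on_interior) (auto simp: continuous_on_eq_continuous_within)
  then have "\<forall>\<^sub>F u in nhds 0. e u > 0"
    using assms(3) by (intro order_tendstoD(1)) (auto simp: isCont_def tendsto_at_iff_tendsto_nhds)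
  then obtain d where d: "d > 0" "\<And>u. dist u 0 < d \<Longrightarrow> e u > 0"
    unfolding eventually_nhds_metric by blast
  show ?thesis
    by (rule that[of "min (d / 2) r"]) (use d assms in auto)
qed

definition mollifier :: "real \<Rightarrow> real \<Rightarrow> real" where
  "mollifier d = bump [:d\<^sup>2, 0, - 1:]"

lemma mollifier_pos: "\<bar>u\<bar> < d \<Longrightarrow> mollifier d u > 0"
  using abs_square_le_1 power_strict_mono[of "\<bar>u\<bar>" d 2]
  by (auto simp: mollifier_def power2_eq_square intro!: bump_pos)

lemma mollifier_nonneg: "mollifier d u \<ge> 0"
  by (simp add: mollifier_def bump_nonneg)

lemma mollifier_eq_0: "d > 0 \<Longrightarrow> \<bar>u\<bar> \<ge> d \<Longrightarrow> mollifier d u = 0"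
  using power_mono[of d "\<bar>u\<bar>" 2] by (auto simp: mollifier_def power2_eq_square intro!: bump_eq_0)

lemma mollifier_shift_test_function:
  assumes "d > 0" "{s - d..s + d} \<subseteq> S"
  shows "(\<lambda>t. mollifier d (t - s)) \<in> test_functions S"
proof -
  have "(\<lambda>t. mollifier d (t - s)) = bump [:d\<^sup>2 - s\<^sup>2, 2 * s, - 1:]"
    by (rule ext) (simp add: mollifier_def bump_term_def power2_eq_square algebra_simps)
  moreover have "bump [:d\<^sup>2 - s\<^sup>2, 2 * s, - 1:] \<in> test_functions S"
  proof (rule bump_test_function[of "{s - d..s + d}"])
    fix x assume "x \<notin> {s - d..s + d}"
    then have "d \<le> \<bar>x - s\<bar>" by auto
    then have "d\<^sup>2 \<le> (x - s)\<^sup>2" using assms(1) power_mono[of d "\<bar>x - s\<bar>" 2] by auto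
    then show "poly [:d\<^sup>2 - s\<^sup>2, 2 * s, - 1:] x \<le> 0"
      by (simp add: power2_eq_square algebra_simps)
  qed (use assms in auto)
  ultimately show ?thesis by simp
qed

lemma mollifier_DERIV:
  obtains B1 B2 where "\<And>u. (mollifier d has_real_derivative B1 u) (at u)"
    "\<And>u. (B1 has_real_derivative B2 u) (at u)" "continuous_on UNIV B1" "continuous_on UNIV B2"
proof -
  define q :: "real poly" where "q = [:d\<^sup>2, 0, - 1:]"
  define p where "p = bump_num 1 0 q"
  have c: "continuous_on UNIV (bump_term p k q)" for p k
    by (intro continuous_at_imp_continuous_on ballI DERIV_isCont[OF DERIV_bump_term])
  show ?thesis
    by (rule that[of "bump_term p 2 q" "bump_term (bump_num p 2 q) 4 q"])
       (use DERIV_bump_term[of 1 0 q] DERIV_bump_term[of p 2 q] c in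
         \<open>auto simp: mollifier_def q_def p_def numeral_2_eq_2 numeral_eq_Suc\<close>)
qed

lemma DERIV_convolution:
  fixes B B1 h :: "real \<Rightarrow> real"
  assumes "\<And>u. (B has_real_derivative B1 u) (at u)" "continuous_on UNIV B1" "continuous_on {a..b} h"
  shows "((\<lambda>s. integral {a..b} (\<lambda>t. B (t - s) * h t)) has_real_derivative
           integral {a..b} (\<lambda>t. - B1 (t - s) * h t)) (at s)"
proof -
  have cB: "continuous_on UNIV B"
    by (intro continuous_at_imp_continuous_on ballI DERIV_isCont[OF assms(1)])
  have "((\<lambda>s. integral (cbox a b) (\<lambda>t. B (t - s) * h t)) has_real_derivative
           integral (cbox a b) (\<lambda>t. - B1 (t - s) * h t)) (at s within UNIV)"
  proof (rule leibniz_rule_field_derivative)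
    fix s t
    have "((\<lambda>s. B (t - s)) has_real_derivative B1 (t - s) * (0 - 1)) (at s)"
      by (intro DERIV_chain2[OF assms(1)] DERIV_diff DERIV_const DERIV_ident)
    then show "((\<lambda>s. B (t - s) * h t) has_real_derivative - B1 (t - s) * h t) (at s within UNIV)"
      by (auto intro: DERIV_cmult_right[THEN DERIV_cong])
  next
    fix s
    show "(\<lambda>t. B (t - s) * h t) integrable_on cbox a b"
      using assms(3)
      by (intro integrable_continuous continuous_intros continuous_on_compose2[OF cB]) auto
  next
    show "continuous_on (UNIV \<times> cbox a b) (\<lambda>(s, t). - B1 (t - s) * h t)"
      unfolding case_prod_unfold
      by (intro continuous_intros continuous_on_compose2[OF assms(2)] continuous_on_compose2[OF assms(3)])
         auto
  qed auto
  then show ?thesis by simp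
qed

lemma second_derivative_zero_imp_affine:
  fixes H :: "real \<Rightarrow> real"
  assumes d: "\<And>s. (H has_real_derivative H1 s) (at s)" "\<And>s. (H1 has_real_derivative H2 s) (at s)"
    and z: "\<And>s. s \<in> {x..y} \<Longrightarrow> H2 s = 0" and xy: "x \<le> y"
  obtains k m where "\<And>s. s \<in> {x..y} \<Longrightarrow> H s = k + m * s"
proof -
  have "\<exists>c. \<forall>s\<in>{x..y}. H1 s = c"
  proof (rule has_field_derivative_zero_constant)
    fix s assume "s \<in> {x..y}"
    then show "(H1 has_real_derivative 0) (at s within {x..y})"
      using d(2)[of s] z by (simp add: has_field_derivative_at_within)
  qed simp
  then obtain m where m: "\<And>s. s \<in> {x..y} \<Longrightarrow> H1 s = m" by blast
  have "\<exists>c. \<forall>s\<in>{x..y}. H s - m * s = c"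
  proof (rule has_field_derivative_zero_constant)
    fix s assume s: "s \<in> {x..y}"
    have "((\<lambda>s. H s - m * s) has_real_derivative H1 s - m * 1) (at s)"
      by (intro DERIV_diff d DERIV_cmult DERIV_ident)
    then show "((\<lambda>s. H s - m * s) has_real_derivative 0) (at s within {x..y})"
      using m[OF s] by (simp add: has_field_derivative_at_within)
  qed simp
  then obtain k where "\<And>s. s \<in> {x..y} \<Longrightarrow> H s - m * s = k" by blast
  then have "\<And>s. s \<in> {x..y} \<Longrightarrow> H s = k + m * s" by fastforce
  then show ?thesis by (rule that)
qed

text \<open>Convolution of \<open>h\<close> with a mollifier is affine, and in this form the normalisation of the
  mollifier plays no role: the three-point defect of \<open>h\<close> has weighted mean zero over all shifts.\<close>

lemma weakly_affine_three_point_le: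
  fixes h :: "real \<Rightarrow> real"
  assumes S: "open S" "is_interval S" and cont: "continuous_on S h"
    and weak: "\<And>\<eta>. \<eta> \<in> test_functions S \<Longrightarrow> (LINT t|lebesgue_on S. (deriv ^^ 2) \<eta> t * h t) = 0"
    and xyz: "x \<in> S" "y \<in> S" "x < z" "z < y"
  shows "(y - x) * h z - (y - z) * h x - (z - x) * h y \<le> 0"
proof (rule ccontr)
  obtain r1 where r1: "r1 > 0" "cball x r1 \<subseteq> S" using S(1) xyz(1) open_contains_cball by blast
  obtain r2 where r2: "r2 > 0" "cball y r2 \<subseteq> S" using S(1) xyz(2) open_contains_cball by blast
  define r where "r = min r1 r2"
  define a where "a = x - r"
  define b where "b = y + r"
  have r: "r > 0" using r1 r2 by (simp add: r_def)
  have "a \<in> S" "b \<in> S"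
    using r1 r2 r by (auto simp: a_def b_def r_def dist_real_def subset_iff)
  then have abS: "{a..b} \<subseteq> S"
    using S(2) by (meson atLeastAtMost_iff mem_is_interval_1_I subsetI)
  have conth: "continuous_on {a..b} h" using cont abS continuous_on_subset by blast
  have Sl: "S \<in> sets lebesgue" using S by auto
  define e where "e u = (y - x) * h (z + u) - (y - z) * h (x + u) - (z - x) * h (y + u)" for u
  have conth': "continuous_on {- r..r} (\<lambda>u. h (s + u))" if "s \<in> {x..y}" for s
    using that by (intro continuous_on_compose2[OF conth] continuous_intros) (auto simp: a_def b_def)
  have conte: "continuous_on {- r..r} e"
    unfolding e_def using xyz by (intro continuous_intros conth') auto
  assume "\<not> (y - x) * h z - (y - z) * h x - (z - x) * h y \<le> 0"
  then have "e 0 > 0" by (simp add: e_def)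
  from continuous_positive_near[OF conte r this]
  obtain d where d: "0 < d" "d \<le> r" "\<And>u. \<bar>u\<bar> \<le> d \<Longrightarrow> e u > 0" by blast
  define B where "B = mollifier d"
  obtain B1 B2 where B: "\<And>u. (B has_real_derivative B1 u) (at u)"
    "\<And>u. (B1 has_real_derivative B2 u) (at u)" "continuous_on UNIV B1" "continuous_on UNIV B2"
    by (rule mollifier_DERIV[of d, folded B_def]) (rule that)
  have contB: "continuous_on A B" for A
    using B(1) by (intro continuous_at_imp_continuous_on ballI) (blast intro: DERIV_isCont)
  define H where "H s = integral {a..b} (\<lambda>t. B (t - s) * h t)" for s
  define H1 where "H1 s = integral {a..b} (\<lambda>t. - B1 (t - s) * h t)" for s
  define H2 where "H2 s = integral {a..b} (\<lambda>t. - (- B2 (t - s)) * h t)" for s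
  have dH: "(H has_real_derivative H1 s) (at s)" for s
    unfolding H_def H1_def by (rule DERIV_convolution[OF B(1,3) conth])
  have dH1: "(H1 has_real_derivative H2 s) (at s)" for s
    unfolding H1_def H2_def
    by (rule DERIV_convolution[where B = "\<lambda>u. - B1 u" and ?B1.0 = "\<lambda>u. - B2 u"])
       (auto intro!: DERIV_minus B continuous_on_minus conth)
  have supp: "B (t - s) = 0" if "t \<notin> {s - d<..<s + d}" for t s
    unfolding B_def by (rule mollifier_eq_0) (use that d in auto)
  \<comment> \<open>For a centre in \<open>{x..y}\<close> the shifted mollifier is supported in
    \<open>{a..b}\<close> and is therefore a test function on \<open>S\<close>; \<open>H2 s\<close>
    is its second derivative paired with \<open>h\<close>.\<close>
  have H2: "H2 s = 0" if s: "s \<in> {x..y}" for s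
  proof -
    define \<eta> where "\<eta> t = B (t - s)" for t
    have sub: "{s - d..s + d} \<subseteq> {a..b}" using s d by (auto simp: a_def b_def)
    have \<eta>: "\<eta> \<in> test_functions S"
      unfolding \<eta>_def B_def using sub abS d by (intro mollifier_shift_test_function) auto
    have shift: "((\<lambda>t. t - s) has_real_derivative 1) (at t)" for t
      by (auto intro!: derivative_eq_intros)
    have 1: "(\<eta> has_real_derivative B1 (t - s)) (at t)" for t
      unfolding \<eta>_def using DERIV_chain2[OF B(1) shift] by simp
    then have d1: "deriv \<eta> = (\<lambda>t. B1 (t - s))" by (auto intro: DERIV_imp_deriv)
    have 2: "((\<lambda>t. B1 (t - s)) has_real_derivative B2 (t - s)) (at t)" for t
      using DERIV_chain2[OF B(2) shift] by simp
    then have d2: "(deriv ^^ 2) \<eta> = (\<lambda>t. B2 (t - s))"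
      by (auto simp: numeral_2_eq_2 d1 intro: DERIV_imp_deriv)
    have z: "B2 (t - s) = 0" if "t \<notin> {a..b}" for t
    proof -
      have out: "\<forall>\<^sub>F w in nhds v. w \<in> - {a..b}" if "v \<notin> {a..b}" for v
        using that by (intro eventually_nhds_in_open) auto
      have zB1: "B1 (v - s) = 0" if "v \<notin> {a..b}" for v
      proof -
        have "\<forall>\<^sub>F w in nhds v. \<eta> w = 0"
          using out[OF that] by eventually_elim (use sub supp in \<open>auto simp: \<eta>_def\<close>)
        then have "(\<eta> has_real_derivative 0) (at v)"
          by (rule DERIV_cong_ev[OF refl _ refl, THEN iffD2]) simp
        with 1 show ?thesis by (rule DERIV_unique)
      qed
      have "\<forall>\<^sub>F w in nhds t. B1 (w - s) = 0"
        using out[OF that] by eventually_elim (use zB1 in auto)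
      then have "((\<lambda>w. B1 (w - s)) has_real_derivative 0) (at t)"
        by (rule DERIV_cong_ev[OF refl _ refl, THEN iffD2]) simp
      with 2 show ?thesis by (rule DERIV_unique)
    qed
    have "(LINT t|lebesgue_on S. B2 (t - s) * h t) = integral {a..b} (\<lambda>t. B2 (t - s) * h t)"
      using z abS Sl
      by (intro integral_lebesgue_on_support continuous_intros conth continuous_on_compose2[OF B(4)]) auto
    then show ?thesis using weak[OF \<eta>] by (simp add: d2 H2_def)
  qed
  from xyz have "x \<le> y" by simp
  from second_derivative_zero_imp_affine[OF dH dH1 H2 this]
  obtain k m where km: "\<And>s. s \<in> {x..y} \<Longrightarrow> H s = k + m * s" by blast
  have Hlin: "(y - x) * H z - (y - z) * H x - (z - x) * H y = 0"
    using xyz by (simp add: km algebra_simps)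
  have Hs: "H s = integral {- d..d} (\<lambda>u. B u * h (s + u))" if s: "s \<in> {x..y}" for s
  proof -
    have sub: "{s - d..s + d} \<subseteq> {a..b}" using s d by (auto simp: a_def b_def)
    have c: "continuous_on {a..b} (\<lambda>t. B (t - s) * h t)"
      by (intro continuous_intros conth continuous_on_compose2[OF contB[of UNIV]]) auto
    have "H s = (LINT t|lebesgue_on {a..b}. B (t - s) * h t)"
      unfolding H_def using c by (intro integral_lebesgue_on_support(2)[symmetric]) auto
    also have "\<dots> = integral {- d + s..d + s} (\<lambda>t. B (t - s) * h t)"
    proof (rule integral_lebesgue_on_support(2))
      show "continuous_on {- d + s..d + s} (\<lambda>t. B (t - s) * h t)"
        by (rule continuous_on_subset[OF c]) (use sub in auto)
    qed (use sub supp in auto)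
    also have "\<dots> = integral {- d..d} (\<lambda>u. B (u + s - s) * h (u + s))"
      by (rule integral_shift_real, rule continuous_on_subset[OF c]) (use sub in auto)
    finally show ?thesis by (simp add: add.commute)
  qed
  have int: "(\<lambda>u. B u * h (s + u)) integrable_on {- d..d}" if "s \<in> {x..y}" for s
    using d by (intro integrable_continuous_interval continuous_intros contB
        continuous_on_subset[OF conth'[OF that]]) auto
  have "integral {- d..d} (\<lambda>u. B u * e u) =
     integral {- d..d} (\<lambda>u. (y - x) * (B u * h (z + u)) - (y - z) * (B u * h (x + u))
        - (z - x) * (B u * h (y + u)))"
    by (rule arg_cong[where f = "integral _"]) (auto simp: e_def algebra_simps)
  also have "\<dots> = (y - x) * H z - (y - z) * H x - (z - x) * H y"
  proof -
    have m: "z \<in> {x..y}" "x \<in> {x..y}" "y \<in> {x..y}" using xyz by auto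
    note i = int[OF m(1)] int[OF m(2)] int[OF m(3)]
    have "((\<lambda>u. (y - x) * (B u * h (z + u)) - (y - z) * (B u * h (x + u))
        - (z - x) * (B u * h (y + u))) has_integral
        (y - x) * H z - (y - z) * H x - (z - x) * H y) {- d..d}"
      unfolding Hs[OF m(1)] Hs[OF m(2)] Hs[OF m(3)]
      by (intro has_integral_diff has_integral_mult_right integrable_integral i)
    then show ?thesis by (rule integral_unique)
  qed
  finally have I0: "integral {- d..d} (\<lambda>u. B u * e u) = (y - x) * H z - (y - z) * H x - (z - x) * H y" .
  have cBe: "continuous_on {- d..d} (\<lambda>u. B u * e u)"
    using d by (intro continuous_intros contB continuous_on_subset[OF conte]) auto
  \<comment> \<open>A continuous nonnegative integrand with integral 0 vanishes pointwise. The
    integral is 0 because it is the three-point defect of the affine function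
    \<open>H\<close>.\<close>
  have "B 0 * e 0 = 0"
  proof (rule has_integral_0_cbox_imp_0[of "- d" d "\<lambda>u. B u * e u"])
    show "continuous_on (cbox (- d) d) (\<lambda>u. B u * e u)" using cBe by simp
    show "((\<lambda>u. B u * e u) has_integral 0) (cbox (- d) d)"
      using integrable_integral[OF integrable_continuous_interval[OF cBe]] I0 Hlin by simp
    fix u assume "u \<in> box (- d) d"
    then have "e u > 0" by (intro d) auto
    then show "0 \<le> B u * e u" by (simp add: B_def mollifier_nonneg)
  qed (use d in auto)
  moreover have "B 0 > 0" unfolding B_def using d by (intro mollifier_pos) auto
  ultimately show False using \<open>e 0 > 0\<close> by simp
qed

text \<open>The three-point inequality for \<open>h\<close> and for \<open>- h\<close> gives an
  equality. Two fixed points \<open>c < b\<close> then determine the line, in whichever order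
  \<open>x\<close> lies relative to them.\<close>

lemma weakly_affine_imp_affine:
  fixes h :: "real \<Rightarrow> real"
  assumes S: "open S" "is_interval S" "S \<noteq> {}" and cont: "continuous_on S h"
    and weak: "\<And>\<eta>. \<eta> \<in> test_functions S \<Longrightarrow> (LINT t|lebesgue_on S. (deriv ^^ 2) \<eta> t * h t) = 0"
  obtains k m where "\<And>x. x \<in> S \<Longrightarrow> h x = k + m * x"
proof -
  have three: "(y - x) * h z - (y - z) * h x - (z - x) * h y = 0"
    if "x \<in> S" "y \<in> S" "x < z" "z < y" for x y z
  proof -
    have "(y - x) * (- h z) - (y - z) * (- h x) - (z - x) * (- h y) \<le> 0"
      by (rule weakly_affine_three_point_le[OF S(1,2) continuous_on_minus[OF cont] _ that])
         (simp add: weak)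
    with weakly_affine_three_point_le[OF S(1,2) cont weak that] show ?thesis
      by (simp add: algebra_simps)
  qed
  obtain c where c: "c \<in> S" using S(3) by blast
  then obtain e where e: "e > 0" "cball c e \<subseteq> S" using S(1) open_contains_cball by blast
  define b where "b = c + e"
  have b: "b \<in> S" "c < b" using e by (auto simp: b_def dist_real_def subset_iff)
  define m where "m = (h b - h c) / (b - c)"
  have m: "m * (b - c) = h b - h c" using b by (simp add: m_def)
  have "h x = (h c - m * c) + m * x" if x: "x \<in> S" for x
  proof -
    have "(b - c) * (h x - h c) = (h b - h c) * (x - c)"
    proof -
      consider "x = b" | "x = c" | "x < c" | "c < x" "x < b" | "b < x" by linarith
      then show ?thesis
      proof cases
        case 3 then show ?thesis using three[of x b c] x b by (simp add: algebra_simps)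
      next
        case 4 then show ?thesis using three[of c b x] c b by (simp add: algebra_simps)
      next
        case 5 then show ?thesis using three[of c x b] c x b by (simp add: algebra_simps)
      qed (auto simp: algebra_simps)
    qed
    also have "\<dots> = (b - c) * (m * (x - c))" by (simp only: m[symmetric] mult_ac)
    finally have "h x - h c = m * (x - c)" using b by simp
    then show ?thesis by (simp add: algebra_simps)
  qed
  then show ?thesis by (rule that)
qed

section \<open>The energy coordinate\<close>

text \<open>Writing a solution as \<open>\<phi> = exp (- t / 2)\<close>, the quantity \<open>2 \<phi>\<^sup>2 ln \<phi> - \<phi>\<^sup>2\<close> in the conserved
  energy equals \<open>(amp t)\<^sup>2 - 1\<close>, where \<open>amp\<close> below is a smooth increasing coordinate. It contains the
  remainder quotient \<open>exp_rem\<close>, extended continuously to \<open>t = 0\<close>.\<close>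

definition exp_rem :: "real \<Rightarrow> real" where
  "exp_rem t = (if t = 0 then 1 / 2 else (exp t - 1 - t) / t\<^sup>2)"

lemma exp_rem_sq: "exp_rem t * t\<^sup>2 = exp t - 1 - t"
  by (simp add: exp_rem_def)

text \<open>Square exp (t / 2) \<ge> 1 + t / 2; the range of \<open>t\<close> keeps the right-hand
  side nonnegative.\<close>

lemma exp_quadratic_lower:
  fixes t :: real
  assumes "t \<ge> -2"
  shows "exp t - 1 - t \<ge> t\<^sup>2 / 4"
proof -
  have "(1 + t / 2)\<^sup>2 \<le> (exp (t / 2))\<^sup>2"
    using assms exp_ge_add_one_self[of "t / 2"] by (intro power_mono) auto
  also have "\<dots> = exp t"
    by (simp add: power2_eq_square exp_add[symmetric])
  finally show ?thesis
    by (simp add: power2_eq_square field_simps)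
qed

lemma exp_rem_ge: "t \<ge> -2 \<Longrightarrow> exp_rem t \<ge> 1 / 4"
  using exp_quadratic_lower[of t] by (auto simp: exp_rem_def field_simps)

lemma exp_rem_pos: "exp_rem t > 0"
proof (cases "t \<ge> -2")
  case True
  then show ?thesis using exp_rem_ge[of t] by linarith
next
  case False
  then have "exp t - 1 - t > 0" using exp_gt_zero[of t] by linarith
  then show ?thesis by (auto simp: exp_rem_def)
qed

lemma DERIV_exp_rem:
  assumes "t \<noteq> 0"
  shows "(exp_rem has_real_derivative ((t - 2) * exp t + t + 2) / t ^ 3) (at t)"
proof -
  have "((\<lambda>t. (exp t - 1 - t) / t\<^sup>2) has_real_derivative ((t - 2) * exp t + t + 2) / t ^ 3) (at t)"
    using assms by (auto intro!: derivative_eq_intros simp: field_simps power2_eq_square power3_eq_cube)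
  moreover have "\<forall>\<^sub>F s in nhds t. exp_rem s = (exp s - 1 - s) / s\<^sup>2"
    using t1_space_nhds[OF assms] by eventually_elim (simp add: exp_rem_def)
  ultimately show ?thesis
    by (simp cong: DERIV_cong_ev)
qed

lemma isCont_exp_rem: "isCont exp_rem t"
proof (cases "t = 0")
  case True
  have "((\<lambda>t::real. (exp t - 1 - t) / t\<^sup>2) \<longlongrightarrow> 1 / 2) (at 0)"
    by real_asymp
  then have "(exp_rem \<longlongrightarrow> 1 / 2) (at 0)"
    by (rule Lim_transform_eventually) (auto simp: exp_rem_def eventually_at_filter)
  then show ?thesis using True by (simp add: isCont_def exp_rem_def)
qed (use DERIV_exp_rem DERIV_isCont in blast)

text \<open>The numerator vanishes at 0 and is nondecreasing, its derivative being nonnegative by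
  exp (- t) \<ge> 1 - t. Hence it has the sign of \<open>t\<close>, as \<open>t ^ 3\<close>
  does.\<close>

lemma exp_rem_deriv_nonneg:
  fixes t :: real
  assumes "t \<noteq> 0"
  shows "((t - 2) * exp t + t + 2) / t ^ 3 \<ge> 0"
proof -
  define n where "n \<equiv> \<lambda>t::real. (t - 2) * exp t + t + 2"
  have d: "(n has_real_derivative (t - 1) * exp t + 1) (at t)" for t
    unfolding n_def by (auto intro!: derivative_eq_intros simp: algebra_simps)
  have pos: "(t - 1) * exp t + 1 \<ge> 0" for t :: real
    using exp_ge_add_one_self[of "-t"] exp_gt_zero[of t]
    by (simp add: exp_minus field_simps)
  have mono: "n s \<le> n t" if "s \<le> t" for s t
    using that d pos DERIV_nonneg_imp_nondecreasing[of s t n] by blast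
  have n0: "n 0 = 0" by (simp add: n_def)
  show ?thesis
  proof (cases "t > 0")
    case True
    then show ?thesis using mono[of 0 t] n0 by (auto simp: n_def)
  next
    case False
    then have "n t \<le> 0" "t ^ 3 \<le> 0" using mono[of t 0] n0 assms
      by (auto simp: n_def power_le_zero_eq)
    then show ?thesis by (auto simp: n_def divide_nonpos_nonpos)
  qed
qed

text \<open>The constant is the slope of \<open>exp_rem\<close> at 0, read off from the expansion 1
  / 2 + t / 6 + .... Two monotonicity steps descend from 0: \<open>k1\<close> is nonnegative on the
  negative axis, hence \<open>k\<close> increases there to \<open>k 0 = 0\<close>.\<close>

lemma exp_rem_deriv_le:
  fixes t :: real
  assumes "t < 0"
  shows "((t - 2) * exp t + t + 2) / t ^ 3 \<le> 1 / 6"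
proof -
  define k1 where "k1 \<equiv> \<lambda>t::real. t\<^sup>2 / 2 - (t - 1) * exp t - 1"
  define k where "k \<equiv> \<lambda>t::real. t ^ 3 / 6 - ((t - 2) * exp t + t + 2)"
  have d1: "(k1 has_real_derivative t * (1 - exp t)) (at t)" for t
    unfolding k1_def by (auto intro!: derivative_eq_intros simp: algebra_simps)
  have d: "(k has_real_derivative k1 t) (at t)" for t
    unfolding k_def k1_def by (auto intro!: derivative_eq_intros simp: algebra_simps)
  have "k1 s \<ge> k1 0" if "s \<le> 0" for s
    by (rule DERIV_nonpos_imp_nonincreasing[of s 0 k1])
       (use that d1 in \<open>auto intro!: exI simp: mult_nonpos_nonneg\<close>)
  then have k1: "k1 s \<ge> 0" if "s \<le> 0" for s using that by (fastforce simp: k1_def)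
  have "k t \<le> k 0"
    by (rule DERIV_nonneg_imp_nondecreasing[of t 0 k]) (use assms d k1 in auto)
  then have "t ^ 3 / 6 \<le> (t - 2) * exp t + t + 2" by (simp add: k_def)
  moreover have "t ^ 3 < 0" using assms by (simp add: power_less_zero_eq)
  ultimately show ?thesis by (simp add: field_simps)
qed

text \<open>The derivative formula is singular at 0, so monotonicity is shown on either side and
  joined there by continuity.\<close>

lemma exp_rem_mono: assumes "s \<le> t" shows "exp_rem s \<le> exp_rem t"
proof -
  have cont: "continuous_on {a..b} exp_rem" for a b
    by (intro continuous_at_imp_continuous_on ballI isCont_exp_rem)
  have *: "exp_rem a \<le> exp_rem b" if "a \<le> b" "0 \<notin> {a<..<b}" for a b
    by (rule DERIV_nonneg_imp_increasing_open[OF that(1) _ cont])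
       (use DERIV_exp_rem exp_rem_deriv_nonneg that in \<open>metis greaterThanLessThan_iff\<close>)
  show ?thesis
    using *[of s t] *[of s 0] *[of 0 t] assms by (cases "s \<le> 0 \<and> 0 \<le> t") auto
qed

text \<open>The signed square root of \<open>1 - (1 + t) * exp (- t)\<close>. The explicit factor
  \<open>t\<close> carries the sign and keeps the function differentiable through 0, where the
  radicand has a double zero.\<close>

definition amp :: "real \<Rightarrow> real" where
  "amp t = t * (exp (- t / 2) * sqrt (exp_rem t))"

lemma amp_sq: "(amp t)\<^sup>2 = 1 - (1 + t) * exp (- t)"
proof -
  have "(amp t)\<^sup>2 = (exp (- t / 2))\<^sup>2 * (exp_rem t * t\<^sup>2)"
    using exp_rem_pos[of t] by (simp add: amp_def power_mult_distrib)
  also have "(exp (- t / 2))\<^sup>2 = exp (- t)"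
    by (simp add: power2_eq_square exp_add[symmetric])
  finally show ?thesis
    by (simp add: exp_rem_sq exp_minus field_simps)
qed

lemma amp_0 [simp]: "amp 0 = 0" by (simp add: amp_def)

lemma DERIV_sqrt_exp_rem:
  assumes "t \<noteq> 0"
  shows "((\<lambda>t. sqrt (exp_rem t)) has_real_derivative
           ((t - 2) * exp t + t + 2) / t ^ 3 / (2 * sqrt (exp_rem t))) (at t)"
  using DERIV_chain2[OF DERIV_real_sqrt[OF exp_rem_pos] DERIV_exp_rem[OF assms]]
  by (simp add: field_simps)

text \<open>Away from 0 the formula amounts to the identity (2 - t) R + t R' = 1 for R =
  \<open>exp_rem\<close>. At 0 the cofactor of \<open>t\<close> in \<open>amp\<close> is a
  continuous slope function, so Caratheodory's criterion applies.\<close>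

lemma DERIV_amp: "(amp has_real_derivative exp (- t / 2) / (2 * sqrt (exp_rem t))) (at t)"
proof (cases "t = 0")
  case True
  have "isCont (\<lambda>t. exp (- t / 2) * sqrt (exp_rem t)) 0"
    by (intro continuous_intros isCont_exp_rem) auto
  moreover have "exp (- 0 / 2) * sqrt (exp_rem 0) = 1 / (2 * sqrt (exp_rem 0))"
    by (simp add: exp_rem_def real_sqrt_divide real_div_sqrt)
  ultimately show ?thesis
    unfolding CARAT_DERIV True
    by (intro exI[of _ "\<lambda>t. exp (- t / 2) * sqrt (exp_rem t)"]) (auto simp: amp_def)
next
  case False
  define D where "D = ((t - 2) * exp t + t + 2) / t ^ 3"
  define S where "S = sqrt (exp_rem t)"
  have S: "S > 0" "S * S = exp_rem t" using exp_rem_pos[of t] by (auto simp: S_def)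
  have "(amp has_real_derivative
      exp (- t / 2) * S + t * (- (1 / 2) * exp (- t / 2) * S + exp (- t / 2) * (D / (2 * S)))) (at t)"
    unfolding amp_def[abs_def] S_def D_def
    by (rule derivative_eq_intros DERIV_sqrt_exp_rem[OF False] refl | simp)+
  also have "exp (- t / 2) * S + t * (- (1 / 2) * exp (- t / 2) * S + exp (- t / 2) * (D / (2 * S)))
      = exp (- t / 2) / (2 * S) * ((2 - t) * (S * S) + t * D)"
    using S(1) by (simp add: field_simps)
  also have "(2 - t) * (S * S) + t * D = 1"
    unfolding S(2) D_def exp_rem_def using False
    by (simp add: field_simps power2_eq_square power3_eq_cube)
  finally show ?thesis by (simp add: S_def)
qed

lemma amp_deriv_pos: "exp (- t / 2) / (2 * sqrt (exp_rem t)) > 0"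
  using exp_rem_pos[of t] by simp

lemma strict_mono_amp: "strict_mono amp"
  by (rule strict_monoI, erule DERIV_pos_imp_increasing) (use DERIV_amp amp_deriv_pos in blast)

lemma isCont_amp: "isCont amp t"
  using DERIV_amp DERIV_isCont by blast

text \<open>Here exp (- t / 2) = exp (1 / 2), the peak of the zero-energy Gaussian. This marks the
  end of the range: orbits of radius below 1 stay at \<open>t > - 1\<close>.\<close>

lemma amp_minus_one: "amp (- 1) = - 1"
proof -
  have "(amp (- 1))\<^sup>2 = 1" by (simp add: amp_sq)
  moreover have "amp (- 1) < 0" using strict_monoD[OF strict_mono_amp, of "-1" 0] by simp
  ultimately show ?thesis by (auto simp: power2_eq_1_iff)
qed

lemma amp_less_one: "amp t < 1"
proof (cases "t > 0")
  case True
  then have "(amp t)\<^sup>2 < 1\<^sup>2" by (simp add: amp_sq)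
  then show ?thesis by (rule power2_less_imp_less) simp
next
  case False
  then show ?thesis using strict_mono_less_eq[OF strict_mono_amp, of t 0] by simp
qed

lemma amp_surj:
  assumes "-1 \<le> r" "r < 1"
  shows "\<exists>t. amp t = r"
proof -
  have "((\<lambda>t::real. 1 - (1 + t) * exp (- t)) \<longlongrightarrow> 1) at_top" by real_asymp
  \<comment> \<open>The limit 1 eventually exceeds \<open>\<bar>r\<bar>\<^sup>2\<close> only if
    \<open>\<bar>r\<bar> < 1\<close>; the end point \<open>- 1\<close>, attained at
    \<open>t = - 1\<close>, is carried along as a separate case.\<close>
  then have "\<forall>\<^sub>F t in at_top. \<bar>r\<bar>\<^sup>2 < 1 - (1 + t) * exp (- t) \<or> r = -1"
    using assms by (cases "r = -1") (auto elim!: order_tendstoD(1) simp: abs_square_less_1)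
  then have "\<forall>\<^sub>F t in at_top. (\<bar>r\<bar>\<^sup>2 < 1 - (1 + t) * exp (- t) \<or> r = -1) \<and> t > 0"
    using eventually_gt_at_top[of 0] by eventually_elim auto
  then obtain t where t: "\<bar>r\<bar>\<^sup>2 < (amp t)\<^sup>2 \<or> r = -1" "t > 0"
    by (auto simp: amp_sq dest!: eventually_happens)
  have "amp t > 0" using t(2) strict_monoD[OF strict_mono_amp, of 0 t] by simp
  with t(1) have "r \<le> amp t"
    by (smt (verit) power2_less_imp_less)
  with assms show ?thesis
    using IVT'[of amp "-1" r t] t(2) amp_minus_one isCont_amp
    by (auto intro!: continuous_at_imp_continuous_on)
qed

lemma has_real_derivative_left_inverse:
  fixes f g :: "real \<Rightarrow> real"
  assumes "(f has_real_derivative D) (at x)" "D \<noteq> 0" "\<And>z. isCont f z" "\<And>z. g (f z) = z"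
  shows "(g has_real_derivative 1 / D) (at (f x))"
  unfolding has_field_derivative_def
  by (rule has_derivative_inverse_strong[where S = UNIV and f' = "times D"])
     (use assms in \<open>auto simp: has_field_derivative_def fun_eq_iff
       intro!: continuous_at_imp_continuous_on\<close>)

section \<open>The inverse coordinate and the length covered per unit of angle\<close>

definition amp_inv :: "real \<Rightarrow> real" where
  "amp_inv = inv amp"

lemma amp_inv_amp [simp]: "amp_inv (amp t) = t"
  by (simp add: amp_inv_def inv_f_f strict_mono_imp_inj_on strict_mono_amp)

lemma amp_amp_inv: "-1 \<le> r \<Longrightarrow> r < 1 \<Longrightarrow> amp (amp_inv r) = r"
  using amp_surj by fastforce

lemma amp_inv_0 [simp]: "amp_inv 0 = 0"
  using amp_inv_amp[of 0] by simp

lemma amp_inv_less_iff: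
  assumes "-1 \<le> r" "r < 1" "-1 \<le> s" "s < 1"
  shows "amp_inv r < amp_inv s \<longleftrightarrow> r < s"
  using assms strict_mono_less[OF strict_mono_amp, of "amp_inv r" "amp_inv s"]
  by (simp add: amp_amp_inv)

lemma amp_inv_le_iff:
  assumes "-1 \<le> r" "r < 1" "-1 \<le> s" "s < 1"
  shows "amp_inv r \<le> amp_inv s \<longleftrightarrow> r \<le> s"
  using amp_inv_less_iff[of s r] assms by (auto simp: not_less[symmetric])

lemma amp_inv_gt: "-1 < r \<Longrightarrow> r < 1 \<Longrightarrow> amp_inv r > -1"
  using amp_inv_less_iff[of "-1" r] amp_inv_amp[of "-1"] by (simp add: amp_minus_one)

lemma amp_inv_sq:
  assumes "-1 \<le> r" "r < 1"
  shows "(1 + amp_inv r) * exp (- amp_inv r) = 1 - r\<^sup>2"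
  using amp_sq[of "amp_inv r"] assms by (simp add: amp_amp_inv)

text \<open>Along an orbit, \<open>dx / d\<theta> = transit (- \<rho> cos \<theta>)\<close> for the angle \<open>\<theta>\<close> in the energy circle of
  radius \<open>\<rho>\<close>.\<close>

definition transit :: "real \<Rightarrow> real" where
  "transit r = sqrt (exp_rem (amp_inv r))"

lemma transit_pos: "transit r > 0"
  by (simp add: transit_def exp_rem_pos)

lemma DERIV_amp_inv:
  assumes "-1 \<le> r" "r < 1"
  shows "(amp_inv has_real_derivative 2 * exp (amp_inv r / 2) * transit r) (at r)"
proof -
  have "(amp_inv has_real_derivative 1 / (exp (- amp_inv r / 2) / (2 * sqrt (exp_rem (amp_inv r)))))
     (at (amp (amp_inv r)))"
    using amp_deriv_pos[of "amp_inv r"]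
    by (intro has_real_derivative_left_inverse[OF DERIV_amp] isCont_amp amp_inv_amp) linarith
  then show ?thesis
    using assms by (simp add: amp_amp_inv transit_def exp_minus field_simps)
qed

lemma continuous_on_amp_inv: "continuous_on {-1..<1} amp_inv"
  by (intro continuous_at_imp_continuous_on ballI DERIV_isCont[OF DERIV_amp_inv]) auto

lemma continuous_on_transit: "continuous_on {-1..<1} transit"
proof -
  have "continuous_on UNIV exp_rem"
    by (intro continuous_at_imp_continuous_on ballI isCont_exp_rem)
  then show ?thesis
    unfolding transit_def[abs_def]
    by (intro continuous_intros continuous_on_compose2[OF _ continuous_on_amp_inv]) auto
qed

lemma transit_mono:
  assumes "-1 \<le> r" "r \<le> s" "s < 1"
  shows "transit r \<le> transit s"
  using assms amp_inv_le_iff[of r s] by (auto simp: transit_def intro: exp_rem_mono)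

lemma transit_0: "transit 0 = sqrt (1 / 2)"
  by (simp add: transit_def exp_rem_def)

lemma transit_ge:
  assumes "-1 \<le> r" "r < 1" shows "transit r \<ge> 1 / 2"
proof -
  have "amp_inv r \<ge> -1"
    using amp_inv_le_iff[of "-1" r] amp_inv_amp[of "-1"] assms by (simp add: amp_minus_one)
  then show ?thesis
    using exp_rem_ge[of "amp_inv r"] real_sqrt_le_mono[of "1/4" "exp_rem (amp_inv r)"]
    by (simp add: transit_def real_sqrt_divide)
qed

text \<open>In the variable \<open>t\<close> the slope of \<open>transit\<close> is the quotient of
  the derivatives of \<open>sqrt (exp_rem t)\<close> and \<open>amp t\<close>, which is R' exp (t /
  2) for R = \<open>exp_rem\<close>. For \<open>t < 0\<close> both R' \<le> 1 / 6 and exp (t / 2)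
  \<le> 1.\<close>

lemma transit_diff_le_neg:
  assumes "-1 \<le> r" "r \<le> s" "s < 0"
  shows "transit s - transit r \<le> (s - r) / 6"
proof -
  define g where "g \<equiv> \<lambda>t. sqrt (exp_rem t) - amp t / 6"
  have le: "amp_inv r \<le> amp_inv s" "amp_inv s < 0"
    using assms amp_inv_le_iff[of r s] amp_inv_less_iff[of s 0] by auto
  have "g (amp_inv s) \<le> g (amp_inv r)"
  proof (rule DERIV_nonpos_imp_nonincreasing[OF le(1)])
    fix t assume t: "amp_inv r \<le> t" "t \<le> amp_inv s"
    with le have t0: "t < 0" by linarith
    define D where "D = ((t - 2) * exp t + t + 2) / t ^ 3"
    have "(g has_real_derivative D / (2 * sqrt (exp_rem t))
        - exp (- t / 2) / (2 * sqrt (exp_rem t)) / 6) (at t)"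
      unfolding g_def D_def
      using t0 by (intro DERIV_diff DERIV_cdivide DERIV_amp DERIV_sqrt_exp_rem) auto
    also have "D / (2 * sqrt (exp_rem t)) - exp (- t / 2) / (2 * sqrt (exp_rem t)) / 6
        = (D - exp (- t / 2) / 6) / (2 * sqrt (exp_rem t))"
      by (simp add: diff_divide_distrib)
    finally have dg: "(g has_real_derivative (D - exp (- t / 2) / 6) / (2 * sqrt (exp_rem t))) (at t)" .
    have "D \<le> 1 / 6" unfolding D_def by (rule exp_rem_deriv_le[OF t0])
    moreover have "exp (- t / 2) \<ge> 1" using t0 by simp
    ultimately have "D - exp (- t / 2) / 6 \<le> 0" by linarith
    then have "(D - exp (- t / 2) / 6) / (2 * sqrt (exp_rem t)) \<le> 0"
      using exp_rem_pos[of t] by (intro divide_nonpos_pos) auto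
    with dg show "\<exists>y. (g has_real_derivative y) (at t) \<and> y \<le> 0" by blast
  qed
  then show ?thesis
    using assms by (simp add: g_def transit_def amp_amp_inv)
qed

section \<open>The half-length of the ring\<close>

definition travel :: "real \<Rightarrow> real \<Rightarrow> real" where
  "travel \<rho> b = integral {0..b} (\<lambda>s. transit (- \<rho> * cos s))"

lemma rho_cos_bounds:
  fixes \<rho> s :: real
  assumes "0 \<le> \<rho>" "\<rho> < 1"
  shows "- 1 < - \<rho> * cos s" "- \<rho> * cos s < 1"
proof -
  have "\<bar>\<rho> * cos s\<bar> \<le> \<bar>\<rho>\<bar> * 1"
    unfolding abs_mult by (intro mult_left_mono) auto
  with assms show "- 1 < - \<rho> * cos s" "- \<rho> * cos s < 1" by auto
qed

lemma continuous_on_transit_cos: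
  assumes "0 \<le> \<rho>" "\<rho> < 1"
  shows "continuous_on S (\<lambda>s. transit (- \<rho> * cos s))"
  by (intro continuous_on_compose2[OF continuous_on_transit] continuous_intros)
     (use rho_cos_bounds[OF assms] in \<open>auto simp: less_imp_le\<close>)

lemma transit_cos_integrable:
  assumes "0 \<le> \<rho>" "\<rho> < 1"
  shows "(\<lambda>s. transit (- \<rho> * cos s)) integrable_on {a..b}"
  by (intro integrable_continuous_interval continuous_on_transit_cos assms)

lemma travel_split:
  assumes "0 \<le> \<rho>" "\<rho> < 1" "0 \<le> a" "a \<le> b"
  shows "travel \<rho> b = travel \<rho> a + integral {a..b} (\<lambda>s. transit (- \<rho> * cos s))"
  using Henstock_Kurzweil_Integration.integral_combine[OF assms(3,4) transit_cos_integrable[OF assms(1,2)]]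
  by (simp add: travel_def)

lemma transit_cos_mono:
  assumes "0 \<le> \<rho>" "\<rho> < 1" "0 \<le> \<rho>'" "\<rho>' < 1" "- \<rho> * cos s \<le> - \<rho>' * cos s"
  shows "transit (- \<rho> * cos s) \<le> transit (- \<rho>' * cos s)"
  using rho_cos_bounds(1)[OF assms(1,2), of s] rho_cos_bounds(2)[OF assms(3,4), of s] assms(5)
  by (intro transit_mono) auto

lemma transit_cos_ge:
  assumes "0 \<le> \<rho>" "\<rho> < 1"
  shows "transit (- \<rho> * cos s) \<ge> 1 / 2"
  using rho_cos_bounds[OF assms, of s] by (intro transit_ge) auto

lemma integral_transit_pos:
  assumes "0 \<le> \<rho>" "\<rho> < 1" "a < b"
  shows "integral {a..b} (\<lambda>s. transit (- \<rho> * cos s)) > 0"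
proof -
  have "integral {a..b} (\<lambda>s. 1 / 2) \<le> integral {a..b} (\<lambda>s. transit (- \<rho> * cos s))"
    by (intro integral_le transit_cos_integrable transit_cos_ge assms) auto
  with assms(3) show ?thesis by simp
qed

text \<open>The amplitude at which the orbit through angle \<open>b\<close> meets the vertex condition
  \<open>4 (\<rho> sin b)\<^sup>2 = 1 - (\<rho> cos b)\<^sup>2\<close>.\<close>

definition match_amp :: "real \<Rightarrow> real" where
  "match_amp b = 1 / sqrt (1 + 3 * (sin b)\<^sup>2)"

lemma match_amp_pos: "match_amp b > 0"
  by (simp add: match_amp_def add_pos_nonneg)

lemma match_amp_sq: "(match_amp b)\<^sup>2 = 1 / (1 + 3 * (sin b)\<^sup>2)"
  by (simp add: match_amp_def power_divide)

lemma match_amp_less_one: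
  assumes "0 < b" "b < pi" shows "match_amp b < 1"
proof -
  have "1 < sqrt (1 + 3 * (sin b)\<^sup>2)"
    using sin_gt_zero[OF assms] by (intro real_less_rsqrt) simp
  then show ?thesis
    using less_trans[OF zero_less_one] by (simp only: match_amp_def divide_less_eq_1_pos)
qed

lemma match_amp_iff:
  assumes "\<rho> > 0"
  shows "\<rho> = match_amp b \<longleftrightarrow> 4 * (\<rho> * sin b)\<^sup>2 = 1 - (\<rho> * cos b)\<^sup>2"
proof -
  have pos: "1 + 3 * (sin b)\<^sup>2 > 0" by (simp add: add_pos_nonneg)
  have "\<rho> = match_amp b \<longleftrightarrow> \<rho>\<^sup>2 = (match_amp b)\<^sup>2"
    using assms match_amp_pos[of b] by (simp add: power2_eq_iff_nonneg)
  also have "\<dots> \<longleftrightarrow> \<rho>\<^sup>2 * (1 + 3 * (sin b)\<^sup>2) = 1"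
    using pos by (simp add: match_amp_sq eq_divide_eq)
  also have "\<dots> \<longleftrightarrow> 4 * (\<rho> * sin b)\<^sup>2 = 1 - (\<rho> * cos b)\<^sup>2"
    by (simp add: power_mult_distrib cos_squared_eq algebra_simps)
  finally show ?thesis .
qed

lemma continuous_on_match_amp: "continuous_on S match_amp"
proof -
  have "sqrt (1 + 3 * (sin b)\<^sup>2) \<noteq> 0" for b :: real
    using zero_le_power2[of "sin b"] unfolding real_sqrt_eq_zero_cancel_iff by linarith
  then show ?thesis
    unfolding match_amp_def[abs_def] by (intro continuous_intros) auto
qed

text \<open>The derivative of x + (sin x)^2 is the perfect square (sin x + cos x)^2.\<close>

lemma sin_sq_diff_le:
  fixes a b :: real
  assumes "a \<le> b" shows "(sin a)\<^sup>2 - (sin b)\<^sup>2 \<le> b - a"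
proof -
  have "a + (sin a)\<^sup>2 \<le> b + (sin b)\<^sup>2"
  proof (rule DERIV_nonneg_imp_nondecreasing[OF assms])
    fix x :: real
    have "((\<lambda>x. x + (sin x)\<^sup>2) has_real_derivative (sin x + cos x)\<^sup>2) (at x)"
      by (auto intro!: derivative_eq_intros simp: power2_sum)
    then show "\<exists>y. ((\<lambda>x. x + (sin x)\<^sup>2) has_real_derivative y) (at x) \<and> 0 \<le> y"
      by (blast intro: zero_le_power2)
  qed
  then show ?thesis by simp
qed

lemma sin_antimono_upper:
  assumes "pi / 2 \<le> a" "a \<le> b" "b \<le> pi"
  shows "sin b \<le> sin a"
  using cos_monotone_0_pi_le[of "a - pi / 2" "b - pi / 2"] assms by (simp add: cos_diff)

text \<open>The inverse squares of the amplitudes differ by 3 ((sin a)^2 - (sin b)^2) \<le> 3 (b -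
  a). Since both amplitudes are below 1, this difference is at least twice that of the amplitudes
  themselves, whence 3 / 2.\<close>

lemma match_amp_diff_le:
  assumes "pi / 2 \<le> a" "a \<le> b" "b < pi"
  shows "match_amp a \<le> match_amp b" "match_amp b - match_amp a \<le> 3 / 2 * (b - a)"
proof -
  define p where "p = match_amp a"
  define q where "q = match_amp b"
  have pq: "0 < p" "0 < q" "p < 1" "q < 1"
    using assms pi_gt_zero by (auto simp: p_def q_def match_amp_pos intro!: match_amp_less_one)
  have inv: "1 / p\<^sup>2 - 1 / q\<^sup>2 = 3 * ((sin a)\<^sup>2 - (sin b)\<^sup>2)"
    by (simp add: p_def q_def match_amp_sq)
  have "(sin b)\<^sup>2 \<le> (sin a)\<^sup>2"
    using sin_antimono_upper[OF assms(1,2)] sin_ge_zero[of b] assms pi_gt_zero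
    by (intro power_mono) auto
  then have "1 / q\<^sup>2 \<le> 1 / p\<^sup>2" using inv by simp
  then have "p\<^sup>2 \<le> q\<^sup>2" using pq by (simp add: field_simps)
  then have le: "p \<le> q" using pq by (simp add: power2_le_iff_abs_le)
  then show "match_amp a \<le> match_amp b" by (simp add: p_def q_def)
  have "2 * (q - p) \<le> (q - p) * ((1 / p + 1 / q) * (1 / p * (1 / q)))"
  proof -
    have g: "1 / p \<ge> 1" "1 / q \<ge> 1" using pq by (auto simp: field_simps)
    then have "1 * 1 \<le> 1 / p * (1 / q)" using pq by (intro mult_mono) auto
    moreover have "2 \<le> 1 / p + 1 / q" using g by linarith
    ultimately have "2 * 1 \<le> (1 / p + 1 / q) * (1 / p * (1 / q))"
      using pq by (intro mult_mono) auto
    then have "(q - p) * (2 * 1) \<le> (q - p) * ((1 / p + 1 / q) * (1 / p * (1 / q)))"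
      using le by (intro mult_left_mono) auto
    then show ?thesis by (simp only: mult.commute[of 2] mult_1_right mult_1_left)
  qed
  also have "\<dots> = 1 / p\<^sup>2 - 1 / q\<^sup>2"
    using pq by (simp add: field_simps power2_eq_square)
  also have "\<dots> \<le> 3 * (b - a)"
    using inv sin_sq_diff_le[OF assms(2)] by simp
  finally show "match_amp b - match_amp a \<le> 3 / 2 * (b - a)" by (simp add: p_def q_def)
qed

section \<open>Strict growth and range of the half-length\<close>

definition half_length :: "real \<Rightarrow> real" where
  "half_length b = travel (match_amp b) b"

text \<open>Up to \<open>pi / 2\<close> both effects agree: a larger angle lowers the amplitude,
  which raises \<open>- \<rho> * cos s\<close> and with it \<open>transit\<close>, and it also
  extends the domain of integration.\<close>

lemma half_length_less_lower:
  assumes "0 < a" "a < b" "b \<le> pi / 2"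
  shows "half_length a < half_length b"
proof -
  define p where "p = match_amp a"
  define q where "q = match_amp b"
  have pq: "0 < p" "0 < q" "p < 1" "q < 1"
    using assms pi_gt_zero by (auto simp: p_def q_def match_amp_pos intro!: match_amp_less_one)
  have "sin a \<le> sin b" "0 \<le> sin a"
    using assms by (auto intro!: sin_monotone_2pi_le sin_ge_zero)
  then have "q \<le> p"
    unfolding p_def q_def match_amp_def
    by (intro divide_left_mono) (auto intro!: power_mono add_pos_nonneg mult_pos_pos)
  have "travel p a \<le> travel q a"
    unfolding travel_def
  proof (intro integral_le transit_cos_integrable transit_cos_mono)
    fix s assume "s \<in> {0..a}"
    then have "cos s \<ge> 0" using assms by (intro cos_ge_zero) auto
    then show "- p * cos s \<le> - q * cos s"
      using \<open>q \<le> p\<close> by (simp add: mult_right_mono)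
  qed (use pq in auto)
  also have "\<dots> < travel q b"
    using travel_split[of q a b] integral_transit_pos[of q a b] pq assms by auto
  finally show ?thesis by (simp add: half_length_def p_def q_def)
qed

text \<open>Beyond the angle \<open>pi / 2\<close> a larger amplitude shortens the first quarter of the orbit. This
  loss is beaten by the extra angle travelled, where \<^term>\<open>transit\<close> is at least \<open>sqrt (1 / 2)\<close>.\<close>

lemma half_length_less_upper:
  assumes "pi / 2 \<le> a" "a < b" "b < pi"
  shows "half_length a < half_length b"
proof -
  define p where "p = match_amp a"
  define q where "q = match_amp b"
  have pq: "0 < p" "0 < q" "p < 1" "q < 1"
    using assms pi_gt_zero by (auto simp: p_def q_def match_amp_pos intro!: match_amp_less_one)
  have d: "p \<le> q" "q - p \<le> 3 / 2 * (b - a)"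
    using match_amp_diff_le[of a b] assms by (auto simp: p_def q_def)
  let ?G = "\<lambda>r s. transit (- r * cos s)"
  have int: "?G r integrable_on {x..y}" if "r = p \<or> r = q" for r x y
    using that pq by (intro transit_cos_integrable) auto
  have "integral {0..pi/2} (?G p) \<le> integral {0..pi/2} (\<lambda>s. ?G q s + (q - p) / 6)"
  proof (intro integral_le integrable_add int)
    fix s assume s: "s \<in> {0..pi / 2}"
    show "?G p s \<le> ?G q s + (q - p) / 6"
    \<comment> \<open>The Lipschitz bound needs a negative argument; at \<open>pi / 2\<close> both
      arguments are 0.\<close>
    proof (cases "s = pi / 2")
      case True
      then have "cos s = 0" by (simp only: cos_pi_half)
      then show ?thesis using d by simp
    next
      case False
      then have c: "cos s > 0" using s by (intro cos_gt_zero_pi) auto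
      have "?G p s - ?G q s \<le> (- p * cos s - - q * cos s) / 6"
        using rho_cos_bounds[of q s] pq c d
        by (intro transit_diff_le_neg) (auto simp: mult_right_mono)
      also have "\<dots> = (q - p) * cos s / 6" by (simp add: algebra_simps)
      also have "\<dots> \<le> (q - p) * 1 / 6"
        using d by (intro divide_right_mono mult_left_mono) auto
      finally show ?thesis unfolding mult_1_right by linarith
    qed
  qed auto
  also have "\<dots> = integral {0..pi/2} (?G q) + pi / 2 * ((q - p) / 6)"
    by (subst Henstock_Kurzweil_Integration.integral_add) (use int in \<open>auto simp del: mult_minus_left\<close>)
  also have "\<dots> \<le> integral {0..pi/2} (?G q) + (b - a) / 2"
  proof (rule add_left_mono)
    \<comment> \<open>The loss over a quarter turn: length at most 2, slope 1 / 6 and amplitude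
      change at most 3 / 2 (b - a) multiply to (b - a) / 2.\<close>
    have "pi / 2 * ((q - p) / 6) \<le> 2 * ((q - p) / 6)"
      using d pi_less_4 by (intro mult_right_mono) auto
    also have "\<dots> \<le> (b - a) / 2" using d(2) by (simp add: field_simps)
    finally show "pi / 2 * ((q - p) / 6) \<le> (b - a) / 2" .
  qed
  finally have 1: "integral {0..pi/2} (?G p) \<le> integral {0..pi/2} (?G q) + (b - a) / 2" .
  have cneg: "cos s \<le> 0" if "pi / 2 \<le> s" "s \<le> pi" for s
    using cos_monotone_0_pi_le[of "pi / 2" s] that by simp
  have 2: "integral {pi/2..a} (?G p) \<le> integral {pi/2..a} (?G q)"
  proof (intro integral_le int transit_cos_mono)
    fix s assume "s \<in> {pi/2..a}"
    then have "cos s \<le> 0" using assms by (intro cneg) auto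
    then show "- p * cos s \<le> - q * cos s" using d by (simp add: mult_right_mono_neg)
  qed (use pq in auto)
  have "integral {a..b} (\<lambda>s. sqrt (1 / 2)) \<le> integral {a..b} (?G q)"
  proof (intro integral_le int)
    fix s assume "s \<in> {a..b}"
    then have "cos s \<le> 0" using assms by (intro cneg) auto
    then show "sqrt (1 / 2) \<le> ?G q s"
      unfolding transit_0[symmetric] using pq rho_cos_bounds(2)[of q s]
      by (intro transit_mono) (auto simp: mult_nonneg_nonpos)
  qed auto
  then have 3: "sqrt (1 / 2) * (b - a) \<le> integral {a..b} (?G q)"
    using assms by (simp add: mult.commute)
  \<comment> \<open>This gap between gain and loss per unit of angle makes the inequality
    strict.\<close>
  have "sqrt (1 / 2) > 1 / 2" by (rule real_less_rsqrt) (simp add: power2_eq_square)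
  then have 4: "sqrt (1 / 2) * (b - a) > 1 / 2 * (b - a)"
    using assms by (intro mult_strict_right_mono) auto
  have "travel p a = integral {0..pi/2} (?G p) + integral {pi/2..a} (?G p)"
    using travel_split[of p "pi / 2" a] pq assms by (simp add: travel_def)
  moreover have "travel q b = integral {0..pi/2} (?G q) + integral {pi/2..a} (?G q)
      + integral {a..b} (?G q)"
    using travel_split[of q "pi / 2" a] travel_split[of q a b] pq assms pi_gt_zero
    by (simp add: travel_def)
  moreover have "A + B < A' + B' + C"
    if "A \<le> A' + e / 2" "B \<le> B'" "c \<le> C" "c > 1 / 2 * e" for A B A' B' C c e :: real
    using that by linarith
  ultimately have "travel p a < travel q b"
    using 1 2 3 4 by presburger
  then show ?thesis by (simp add: half_length_def p_def q_def)
qed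

lemma half_length_strict_mono: "strict_mono_on {0<..<pi} half_length"
proof (rule strict_mono_onI)
  fix a b :: real assume ab: "a \<in> {0<..<pi}" "b \<in> {0<..<pi}" "a < b"
  consider "b \<le> pi / 2" | "pi / 2 \<le> a" | "a < pi / 2" "pi / 2 < b" by linarith
  then show "half_length a < half_length b"
  proof cases
    case 3
    then show ?thesis
      using half_length_less_lower[of a "pi / 2"] half_length_less_upper[of "pi / 2" b] ab by auto
  qed (use half_length_less_lower half_length_less_upper ab in auto)
qed

text \<open>In the first quarter \<open>transit\<close> stays below its value at 0, which is below
  1. This supplies the small lengths for the intermediate value theorem.\<close>

lemma half_length_le:
  assumes "0 < b" "b \<le> pi / 2"
  shows "half_length b \<le> b"
proof -
  define q where "q = match_amp b"
  have q: "0 < q" "q < 1"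
    using assms pi_gt_zero by (auto simp: q_def match_amp_pos intro!: match_amp_less_one)
  have "travel q b \<le> integral {0..b} (\<lambda>s. 1)"
    unfolding travel_def
  proof (intro integral_le transit_cos_integrable)
    fix s assume "s \<in> {0..b}"
    then have "cos s \<ge> 0" using assms by (intro cos_ge_zero) auto
    then have "transit (- q * cos s) \<le> transit 0"
      using q rho_cos_bounds(1)[of q s] by (intro transit_mono) auto
    also have "\<dots> \<le> 1" by (simp add: transit_0)
    finally show "transit (- q * cos s) \<le> 1" .
  qed (use q in auto)
  then show ?thesis using assms by (simp add: half_length_def q_def)
qed

text \<open>With \<open>t = amp_inv (- \<rho> cos s)\<close>, the function \<open>sqrt (1 + t)\<close> is the logarithmic slope of the
  Gaussian through the same point, and along the orbit it grows at most at unit speed in the space variable.\<close>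

lemma travel_ge:
  assumes "0 < \<rho>" "\<rho> < 1" "0 \<le> b"
  shows "sqrt (1 + amp_inv (- \<rho> * cos b)) - 1 \<le> travel \<rho> b"
proof -
  define S where "S s = sqrt (1 + amp_inv (- \<rho> * cos s))" for s
  define D where "D s = transit (- \<rho> * cos s) *
     (exp (amp_inv (- \<rho> * cos s) / 2) * (\<rho> * sin s) / S s)" for s
  note bd = rho_cos_bounds[OF less_imp_le[OF assms(1)] assms(2)]
  have gt: "1 + amp_inv (- \<rho> * cos s) > 0" for s
    using amp_inv_gt[OF bd, of s] by simp
  have Spos: "S s > 0" for s using gt by (simp add: S_def)
  have deriv: "(S has_real_derivative D s) (at s)" for s
  proof -
    have 1: "((\<lambda>s. 1 + amp_inv (- \<rho> * cos s)) has_real_derivative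
      2 * exp (amp_inv (- \<rho> * cos s) / 2) * transit (- \<rho> * cos s) * (\<rho> * sin s)) (at s)"
      by (rule derivative_eq_intros DERIV_chain2[OF DERIV_amp_inv] less_imp_le bd refl | simp)+
    show ?thesis
      using DERIV_chain2[OF DERIV_real_sqrt[OF gt] 1]
      unfolding S_def[abs_def] by (rule DERIV_cong) (simp add: D_def S_def field_simps)
  qed
  have "D s \<le> transit (- \<rho> * cos s)" for s
  proof -
    define t where "t = amp_inv (- \<rho> * cos s)"
    have "exp (t / 2) * (\<rho> * sin s) \<le> S s"
      unfolding S_def t_def[symmetric]
    proof (rule real_le_rsqrt)
      \<comment> \<open>Since (sin s)^2 + (cos s)^2 = 1, this is just \<rho>^2 \<le> 1; it is all
        that the unit speed bound rests on.\<close>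
      have "(\<rho> * sin s)\<^sup>2 \<le> 1 - (- \<rho> * cos s)\<^sup>2"
        using assms by (simp add: sin_squared_eq power_mult_distrib algebra_simps power_le_one)
      also have "\<dots> = (1 + t) * exp (- t)"
        unfolding t_def by (rule amp_inv_sq[symmetric]) (use bd in \<open>auto simp: less_imp_le\<close>)
      finally have "exp t * (\<rho> * sin s)\<^sup>2 \<le> 1 + t"
        by (simp add: exp_minus field_simps)
      then show "(exp (t / 2) * (\<rho> * sin s))\<^sup>2 \<le> 1 + t"
        by (simp add: power_mult_distrib power2_eq_square[of "exp (t / 2)"] exp_add[symmetric])
    qed
    then have "exp (t / 2) * (\<rho> * sin s) / S s \<le> 1" using Spos[of s] by simp
    then show ?thesis
      using transit_pos[of "- \<rho> * cos s"]
      unfolding D_def t_def[symmetric] by (metis mult.right_neutral mult_left_mono less_imp_le)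
  qed
  moreover have "(D has_integral S b - S 0) {0..b}"
    using deriv assms
    by (intro fundamental_theorem_of_calculus)
       (auto simp: has_real_derivative_iff_has_vector_derivative[symmetric]
         intro: has_field_derivative_at_within)
  ultimately have "S b - S 0 \<le> travel \<rho> b"
    unfolding travel_def using assms
    by (intro has_integral_le[OF _ integrable_integral[OF transit_cos_integrable]]) auto
  moreover have "amp_inv (- \<rho>) \<le> 0"
    using amp_inv_le_iff[of "- \<rho>" 0] assms by simp
  then have "S 0 \<le> 1" by (simp add: S_def)
  ultimately show ?thesis by (simp add: S_def[of b])
qed

text \<open>Moves the dependence on \<open>b\<close> from the domain into the integrand, so that
  continuity in \<open>b\<close> is continuity of an integral with a parameter.\<close>

lemma half_length_scaled:
  assumes "0 < b" "b < pi"
  shows "half_length b = b * integral {0..1} (\<lambda>u. transit (- match_amp b * cos (b * u)))"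
proof -
  have "((\<lambda>s. transit (- match_amp b * cos s)) has_integral half_length b) {0..b}"
    unfolding half_length_def travel_def using match_amp_less_one[OF assms] match_amp_pos[of b]
    by (intro integrable_integral transit_cos_integrable) auto
  moreover have "(\<lambda>x. x / b) ` {0..b} = {0..1}"
    using assms image_divide_atLeastAtMost[of b 0 b] by simp
  ultimately have "((\<lambda>u. transit (- match_amp b * cos (b * u))) has_integral half_length b / b) {0..1}"
    using has_integral_stretch_real[of _ "half_length b" 0 b b] assms by fastforce
  then show ?thesis using assms by (simp add: integral_unique)
qed

lemma continuous_on_half_length: "continuous_on {0<..<pi} half_length"
proof -
  have "continuous_on ({0<..<pi} \<times> cbox 0 1) (\<lambda>(b, u). transit (- match_amp b * cos (b * u)))"
    unfolding case_prod_unfold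
  proof (rule continuous_on_compose2[OF continuous_on_transit,
        where f = "\<lambda>x. - match_amp (fst x) * cos (fst x * snd x)"])
    show "continuous_on ({0<..<pi} \<times> cbox 0 1) (\<lambda>x. - match_amp (fst x) * cos (fst x * snd x))"
      by (intro continuous_intros continuous_on_compose2[OF continuous_on_match_amp[of UNIV]]) auto
    show "(\<lambda>x. - match_amp (fst x) * cos (fst x * snd x)) ` ({0<..<pi} \<times> cbox 0 1) \<subseteq> {- 1..<1}"
    proof (rule image_subsetI)
      fix x :: "real \<times> real" assume "x \<in> {0<..<pi} \<times> cbox 0 1"
      then show "- match_amp (fst x) * cos (fst x * snd x) \<in> {- 1..<1}"
        using rho_cos_bounds[of "match_amp (fst x)" "fst x * snd x"] match_amp_less_one[of "fst x"]
          match_amp_pos[of "fst x"] by auto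
    qed
  qed
  from integral_continuous_on_param[OF this]
  have "continuous_on {0<..<pi} (\<lambda>b. b * integral {0..1} (\<lambda>u. transit (- match_amp b * cos (b * u))))"
    by (intro continuous_intros) auto
  then show ?thesis
    by (rule continuous_on_eq) (simp add: half_length_scaled)
qed

text \<open>As b tends to pi the amplitude tends to 1, so \<open>- match_amp b * cos b\<close> tends
  to 1 and passes every value of \<open>amp\<close>. The threshold \<open>r\<close> is chosen to
  make the square root in \<open>travel_ge\<close> at least \<bar>L\<bar> + 1, where the 1 pays for
  the constant subtracted there.\<close>

lemma half_length_unbounded: "\<exists>b\<in>{0<..<pi}. half_length b \<ge> L"
proof -
  define r where "r = amp ((\<bar>L\<bar> + 1)\<^sup>2)"
  have "isCont match_amp pi" using continuous_on_match_amp[of UNIV] by (simp add: continuous_on_eq_continuous_at)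
  then have "isCont (\<lambda>b. - match_amp b * cos b) pi" by (intro continuous_intros) auto
  then have "((\<lambda>b. - match_amp b * cos b) \<longlongrightarrow> 1) (at_left pi)"
    by (auto simp: isCont_def match_amp_def intro: tendsto_within_subset)
  then have "\<forall>\<^sub>F b in at_left pi. r < - match_amp b * cos b"
    by (rule order_tendstoD) (simp add: r_def amp_less_one)
  moreover have "\<forall>\<^sub>F b in at_left pi. b \<in> {0<..<pi}"
    by (rule eventually_at_left_real) (rule pi_gt_zero)
  ultimately have "\<forall>\<^sub>F b in at_left pi. r < - match_amp b * cos b \<and> b \<in> {0<..<pi}"
    by eventually_elim auto
  then obtain b where b: "r < - match_amp b * cos b" "0 < b" "b < pi"
    by (auto dest!: eventually_happens simp: trivial_limit_at_left_real)
  define q where "q = match_amp b"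
  have q: "0 < q" "q < 1"
    using b by (auto simp: q_def match_amp_pos intro!: match_amp_less_one)
  have "amp 0 \<le> r" unfolding r_def by (simp only: strict_mono_less_eq[OF strict_mono_amp]) simp
  then have "amp_inv r \<le> amp_inv (- q * cos b)"
    using b(1) rho_cos_bounds(2)[of q b] q by (subst amp_inv_le_iff) (auto simp: q_def)
  then have "(\<bar>L\<bar> + 1)\<^sup>2 \<le> 1 + amp_inv (- q * cos b)"
    by (simp add: r_def)
  then have "\<bar>L\<bar> + 1 \<le> sqrt (1 + amp_inv (- q * cos b))"
    by (rule real_le_rsqrt)
  then have "L \<le> travel q b"
    using travel_ge[OF q, of b] b by simp
  then show ?thesis using b by (auto simp: half_length_def q_def)
qed

lemma half_length_surj:
  assumes "L > 0"
  obtains b where "0 < b" "b < pi" "half_length b = L"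
proof -
  \<comment> \<open>An angle in the first quarter with \<open>a \<le> L\<close>, where the
    half-length is at most \<open>a\<close>.\<close>
  define a where "a = min L (pi / 2)"
  have a: "0 < a" "a \<le> pi / 2" "a \<le> L" using assms by (auto simp: a_def)
  then have la: "half_length a \<le> L" using half_length_le[of a] by linarith
  obtain c where c: "0 < c" "c < pi" "half_length c \<ge> L" using half_length_unbounded[of L] by auto
  show ?thesis
  proof (cases "a \<le> c")
    case True
    have "continuous_on {a..c} half_length"
      by (rule continuous_on_subset[OF continuous_on_half_length]) (use a c in auto)
    with IVT'[of half_length a L c] la c True obtain b where "a \<le> b" "b \<le> c" "half_length b = L"
      by auto
    then show ?thesis using that[of b] a c by auto
  next
    case False
    then have "half_length c < half_length a"
      using strict_mono_onD[OF half_length_strict_mono, of c a] a c pi_gt_zero by auto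
    with la c show ?thesis by linarith
  qed
qed

text \<open>In the angle \<open>\<theta>\<close> the energy level \<open>\<phi>'\<^sup>2 + 2 \<phi>\<^sup>2 ln \<phi> - \<phi>\<^sup>2 = \<rho>\<^sup>2 - 1\<close> becomes a circle of radius
  \<open>\<rho>\<close>: with \<open>\<phi> = exp (- t / 2)\<close> one has \<open>\<phi>' = - \<rho> sin \<theta>\<close> and \<open>amp t = - \<rho> cos \<theta>\<close>.\<close>

lemma ring_profile:
  assumes "0 < \<rho>" "\<rho> < 1"
  obtains \<theta> \<phi> :: "real \<Rightarrow> real" where
    "\<And>x. \<theta> (- x) = - \<theta> x" "strict_mono \<theta>"
    "\<And>x. 0 \<le> x \<Longrightarrow> travel \<rho> (\<theta> x) = x" "\<And>b. 0 \<le> b \<Longrightarrow> \<theta> (travel \<rho> b) = b"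
    "\<And>x. \<phi> x = exp (- amp_inv (- \<rho> * cos (\<theta> x)) / 2)"
    "\<And>x. (\<phi> has_real_derivative - \<rho> * sin (\<theta> x)) (at x)"
    "\<And>x. ((\<lambda>x. - \<rho> * sin (\<theta> x)) has_real_derivative - 2 * \<phi> x * ln (\<phi> x)) (at x)"
proof -
  define G where "G s = transit (- \<rho> * cos s)" for s
  note bd = rho_cos_bounds[OF less_imp_le[OF assms(1)] assms(2)]
  have contG: "isCont G s" for s
    using continuous_on_transit_cos[of \<rho> UNIV] assms
    by (simp add: G_def[abs_def] continuous_on_eq_continuous_at)
  \<comment> \<open>An antiderivative on the whole line, rather than \<open>travel\<close> on
    nonnegative angles, so that its inverse also covers the left half of the ring.\<close>
  have "\<exists>F. \<forall>x. (F has_real_derivative G x) (at x)"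
    using einterval_antiderivative[of "-\<infinity>" "\<infinity>" G] contG
    by (simp add: has_real_derivative_iff_has_vector_derivative)
  then obtain F where F: "\<And>x. (F has_real_derivative G x) (at x)" by blast
  define X where "X s = F s - F 0" for s
  have dX: "(X has_real_derivative G s) (at s)" for s
    unfolding X_def[abs_def] using DERIV_diff[OF F DERIV_const] by simp
  have Gge: "G s \<ge> 1 / 2" for s
    unfolding G_def using bd[of s] by (intro transit_ge) auto
  have Gpos: "G s > 0" for s by (simp add: G_def transit_pos)
  have smX: "strict_mono X"
    by (rule strict_monoI, erule DERIV_pos_imp_increasing) (use dX Gpos in blast)
  have oddX: "X (- s) = - X s" for s
  proof -
    have "((\<lambda>s. X (- s) + X s) has_real_derivative 0) (at s)" for s
      by (rule derivative_eq_intros DERIV_chain2[OF dX] dX refl)+ (simp add: G_def)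
    then have "X (- s) + X s = X (- 0) + X 0"
      by (intro DERIV_isconst_all[of "\<lambda>s. X (- s) + X s"]) auto
    then show ?thesis by (simp add: X_def)
  qed
  \<comment> \<open>The lower bound 1 / 2 on \<open>transit\<close> forces linear growth; this makes
    the position surjective and the profile global.\<close>
  have Xge: "X s \<ge> s / 2" if "s \<ge> 0" for s
  proof -
    have "X 0 - 0 / 2 \<le> X s - s / 2"
    proof (rule DERIV_nonneg_imp_nondecreasing[OF that])
      fix x show "\<exists>y. ((\<lambda>s. X s - s / 2) has_real_derivative y) (at x) \<and> 0 \<le> y"
        by (rule exI[of _ "G x - 1 / 2"]) (use Gge in \<open>auto intro!: derivative_eq_intros dX\<close>)
    qed
    then show ?thesis by (simp add: X_def)
  qed
  have contX: "isCont X s" for s using dX DERIV_isCont by blast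
  have pre: "\<exists>s. X s = x" if "x \<ge> 0" for x
  proof -
    have "continuous_on {0..2 * x} X" by (intro continuous_at_imp_continuous_on ballI contX)
    moreover have "X 0 \<le> x" using that by (simp add: X_def)
    ultimately show ?thesis
      using IVT'[of X 0 x "2 * x"] Xge[of "2 * x"] that by auto
  qed
  have surjX: "\<exists>s. X s = x" for x
  proof (cases "x \<ge> 0")
    case False
    then obtain s where "X s = - x" using pre[of "- x"] by auto
    then have "X (- s) = x" by (simp add: oddX)
    then show ?thesis ..
  qed (rule pre)
  define \<theta> where "\<theta> = inv X"
  have \<theta>X: "\<theta> (X s) = s" for s
    by (simp add: \<theta>_def inv_f_f strict_mono_imp_inj_on smX)
  have X\<theta>: "X (\<theta> x) = x" for x using surjX[of x] \<theta>X by auto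
  have d\<theta>: "(\<theta> has_real_derivative 1 / G (\<theta> x)) (at x)" for x
    using has_real_derivative_left_inverse[OF dX _ contX \<theta>X, of "\<theta> x"] Gpos[of "\<theta> x"]
    by (simp add: X\<theta>)
  have odd\<theta>: "\<theta> (- x) = - \<theta> x" for x
    by (metis \<theta>X X\<theta> oddX)
  have sm\<theta>: "strict_mono \<theta>"
    by (rule strict_monoI) (metis X\<theta> smX strict_mono_less)
  have travelX: "travel \<rho> b = X b" if "b \<ge> 0" for b
  proof -
    have "(G has_integral X b - X 0) {0..b}"
      using dX that
      by (intro fundamental_theorem_of_calculus)
         (auto simp: has_real_derivative_iff_has_vector_derivative[symmetric]
           intro: has_field_derivative_at_within)
    then show ?thesis by (simp add: travel_def G_def[abs_def] X_def integral_unique)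
  qed
  have \<theta>0: "\<theta> 0 = 0" using odd\<theta>[of 0] by simp
  define t where "t x = amp_inv (- \<rho> * cos (\<theta> x))" for x
  define \<phi> where "\<phi> x = exp (- t x / 2)" for x
  have dt: "(t has_real_derivative 2 * exp (t x / 2) * (\<rho> * sin (\<theta> x))) (at x)" for x
  proof -
    have "((\<lambda>x. - \<rho> * cos (\<theta> x)) has_real_derivative \<rho> * sin (\<theta> x) / G (\<theta> x)) (at x)"
      by (rule derivative_eq_intros d\<theta> refl)+ simp
    from DERIV_chain2[OF DERIV_amp_inv this] bd[of "\<theta> x"] Gpos[of "\<theta> x"] show ?thesis
      by (simp add: t_def[abs_def] G_def less_imp_le mult.assoc)
  qed
  have d\<phi>: "(\<phi> has_real_derivative - \<rho> * sin (\<theta> x)) (at x)" for x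
  proof -
    have "((\<lambda>x. - t x / 2) has_real_derivative - (exp (t x / 2) * (\<rho> * sin (\<theta> x)))) (at x)"
      using DERIV_cdivide[OF DERIV_minus[OF dt[of x]], of 2] by simp
    from DERIV_chain2[OF DERIV_exp this] show ?thesis
      by (simp add: \<phi>_def[abs_def] exp_minus mult.assoc[symmetric])
  qed
  have d\<phi>1: "((\<lambda>x. - \<rho> * sin (\<theta> x)) has_real_derivative - 2 * \<phi> x * ln (\<phi> x)) (at x)" for x
  proof -
    have 1: "((\<lambda>x. - \<rho> * sin (\<theta> x)) has_real_derivative - \<rho> * (cos (\<theta> x) / G (\<theta> x))) (at x)"
      by (rule derivative_eq_intros d\<theta> refl)+ simp
    have "- \<rho> * cos (\<theta> x) = amp (t x)"
      using bd[of "\<theta> x"] by (simp add: t_def amp_amp_inv less_imp_le)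
    \<comment> \<open>By construction \<open>amp\<close> is \<open>t * exp (- t / 2)\<close> times
      the density \<open>G\<close>; dividing by \<open>G\<close> leaves
      \<open>t * exp (- t / 2)\<close>, which is \<open>- 2 * \<phi> * ln \<phi>\<close>.\<close>
    also have "\<dots> = t x * (exp (- t x / 2) * G (\<theta> x))"
      by (simp add: amp_def G_def transit_def t_def)
    finally have "- \<rho> * (cos (\<theta> x) / G (\<theta> x)) = - 2 * \<phi> x * ln (\<phi> x)"
      using Gpos[of "\<theta> x"] by (simp add: \<phi>_def field_simps)
    then show ?thesis using 1 by simp
  qed
  have "travel \<rho> (\<theta> x) = x" if "0 \<le> x" for x
    using travelX[of "\<theta> x"] X\<theta> \<theta>0 strict_mono_less_eq[OF sm\<theta>, of 0 x] that by simp
  moreover have "\<theta> (travel \<rho> b) = b" if "0 \<le> b" for b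
    using travelX[OF that] \<theta>X by simp
  ultimately show ?thesis
    using that[OF odd\<theta> sm\<theta> _ _ _ d\<phi> d\<phi>1] by (simp add: \<phi>_def t_def)
qed

section \<open>Regularity of weak solutions\<close>

text \<open>Derivatives are taken within the closed edge, hence one-sided at its end points, where
  the vertex condition reads them. They are explicit arguments so that an equation can be put in the
  place of \<open>f2\<close>.\<close>

definition C2_edge :: "real set \<Rightarrow> (real \<Rightarrow> real) \<Rightarrow> (real \<Rightarrow> real) \<Rightarrow> (real \<Rightarrow> real) \<Rightarrow> bool" where
  "C2_edge T f f1 f2 \<longleftrightarrow>
     (\<forall>x\<in>T. (f has_real_derivative f1 x) (at x within T)) \<and>
     (\<forall>x\<in>T. (f1 has_real_derivative f2 x) (at x within T)) \<and> continuous_on T f2"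

lemma global_antiderivative:
  fixes q :: "real \<Rightarrow> real"
  assumes "continuous_on UNIV q"
  obtains Q where "\<And>x. (Q has_real_derivative q x) (at x)"
  using einterval_antiderivative[of "-\<infinity>" "\<infinity>" q] assms
  by (auto simp: has_real_derivative_iff_has_vector_derivative continuous_on_eq_continuous_at)

lemma test_function_times_integrable:
  fixes f :: "real \<Rightarrow> real"
  assumes S: "open S" "is_interval S" "S \<noteq> {}" and "\<eta> \<in> test_functions S" "continuous_on S f"
  shows "integrable (lebesgue_on S) (\<lambda>x. \<eta> x * f x)"
proof -
  obtain K where K: "compact K" "K \<subseteq> S" "\<And>x. x \<notin> K \<Longrightarrow> \<eta> x = 0"
    using assms(4) unfolding test_functions_def by blast
  obtain a b where ab: "a < b" "{a..b} \<subseteq> S" "K \<subseteq> {a<..<b}"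
    using compact_subset_open_interval[OF S K(1,2)] by blast
  have z: "\<eta> x = 0" if "x \<notin> {a..b}" for x
    using that ab(3) by (intro K(3)) auto
  show ?thesis
    using ab S z assms(5)
    by (intro integral_lebesgue_on_support(1)[of a b] continuous_intros
        test_function_continuous[OF assms(4)] continuous_on_subset[OF assms(5)]) auto
qed

text \<open>Subtracting a classical second antiderivative of the right-hand side leaves a weakly affine
  function.\<close>

lemma H2_regularity:
  fixes f q v :: "real \<Rightarrow> real"
  assumes S: "open S" "is_interval S" "S \<noteq> {}"
    and contf: "continuous_on (closure S) f" and contq: "continuous_on (closure S) q"
    and v: "v \<in> L2 S" "is_weak_deriv 2 S f v" and vq: "AE x in lebesgue_on S. v x = q x"
  obtains f1 where "C2_edge (closure S) f f1 q"
proof -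
  let ?T = "closure S"
  have T: "convex ?T" "closed ?T" "?T \<noteq> {}" "S \<subseteq> ?T"
    using S(3) closure_subset[of S] by (auto intro: convex_closure[OF is_interval_convex[OF S(2)]])
  \<comment> \<open>Projection onto the closed edge extends \<open>q\<close> continuously to the
    line, so that its antiderivatives are defined beyond the end points.\<close>
  define qe where "qe x = q (closest_point ?T x)" for x
  have qe: "qe x = q x" if "x \<in> ?T" for x
    using that by (simp add: qe_def closest_point_self)
  have contqe: "continuous_on UNIV qe"
    unfolding qe_def
    by (intro continuous_on_compose2[OF contq] continuous_on_closest_point T)
       (use T closest_point_in_set in auto)
  obtain Q1 where Q1: "\<And>x. (Q1 has_real_derivative qe x) (at x)"
    by (rule global_antiderivative[OF contqe]) (rule that)
  have contQ1: "continuous_on A Q1" for A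
    using Q1 by (intro continuous_at_imp_continuous_on ballI) (blast intro: DERIV_isCont)
  obtain Q where Q: "\<And>x. (Q has_real_derivative Q1 x) (at x)"
    by (rule global_antiderivative[OF contQ1]) (rule that)
  have contQ: "continuous_on A Q" for A
    using Q by (intro continuous_at_imp_continuous_on ballI) (blast intro: DERIV_isCont)
  have "is_weak_deriv (Suc 0) S Q Q1"
    by (rule is_weak_deriv_Suc[OF S is_weak_deriv_0 Q contQ1])
  then have wQ: "is_weak_deriv 2 S Q qe"
    unfolding numeral_2_eq_2
    by (rule is_weak_deriv_Suc[OF S _ Q1]) (rule continuous_on_subset[OF contqe subset_UNIV])
  have contfS: "continuous_on S f" using contf T(4) continuous_on_subset by blast
  have "(LINT x|lebesgue_on S. (deriv ^^ 2) \<eta> x * (f x - Q x)) = 0" if \<eta>: "\<eta> \<in> test_functions S" for \<eta>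
  proof -
    have \<eta>2: "(deriv ^^ 2) \<eta> \<in> test_functions S" using \<eta> by (rule funpow_deriv_test_function)
    have Sl: "S \<in> sets lebesgue" using S by auto
    have "(LINT x|lebesgue_on S. \<eta> x * v x) = (LINT x|lebesgue_on S. \<eta> x * qe x)"
    proof (rule integral_cong_AE)
      have "\<eta> \<in> borel_measurable (lebesgue_on S)"
        by (intro continuous_imp_measurable_on_sets_lebesgue test_function_continuous[OF \<eta>] Sl)
      moreover have "v \<in> borel_measurable (lebesgue_on S)" using v by (simp add: L2_def)
      ultimately show "(\<lambda>x. \<eta> x * v x) \<in> borel_measurable (lebesgue_on S)" by simp
      show "(\<lambda>x. \<eta> x * qe x) \<in> borel_measurable (lebesgue_on S)"
        by (intro continuous_imp_measurable_on_sets_lebesgue continuous_intros Sl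
            test_function_continuous[OF \<eta>] continuous_on_subset[OF contqe]) auto
      have "AE x in lebesgue_on S. x \<in> S" using Sl by (intro AE_I2) auto
      with vq show "AE x in lebesgue_on S. \<eta> x * v x = \<eta> x * qe x"
        by eventually_elim (use T(4) qe in auto)
    qed
    then have "(LINT x|lebesgue_on S. (deriv ^^ 2) \<eta> x * f x) =
        (LINT x|lebesgue_on S. (deriv ^^ 2) \<eta> x * Q x)"
      using v(2) wQ \<eta> by (simp add: is_weak_deriv_def)
    then show ?thesis
      using test_function_times_integrable[OF S \<eta>2 contfS] test_function_times_integrable[OF S \<eta>2 contQ]
      by (simp add: right_diff_distrib)
  qed
  from weakly_affine_imp_affine[OF S continuous_on_diff[OF contfS contQ] this]
  obtain k m where km: "\<And>x. x \<in> S \<Longrightarrow> f x - Q x = k + m * x" by blast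
  \<comment> \<open>Affinity is known on the open edge only; continuity carries it to the end
    points, where one-sided derivatives are wanted.\<close>
  have const: "f x - Q x - m * x = k" if "x \<in> ?T" for x
    by (rule continuous_constant_on_closure[OF _ _ that])
       (use km in \<open>auto intro!: continuous_intros contf contQ\<close>)
  have eq: "f x = Q x + m * x + k" if "x \<in> ?T" for x
    using const[OF that] by linarith
  have "(f has_real_derivative Q1 x + m) (at x within ?T)" if "x \<in> ?T" for x
  proof (rule has_field_derivative_transform_within[of "\<lambda>y. Q y + m * y + k" _ _ _ 1])
    show "((\<lambda>y. Q y + m * y + k) has_real_derivative Q1 x + m) (at x within ?T)"
      by (auto intro!: derivative_eq_intros has_field_derivative_at_within[OF Q])
  qed (use that eq in auto)
  moreover have "((\<lambda>x. Q1 x + m) has_real_derivative q x) (at x within ?T)" if "x \<in> ?T" for x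
    using qe[OF that] has_field_derivative_at_within[OF Q1, of x ?T]
    by (auto intro!: derivative_eq_intros)
  ultimately have "C2_edge ?T f (\<lambda>x. Q1 x + m) q"
    using contq by (simp add: C2_edge_def)
  then show ?thesis by (rule that)
qed

text \<open>The classical counterpart of a state: derivatives are pointwise, and Sobolev membership
  is replaced by decay of \<open>g\<close>, the only trace of it that uniqueness uses.\<close>

definition lobe_solution ::
  "real \<Rightarrow> real \<Rightarrow> (real \<Rightarrow> real) \<Rightarrow> (real \<Rightarrow> real) \<Rightarrow> (real \<Rightarrow> real) \<Rightarrow> (real \<Rightarrow> real) \<Rightarrow> bool" where
  "lobe_solution L c f f1 g g1 \<longleftrightarrow>
     C2_edge {-L..L} f f1 (\<lambda>x. c * f x - 2 * f x * ln (f x)) \<and>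
     C2_edge {L..} g g1 (\<lambda>x. c * g x - 2 * g x * ln (g x)) \<and>
     (g \<longlongrightarrow> 0) at_top \<and>
     (\<forall>x. x \<notin> {-L..L} \<longrightarrow> f x = 0) \<and> (\<forall>x. x \<notin> {L..} \<longrightarrow> g x = 0) \<and>
     f L = f (-L) \<and> f (-L) = g L \<and> f1 L - f1 (-L) = g1 L \<and>
     (\<forall>x\<in>{-L..L}. f x > 0) \<and> (\<forall>x\<in>{L..}. g x > 0) \<and>
     (\<forall>x\<in>{-L..L}. x \<noteq> 0 \<longrightarrow> f x < f 0) \<and> (\<forall>x\<in>{L..}. g x < f 0) \<and>
     antimono_on {0..L} f \<and> strict_antimono_on {L..} g"

text \<open>\<open>vector_derivative\<close> is a choice and has a definite value only at a limit
  point of \<open>T\<close>; the second point \<open>y\<close> of the interval ensures this.\<close>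

lemma vector_derivative_edge:
  fixes f :: "real \<Rightarrow> real"
  assumes "(f has_real_derivative D) (at x within T)" "x \<in> T" "is_interval T" "y \<in> T" "y \<noteq> x"
  shows "vector_derivative f (at x within T) = D"
proof (rule vector_derivative_within)
  have "connected T" using assms(3) by (rule is_interval_connected)
  then have "x islimpt T" using assms by (intro connected_imp_perfect) auto
  then show "at x within T \<noteq> bot" by (simp add: trivial_limit_within)
qed (use assms(1) in \<open>simp add: has_real_derivative_iff_has_vector_derivative\<close>)

text \<open>A positive decreasing function that does not tend to 0 stays above some
  \<open>e > 0\<close>, and then the constant \<open>e\<^sup>2\<close> would be integrable on a set
  of infinite measure.\<close>

lemma L2_antimono_tendsto_0:
  fixes g :: "real \<Rightarrow> real"
  assumes "g \<in> L2 {L<..}" and anti: "antimono_on {L..} g" and pos: "\<And>x. x \<ge> L \<Longrightarrow> g x > 0"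
  shows "(g \<longlongrightarrow> 0) at_top"
proof (rule ccontr)
  assume "\<not> (g \<longlongrightarrow> 0) at_top"
  then obtain e where e: "e > 0" "\<not> (\<forall>\<^sub>F x in at_top. dist (g x) 0 < e)"
    unfolding tendsto_iff by blast
  have ge: "g x \<ge> e" if x: "x \<ge> L" for x
  proof (rule ccontr)
    assume "\<not> g x \<ge> e"
    have "dist (g y) 0 < e" if "y \<ge> x" for y
      using monotone_onD[OF anti, of x y] that x pos[of y] \<open>\<not> g x \<ge> e\<close> by simp
    with e(2) show False by (auto simp: eventually_at_top_linorder)
  qed
  have "integrable (lebesgue_on {L<..}) (\<lambda>x. (g x)\<^sup>2)" using assms(1) by (simp add: L2_def)
  then have "integrable (lebesgue_on {L<..}) (\<lambda>x. e\<^sup>2)"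
  proof (rule Bochner_Integration.integrable_bound)
    show "AE x in lebesgue_on {L<..}. norm (e\<^sup>2) \<le> norm ((g x)\<^sup>2)"
      using ge e(1) by (intro AE_I2) (auto intro!: power_mono)
  qed simp
  then have fin: "emeasure (lebesgue_on {L<..}) (space (lebesgue_on {L<..})) < \<infinity>"
    using e(1) by (auto simp: integrable_iff_bounded nn_integral_const ennreal_mult_less_top)
  then have "emeasure lebesgue {L<..} < \<infinity>"
    by (simp add: emeasure_restrict_space)
  then obtain m where m: "emeasure lebesgue {L<..} = ennreal m" "m \<ge> 0"
    by (cases "emeasure lebesgue {L<..}") auto
  have "emeasure lebesgue {L<..<L + (m + 1)} \<le> emeasure lebesgue {L<..}"
    by (intro emeasure_mono) auto
  then show False using m by (simp add: ennreal_le_iff)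
qed

text \<open>Positivity up to the end points keeps the logarithm away from 0, so the right-hand side
  is continuous on the closed edges and \<open>H2_regularity\<close> applies on each.\<close>

lemma state_imp_lobe_solution:
  assumes L: "L > 0" and st: "positive_single_lobe_state L c u"
  obtains f1 g1 where "lobe_solution L c (fst u) f1 (snd u) g1"
proof -
  obtain f g where u: "u = (f, g)" by (cases u)
  have D0: "(f, g) \<in> D0 L" and NLS: "NLS_log L c (f, g)"
    and fpos: "\<And>x. x \<in> {-L..L} \<Longrightarrow> f x > 0" and gpos: "\<And>x. x \<in> {L..} \<Longrightarrow> g x > 0"
    and rest: "\<forall>x\<in>{-L..L}. x \<noteq> 0 \<longrightarrow> f x < f 0" "\<forall>x\<in>{L..}. g x < f 0"
      "antimono_on {0..L} f" "strict_antimono_on {L..} g"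
    using st by (auto simp: positive_single_lobe_state_def u)
  have sob: "f \<in> sobolev 2 {-L<..<L}" "g \<in> sobolev 2 {L<..}"
    and cont: "continuous_on {-L..L} f" "continuous_on {L..} g"
    and zero: "\<forall>x. x \<notin> {-L..L} \<longrightarrow> f x = 0" "\<forall>x. x \<notin> {L..} \<longrightarrow> g x = 0"
    and glue: "f L = f (-L)" "f (-L) = g L"
    and kir: "vector_derivative f (at L within {-L..L}) - vector_derivative f (at (-L) within {-L..L})
       = vector_derivative g (at L within {L..})"
    using D0 by (auto simp: D0_def graph_sobolev_def)
  have wd: "weak_deriv 2 S h \<in> L2 S \<and> is_weak_deriv 2 S h (weak_deriv 2 S h)"
    if "h \<in> sobolev 2 S" for S and h :: "real \<Rightarrow> real"
  proof -
    have "\<exists>v. v \<in> L2 S \<and> is_weak_deriv 2 S h v" using that by (auto simp: sobolev_def)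
    then show ?thesis unfolding weak_deriv_def by (rule someI_ex)
  qed
  have cl: "closure {-L<..<L} = {-L..L}" "closure {L<..} = {L..}"
    using L by auto
  have contq: "continuous_on T (\<lambda>x. c * h x - 2 * h x * ln (h x))"
    if "continuous_on T h" "\<And>x. x \<in> T \<Longrightarrow> h x > 0" for T and h :: "real \<Rightarrow> real"
    using that by (intro continuous_intros) (auto simp: less_imp_neq[symmetric])
  have ln2: "h * ln (\<bar>h\<bar>\<^sup>2) = 2 * h * ln h" if "h > 0" for h :: real
    using that by (simp add: ln_realpow)
  have ne: "{-L<..<L} \<noteq> {}" using L by auto
  have AEf: "AE x in lebesgue_on {-L<..<L}. weak_deriv 2 {-L<..<L} f x = c * f x - 2 * f x * ln (f x)"
  proof -
    have "AE x in lebesgue_on {-L<..<L}. x \<in> {-L<..<L}" by (intro AE_I2) auto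
    moreover have "AE x in lebesgue_on {-L<..<L}.
        - weak_deriv 2 {-L<..<L} f x + c * f x - f x * ln (\<bar>f x\<bar>\<^sup>2) = 0"
      using NLS by (simp add: NLS_log_def laplacian_def)
    ultimately show ?thesis
      by eventually_elim (use fpos ln2 in \<open>fastforce simp: algebra_simps\<close>)
  qed
  have AEg: "AE x in lebesgue_on {L<..}. weak_deriv 2 {L<..} g x = c * g x - 2 * g x * ln (g x)"
  proof -
    have "AE x in lebesgue_on {L<..}. x \<in> {L<..}" by (intro AE_I2) auto
    moreover have "AE x in lebesgue_on {L<..}.
        - weak_deriv 2 {L<..} g x + c * g x - g x * ln (\<bar>g x\<bar>\<^sup>2) = 0"
      using NLS by (simp add: NLS_log_def laplacian_def)
    ultimately show ?thesis
      by eventually_elim (use gpos ln2 in \<open>fastforce simp: algebra_simps\<close>)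
  qed
  obtain f1 where f1: "C2_edge {-L..L} f f1 (\<lambda>x. c * f x - 2 * f x * ln (f x))"
    using H2_regularity[of "{-L<..<L}" f "\<lambda>x. c * f x - 2 * f x * ln (f x)", OF _ _ ne]
      wd[OF sob(1)] AEf cont(1) contq[OF cont(1) fpos] unfolding cl by auto
  obtain g1 where g1: "C2_edge {L..} g g1 (\<lambda>x. c * g x - 2 * g x * ln (g x))"
    using H2_regularity[of "{L<..}" g "\<lambda>x. c * g x - 2 * g x * ln (g x)"]
      wd[OF sob(2)] AEg cont(2) contq[OF cont(2) gpos] unfolding cl by auto
  have "f1 L - f1 (-L) = g1 L"
  proof -
    have "vector_derivative f (at L within {-L..L}) = f1 L"
      by (rule vector_derivative_edge[where y = 0]) (use f1 L in \<open>auto simp: C2_edge_def is_interval_cc\<close>)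
    moreover have "vector_derivative f (at (-L) within {-L..L}) = f1 (-L)"
      by (rule vector_derivative_edge[where y = 0]) (use f1 L in \<open>auto simp: C2_edge_def is_interval_cc\<close>)
    moreover have "vector_derivative g (at L within {L..}) = g1 L"
      by (rule vector_derivative_edge[where y = "L + 1"]) (use g1 L in \<open>auto simp: C2_edge_def is_interval_ci\<close>)
    ultimately show ?thesis using kir by simp
  qed
  moreover have "(g \<longlongrightarrow> 0) at_top"
  proof (rule L2_antimono_tendsto_0)
    show "g \<in> L2 {L<..}" using sob(2) by (simp add: sobolev_def)
    show "antimono_on {L..} g"
      using rest(4) by (auto simp: monotone_on_def order_le_less)
  qed (use gpos in auto)
  ultimately have "lobe_solution L c f f1 g g1"
    using f1 g1 zero glue fpos gpos rest by (simp add: lobe_solution_def)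
  then show ?thesis using that by (simp add: u)
qed

section \<open>The logarithmic equation on an interval and on a half-line\<close>

lemma C2_edge_DERIV:
  assumes "C2_edge T f f1 f2" "x \<in> interior T"
  shows "(f has_real_derivative f1 x) (at x)" "(f1 has_real_derivative f2 x) (at x)"
proof -
  have "x \<in> T" using assms(2) interior_subset by blast
  then show "(f has_real_derivative f1 x) (at x)" "(f1 has_real_derivative f2 x) (at x)"
    using assms(1) unfolding C2_edge_def at_within_interior[OF assms(2), symmetric] by blast+
qed

lemma C2_edge_continuous:
  assumes "C2_edge T f f1 f2"
  shows "continuous_on T f" "continuous_on T f1"
  using assms by (auto simp: C2_edge_def continuous_on_eq_continuous_within intro: DERIV_continuous)

text \<open>The slope of s ln s is unbounded near 0; a positive lower end restores the Lipschitz
  property on which uniqueness depends.\<close>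

lemma mult_ln_lipschitz:
  fixes m M :: real
  assumes "0 < m"
  obtains K where "K \<ge> 0"
    "\<And>s r. s \<in> {m..M} \<Longrightarrow> r \<in> {m..M} \<Longrightarrow> \<bar>s * ln s - r * ln r\<bar> \<le> K * \<bar>s - r\<bar>"
proof -
  define K where "K = \<bar>ln m\<bar> + \<bar>ln M\<bar> + 1"
  have bound: "norm (ln z + 1) \<le> K" if "z \<in> {m..M}" for z
  proof -
    have "ln m \<le> ln z" "ln z \<le> ln M" using that assms by auto
    then show ?thesis by (simp add: K_def)
  qed
  have "\<bar>s * ln s - r * ln r\<bar> \<le> K * \<bar>s - r\<bar>" if sr: "s \<in> {m..M}" "r \<in> {m..M}" for s r
  proof -
    have "norm (s * ln s - r * ln r) \<le> K * norm (s - r)"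
    proof (rule field_differentiable_bound[of "{m..M}" "\<lambda>z. z * ln z" "\<lambda>z. ln z + 1"])
      fix z assume z: "z \<in> {m..M}"
      show "((\<lambda>z. z * ln z) has_real_derivative ln z + 1) (at z within {m..M})"
        using z assms by (auto intro!: derivative_eq_intros)
      show "norm (ln z + 1) \<le> K" by (rule bound[OF z])
    qed (use sr in auto)
    then show ?thesis by simp
  qed
  then show ?thesis using that[of K] by (simp add: K_def)
qed

text \<open>Gronwall's argument: on a compact edge both solutions stay in some \<open>{m..M}\<close>
  with \<open>m > 0\<close>, so the squared distance \<open>N\<close> in the phase plane satisfies
  N' \<le> c N, and \<open>exp (- c * x) * N x\<close> is nonincreasing from 0.\<close>

lemma log_ode_unique_right:
  fixes f g :: "real \<Rightarrow> real"
  assumes f: "C2_edge {0..L} f f1 (\<lambda>x. - 2 * f x * ln (f x))"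
    and g: "C2_edge {0..L} g g1 (\<lambda>x. - 2 * g x * ln (g x))"
    and pos: "\<And>x. x \<in> {0..L} \<Longrightarrow> f x > 0" "\<And>x. x \<in> {0..L} \<Longrightarrow> g x > 0"
    and init: "f 0 = g 0" "f1 0 = g1 0" and x: "x \<in> {0..L}"
  shows "f x = g x" "f1 x = g1 x"
proof -
  note cont = C2_edge_continuous[OF f] C2_edge_continuous[OF g]
  have ne: "{0..L} \<noteq> {}" using x by auto
  obtain u1 where u1: "u1 \<in> {0..L}" "\<And>y. y \<in> {0..L} \<Longrightarrow> f u1 \<le> f y"
    using continuous_attains_inf[OF compact_Icc ne cont(1)] by blast
  obtain u2 where u2: "u2 \<in> {0..L}" "\<And>y. y \<in> {0..L} \<Longrightarrow> g u2 \<le> g y"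
    using continuous_attains_inf[OF compact_Icc ne cont(3)] by blast
  obtain v1 where v1: "v1 \<in> {0..L}" "\<And>y. y \<in> {0..L} \<Longrightarrow> f y \<le> f v1"
    using continuous_attains_sup[OF compact_Icc ne cont(1)] by blast
  obtain v2 where v2: "v2 \<in> {0..L}" "\<And>y. y \<in> {0..L} \<Longrightarrow> g y \<le> g v2"
    using continuous_attains_sup[OF compact_Icc ne cont(3)] by blast
  define m where "m = min (f u1) (g u2)"
  define M where "M = max (f v1) (g v2)"
  have m: "m > 0" using pos u1(1) u2(1) by (simp add: m_def)
  have range: "f y \<in> {m..M}" "g y \<in> {m..M}" if "y \<in> {0..L}" for y
    using u1(2)[OF that] u2(2)[OF that] v1(2)[OF that] v2(2)[OF that] by (auto simp: m_def M_def)
  obtain K where K: "K \<ge> 0"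
    "\<And>s r. s \<in> {m..M} \<Longrightarrow> r \<in> {m..M} \<Longrightarrow> \<bar>s * ln s - r * ln r\<bar> \<le> K * \<bar>s - r\<bar>"
    by (rule mult_ln_lipschitz[OF m]) (rule that)
  define N where "N y = (f y - g y)\<^sup>2 + (f1 y - g1 y)\<^sup>2" for y
  define N' where "N' y = 2 * (f y - g y) * (f1 y - g1 y)
      + 2 * (f1 y - g1 y) * (- 2 * f y * ln (f y) - (- 2 * g y * ln (g y)))" for y
  \<comment> \<open>\<open>N'\<close> is bounded by 2 D E + 4 K D E, and 2 D E by
    \<open>N\<close>.\<close>
  define c where "c = 1 + 2 * K"
  have N'_le: "N' y \<le> c * N y" if y: "y \<in> {0..L}" for y
  proof -
    define D where "D = \<bar>f y - g y\<bar>"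
    define E where "E = \<bar>f1 y - g1 y\<bar>"
    have DE: "2 * D * E \<le> N y"
      using sum_squares_bound[of D E] by (simp add: N_def D_def E_def)
    have "(f y - g y) * (f1 y - g1 y) \<le> D * E"
      unfolding D_def E_def abs_mult[symmetric] by simp
    moreover have "(f1 y - g1 y) * (g y * ln (g y) - f y * ln (f y)) \<le> E * (K * D)"
    proof -
      have "(f1 y - g1 y) * (g y * ln (g y) - f y * ln (f y)) \<le> E * \<bar>f y * ln (f y) - g y * ln (g y)\<bar>"
        unfolding E_def abs_minus_commute[of "f y * ln (f y)"] abs_mult[symmetric] by simp
      also have "\<dots> \<le> E * (K * D)"
        unfolding D_def by (intro mult_left_mono K range y) (simp add: E_def)
      finally show ?thesis .
    qed
    ultimately have "N' y \<le> 2 * (D * E) + 4 * (E * (K * D))"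
      by (simp add: N'_def algebra_simps)
    also have "\<dots> = c * (2 * D * E)" by (simp add: c_def algebra_simps)
    also have "\<dots> \<le> c * N y" using DE K(1) by (intro mult_left_mono) (simp_all add: c_def)
    finally show ?thesis .
  qed
  have "exp (- c * x) * N x \<le> exp (- c * 0) * N 0"
  proof (rule DERIV_nonpos_imp_decreasing_open[where f = "\<lambda>y. exp (- c * y) * N y"])
    show "0 \<le> x" using x by simp
    show "continuous_on {0..x} (\<lambda>y. exp (- c * y) * N y)"
      unfolding N_def using x
      by (intro continuous_intros continuous_on_subset[OF cont(1)] continuous_on_subset[OF cont(2)]
          continuous_on_subset[OF cont(3)] continuous_on_subset[OF cont(4)]) auto
    fix y assume y: "0 < y" "y < x"
    then have yi: "y \<in> interior {0..L}" and yL: "y \<in> {0..L}" using x by (auto simp: interior_atLeastAtMost_real)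
    have dN: "(N has_real_derivative N' y) (at y)"
      unfolding N_def[abs_def] N'_def
      by (auto intro!: derivative_eq_intros C2_edge_DERIV[OF f yi] C2_edge_DERIV[OF g yi]
          simp: algebra_simps)
    have "((\<lambda>y. exp (- c * y) * N y) has_real_derivative exp (- c * y) * (N' y - c * N y)) (at y)"
      by (auto intro!: derivative_eq_intros dN simp: algebra_simps)
    moreover have "exp (- c * y) * (N' y - c * N y) \<le> 0"
      using N'_le[OF yL] by (intro mult_nonneg_nonpos) auto
    ultimately show "\<exists>d. ((\<lambda>y. exp (- c * y) * N y) has_real_derivative d) (at y) \<and> d \<le> 0" by blast
  qed
  also have "\<dots> = 0" by (simp add: N_def init)
  finally have "N x \<le> 0" by (simp add: mult_le_0_iff not_le[symmetric])
  moreover have "N x \<ge> 0" by (simp add: N_def)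
  ultimately have "N x = 0" by simp
  then show "f x = g x" "f1 x = g1 x" by (simp_all add: N_def sum_power2_eq_zero_iff)
qed

text \<open>Reflection leaves the second derivative unsigned, so it preserves the autonomous
  equation. This serves both for uniqueness to the left of 0 and for evenness of the ring
  component.\<close>

lemma C2_edge_reflect:
  fixes f :: "real \<Rightarrow> real"
  assumes "C2_edge {- L..L} f f1 f2"
  shows "C2_edge {- L..L} (\<lambda>x. f (- x)) (\<lambda>x. - f1 (- x)) (\<lambda>x. f2 (- x))"
proof -
  have *: "((\<lambda>x. h (- x)) has_real_derivative - h' (- x)) (at x within {- L..L})"
    if "\<And>x. x \<in> {- L..L} \<Longrightarrow> (h has_real_derivative h' x) (at x within {- L..L})" "x \<in> {- L..L}"
    for h h' :: "real \<Rightarrow> real" and x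
  proof -
    have "uminus ` {- L..L} = {- L..L}" by (simp add: image_uminus_atLeastAtMost)
    moreover have "(h has_real_derivative h' (- x)) (at (- x) within {- L..L})"
      using that by auto
    moreover have "(uminus has_real_derivative - 1) (at x within {- L..L})"
      by (auto intro!: derivative_eq_intros)
    ultimately have "(h \<circ> uminus has_real_derivative h' (- x) * - 1) (at x within {- L..L})"
      using DERIV_image_chain[of h "h' (- x)" uminus x "{- L..L}" "- 1"] by simp
    then show ?thesis by (simp add: o_def)
  qed
  have "continuous_on {- L..L} (\<lambda>x. f2 (- x))"
    by (rule continuous_on_compose2[of "{- L..L}" f2])
       (use assms in \<open>auto simp: C2_edge_def intro!: continuous_intros\<close>)
  moreover have "((\<lambda>x. - f1 (- x)) has_real_derivative f2 (- x)) (at x within {- L..L})"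
    if "x \<in> {- L..L}" for x
    using DERIV_minus[OF *[of f1 f2 x]] assms that by (simp add: C2_edge_def)
  ultimately show ?thesis
    using assms *[of f f1] by (auto simp: C2_edge_def)
qed

lemma C2_edge_subset:
  "C2_edge T f f1 f2 \<Longrightarrow> S \<subseteq> T \<Longrightarrow> C2_edge S f f1 f2"
  by (auto simp: C2_edge_def intro: has_field_derivative_subset continuous_on_subset)

lemma log_ode_unique:
  fixes f g :: "real \<Rightarrow> real"
  assumes f: "C2_edge {- L..L} f f1 (\<lambda>x. - 2 * f x * ln (f x))"
    and g: "C2_edge {- L..L} g g1 (\<lambda>x. - 2 * g x * ln (g x))"
    and pos: "\<And>x. x \<in> {- L..L} \<Longrightarrow> f x > 0" "\<And>x. x \<in> {- L..L} \<Longrightarrow> g x > 0"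
    and init: "f 0 = g 0" "f1 0 = g1 0" and x: "x \<in> {- L..L}"
  shows "f x = g x" "f1 x = g1 x"
proof -
  have sub: "{0..L} \<subseteq> {- L..L}" using x by auto
  have "f x = g x \<and> f1 x = g1 x"
  proof (cases "x \<ge> 0")
    case True
    then show ?thesis
      using log_ode_unique_right[OF C2_edge_subset[OF f sub] C2_edge_subset[OF g sub]] pos init x sub
      by auto
  next
    case False
    have pos': "f (- y) > 0" "g (- y) > 0" if "y \<in> {0..L}" for y
      using pos[of "- y"] that by auto
    have init': "f (- 0) = g (- 0)" "- f1 (- 0) = - g1 (- 0)" using init by auto
    have "- x \<in> {0..L}" using False x by auto
    note R = log_ode_unique_right[OF C2_edge_subset[OF C2_edge_reflect[OF f] sub]
        C2_edge_subset[OF C2_edge_reflect[OF g] sub] pos' init' this]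
    have "f (- (- x)) = g (- (- x))" "- f1 (- (- x)) = - g1 (- (- x))"
      by (rule R(1); assumption) (rule R(2); assumption)
    then show ?thesis by simp
  qed
  then show "f x = g x" "f1 x = g1 x" by auto
qed

lemma log_ode_energy:
  fixes f :: "real \<Rightarrow> real"
  assumes f: "C2_edge T f f1 (\<lambda>x. - 2 * f x * ln (f x))" and T: "convex T"
    and pos: "\<And>x. x \<in> T \<Longrightarrow> f x > 0" and xy: "x \<in> T" "y \<in> T"
  shows "(f1 x)\<^sup>2 + 2 * (f x)\<^sup>2 * ln (f x) - (f x)\<^sup>2 = (f1 y)\<^sup>2 + 2 * (f y)\<^sup>2 * ln (f y) - (f y)\<^sup>2"
proof -
  have "\<exists>c. \<forall>x\<in>T. (f1 x)\<^sup>2 + 2 * (f x)\<^sup>2 * ln (f x) - (f x)\<^sup>2 = c"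
  proof (rule has_field_derivative_zero_constant[OF T])
    fix x assume x: "x \<in> T"
    have d: "(f has_real_derivative f1 x) (at x within T)"
      "(f1 has_real_derivative - 2 * f x * ln (f x)) (at x within T)"
      using f x by (auto simp: C2_edge_def)
    show "((\<lambda>x. (f1 x)\<^sup>2 + 2 * (f x)\<^sup>2 * ln (f x) - (f x)\<^sup>2) has_real_derivative 0) (at x within T)"
      using pos[OF x]
      by (auto intro!: derivative_eq_intros d simp: field_simps power2_eq_square)
  qed
  then show ?thesis using xy by metis
qed

text \<open>Zero energy linearises the equation: \<open>p = g' / g\<close> satisfies \<open>p' = - 1\<close>.\<close>

lemma halfline_gaussian:
  fixes g :: "real \<Rightarrow> real"
  assumes g: "C2_edge {L..} g g1 (\<lambda>x. - 2 * g x * ln (g x))"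
    and pos: "\<And>x. x \<ge> L \<Longrightarrow> g x > 0" and anti: "antimono_on {L..} g" and lim: "(g \<longlongrightarrow> 0) at_top"
  obtains q where "q \<ge> 0" "\<And>x. x \<ge> L \<Longrightarrow> g x = exp ((1 - (x - L + q)\<^sup>2) / 2)" "g1 L = - q * g L"
proof -
  define E where "E x = (g1 x)\<^sup>2 + 2 * (g x)\<^sup>2 * ln (g x) - (g x)\<^sup>2" for x
  have energy: "E x = E L" if "x \<ge> L" for x
    unfolding E_def by (rule log_ode_energy[OF g]) (use pos that in auto)
  \<comment> \<open>Decay of \<open>g\<close> alone does not control \<open>g1\<close>, but the mean
    value theorem gives points tending to infinity along which \<open>g1\<close> tends to 0. As the
    energy is constant, a sequence suffices to see that it is 0.\<close>
  have "\<exists>\<xi>. \<xi> > L + real n \<and> g1 \<xi> = g (L + real n + 1) - g (L + real n)" for n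
  proof -
    have "\<exists>\<xi>\<in>{L + real n<..<L + real n + 1}.
        g (L + real n + 1) - g (L + real n) = g1 \<xi> * (L + real n + 1 - (L + real n))"
    proof (rule mvt_simple)
      fix x assume "L + real n \<le> x" "x \<le> L + real n + 1"
      then have "x \<in> {L..}" by auto
      then have "(g has_derivative times (g1 x)) (at x within {L..})"
        using g by (simp add: C2_edge_def has_field_derivative_def)
      then show "(g has_derivative times (g1 x)) (at x within {L + real n..L + real n + 1})"
        by (rule has_derivative_subset) auto
    qed simp
    then show ?thesis by auto
  qed
  then obtain \<xi> where \<xi>: "\<And>n. \<xi> n > L + real n"
    "\<And>n. g1 (\<xi> n) = g (L + real n + 1) - g (L + real n)" by metis
  have "filterlim (\<lambda>n. L + real n) at_top sequentially" by real_asymp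
  then have \<xi>_top: "filterlim \<xi> at_top sequentially"
    by (rule filterlim_at_top_mono) (use \<xi>(1) in \<open>auto intro!: always_eventually less_imp_le\<close>)
  have "filterlim (\<lambda>n. L + real n) at_top sequentially" "filterlim (\<lambda>n. L + real n + 1) at_top sequentially"
    by real_asymp+
  then have g1_lim: "(\<lambda>n. g1 (\<xi> n)) \<longlonglongrightarrow> 0 - 0"
    unfolding \<xi>(2) by (intro tendsto_diff filterlim_compose[OF lim])
  have g_lim: "(\<lambda>n. g (\<xi> n)) \<longlonglongrightarrow> 0" by (rule filterlim_compose[OF lim \<xi>_top])
  have \<xi>L: "\<xi> n \<ge> L" for n using \<xi>(1)[of n] by simp
  have "filterlim (\<lambda>n. g (\<xi> n)) (at_right 0) sequentially"
    using g_lim by (rule tendsto_imp_filterlim_at_right) (simp add: pos[OF \<xi>L])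
  moreover have "((\<lambda>s::real. 2 * s\<^sup>2 * ln s) \<longlongrightarrow> 0) (at_right 0)" by real_asymp
  ultimately have "(\<lambda>n. 2 * (g (\<xi> n))\<^sup>2 * ln (g (\<xi> n))) \<longlonglongrightarrow> 0"
    by (rule filterlim_compose[rotated])
  then have "(\<lambda>n. E (\<xi> n)) \<longlonglongrightarrow> (0 - 0)\<^sup>2 + 0 - 0\<^sup>2"
    unfolding E_def by (intro tendsto_intros g1_lim g_lim)
  then have E0: "E L = 0" using energy[OF \<xi>L] by (simp add: LIMSEQ_const_iff)
  define p where "p x = g1 x / g x" for x
  have psq: "(p x)\<^sup>2 = 1 - 2 * ln (g x)" if "x \<ge> L" for x
    using energy[OF that] E0 pos[OF that] by (simp add: E_def p_def power_divide field_simps)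
  have "\<exists>k. \<forall>x\<in>{L..}. p x + x = k"
  proof (rule has_field_derivative_zero_constant)
    fix x assume x: "x \<in> {L..}"
    have d: "(g has_real_derivative g1 x) (at x within {L..})"
      "(g1 has_real_derivative - 2 * g x * ln (g x)) (at x within {L..})"
      using g x by (auto simp: C2_edge_def)
    have gx: "g x > 0" using pos x by simp
    have "((\<lambda>x. p x + x) has_real_derivative (- 2 * g x * ln (g x) * g x - g1 x * g1 x) / (g x * g x) + 1)
        (at x within {L..})"
      unfolding p_def using gx by (intro DERIV_add DERIV_divide d DERIV_ident) auto
    also have "(- 2 * g x * ln (g x) * g x - g1 x * g1 x) / (g x * g x) = - 2 * ln (g x) - (p x)\<^sup>2"
      using gx by (simp add: p_def field_simps power2_eq_square)
    finally show "((\<lambda>x. p x + x) has_real_derivative 0) (at x within {L..})"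
      using psq[of x] x by simp
  qed simp
  then obtain k where k: "\<And>x. x \<ge> L \<Longrightarrow> p x + x = k" by auto
  define q where "q = - p L"
  have px: "p x = - (x - L + q)" if "x \<ge> L" for x
    using k[OF that] k[of L] by (simp add: q_def)
  have gx: "g x = exp ((1 - (x - L + q)\<^sup>2) / 2)" if "x \<ge> L" for x
  proof -
    have "ln (g x) = (1 - (x - L + q)\<^sup>2) / 2"
      using psq[OF that] unfolding px[OF that] power2_minus by simp
    then show ?thesis using pos[OF that] by (metis exp_ln)
  qed
  \<comment> \<open>For negative \<open>q\<close> the Gaussian would peak at \<open>L - q\<close>,
    inside the half-line, against monotonicity.\<close>
  have "q \<ge> 0"
  proof (rule ccontr)
    assume "\<not> q \<ge> 0"
    then have "g (L - q) \<le> g L" by (intro monotone_onD[OF anti]) auto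
    then show False using gx[of L] gx[of "L - q"] \<open>\<not> q \<ge> 0\<close> by simp
  qed
  moreover have "g1 L = - q * g L" using pos[of L] by (simp add: q_def p_def)
  ultimately show ?thesis using gx that by blast
qed

section \<open>Uniqueness\<close>

lemma C2_edgeI_profile:
  fixes \<phi> :: "real \<Rightarrow> real"
  assumes "\<And>x. (\<phi> has_real_derivative \<phi>1 x) (at x)"
    "\<And>x. (\<phi>1 has_real_derivative - 2 * \<phi> x * ln (\<phi> x)) (at x)" "\<And>x. \<phi> x > 0"
  shows "C2_edge T \<phi> \<phi>1 (\<lambda>x. - 2 * \<phi> x * ln (\<phi> x))"
proof -
  have "continuous_on T \<phi>"
    using assms(1) by (intro continuous_at_imp_continuous_on ballI) (blast intro: DERIV_isCont)
  then have "continuous_on T (\<lambda>x. - 2 * \<phi> x * ln (\<phi> x))"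
    using assms(3) by (intro continuous_intros) (auto simp: less_imp_neq[symmetric])
  then show ?thesis
    using assms(1,2) by (simp add: C2_edge_def has_field_derivative_at_within)
qed

text \<open>Places the ring component on one of the circular orbits: the bounds 0 < ln (f 0) < 1 / 2
  say that its radius lies between 0 and 1, the vertex conditions fix the radius by the angle
  \<open>b\<close>, and monotonicity keeps \<open>b\<close> below pi.\<close>

lemma ring_initial_value:
  fixes f :: "real \<Rightarrow> real"
  assumes L: "L > 0"
    and f: "C2_edge {- L..L} f f1 (\<lambda>x. - 2 * f x * ln (f x))"
    and pos: "\<And>x. x \<in> {- L..L} \<Longrightarrow> f x > 0"
    and max: "\<And>x. x \<in> {- L..L} \<Longrightarrow> x \<noteq> 0 \<Longrightarrow> f x < f 0"
    and anti: "antimono_on {0..L} f"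
    and fL: "f L = exp ((1 - q\<^sup>2) / 2)" and q: "q \<ge> 0" and per: "f L = f (- L)"
    and kir: "f1 L - f1 (- L) = - q * f L"
  obtains b where "0 < b" "b < pi" "half_length b = L" "f1 0 = 0"
    "f 0 = exp (- amp_inv (- match_amp b) / 2)"
proof -
  have int: "x \<in> interior {- L..L}" if "- L < x" "x < L" for x
    using that by (simp add: interior_atLeastAtMost_real)
  have f10: "f1 0 = 0"
  proof (rule DERIV_local_max)
    show "(f has_real_derivative f1 0) (at 0)" using L by (intro C2_edge_DERIV[OF f] int) auto
    show "\<forall>y. \<bar>0 - y\<bar> < L \<longrightarrow> f y \<le> f 0"
    proof (intro allI impI)
      fix y assume "\<bar>0 - y\<bar> < L"
      then have "y \<in> {- L..L}" by auto
      then show "f y \<le> f 0" using max[of y] by (cases "y = 0") auto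
    qed
  qed (rule L)
  \<comment> \<open>If \<open>f 0 \<le> 1\<close>, then \<open>f \<le> 1\<close> on the ring and the
    equation makes \<open>f\<close> convex there; starting with slope 0 it could not fall below its
    value at 0.\<close>
  have lnf0: "ln (f 0) > 0"
  proof (rule ccontr)
    assume "\<not> ln (f 0) > 0"
    then have f0: "f 0 \<le> 1" using pos[of 0] L by (simp add: not_less)
    have f2: "- 2 * f x * ln (f x) \<ge> 0" if "x \<in> {- L..L}" for x
    proof -
      have "f x \<le> 1" using max[OF that] f0 by (cases "x = 0") auto
      then show ?thesis using pos[OF that] by (intro mult_nonpos_nonpos) auto
    qed
    have f1: "f1 x \<ge> 0" if x: "0 \<le> x" "x < L" for x
    proof -
      have "f1 0 \<le> f1 x"
      proof (rule DERIV_nonneg_imp_nondecreasing[OF x(1)])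
        fix y assume "0 \<le> y" "y \<le> x"
        then show "\<exists>d. (f1 has_real_derivative d) (at y) \<and> 0 \<le> d"
          using C2_edge_DERIV(2)[OF f int, of y] f2[of y] x L by auto
      qed
      then show ?thesis using f10 by simp
    qed
    have "f 0 \<le> f L"
    proof (rule DERIV_nonneg_imp_increasing_open[where f = f])
      fix y assume "0 < y" "y < L"
      then show "\<exists>d. (f has_real_derivative d) (at y) \<and> 0 \<le> d"
        using C2_edge_DERIV(1)[OF f int, of y] f1[of y] by auto
    next
      show "continuous_on {0..L} f"
        by (rule continuous_on_subset[OF C2_edge_continuous(1)[OF f]]) auto
    qed (use L in simp)
    with max[of L] L show False by simp
  qed
  \<comment> \<open>\<open>f\<close> and its reflection have the same value and slope at 0, where
    the slope vanishes.\<close>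
  have evenf: "f1 (- L) = - f1 L"
  proof -
    have "f1 x = - f1 (- x)" if "x \<in> {- L..L}" for x
      by (rule log_ode_unique(2)[OF f C2_edge_reflect[OF f] pos _ _ _ that]) (use pos f10 in auto)
    from this[of L] show ?thesis using L by simp
  qed
  then have f1L: "2 * f1 L = - q * f L" using kir by simp
  have lnfL: "2 * ln (f L) = 1 - q\<^sup>2" by (simp add: fL)
  \<comment> \<open>At the vertex the slope contributes q^2 / 4 and the Gaussian height - q^2, in
    units of \<open>(f L)\<^sup>2\<close>; together they give - 3 / 4.\<close>
  have energy: "(f 0)\<^sup>2 * (2 * ln (f 0) - 1) = - 3 / 4 * q\<^sup>2 * (f L)\<^sup>2"
  proof -
    have "(f1 0)\<^sup>2 + 2 * (f 0)\<^sup>2 * ln (f 0) - (f 0)\<^sup>2 = (f1 L)\<^sup>2 + 2 * (f L)\<^sup>2 * ln (f L) - (f L)\<^sup>2"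
      by (rule log_ode_energy[OF f]) (use pos L in auto)
    moreover have "(f1 L)\<^sup>2 = q\<^sup>2 * (f L)\<^sup>2 / 4"
    proof -
      have "(2 * f1 L)\<^sup>2 = (- q * f L)\<^sup>2" by (simp only: f1L)
      then show ?thesis by (simp add: power_mult_distrib)
    qed
    moreover have "2 * (f L)\<^sup>2 * ln (f L) = (f L)\<^sup>2 * (1 - q\<^sup>2)"
      using lnfL by (metis mult.assoc mult.commute)
    ultimately show ?thesis by (simp add: f10 algebra_simps)
  qed
  have "ln (f 0) < 1 / 2"
  proof -
    have f0: "(f 0)\<^sup>2 > 0" using pos[of 0] L by simp
    have fLpos: "(f L)\<^sup>2 > 0" using pos[of L] L by simp
    \<comment> \<open>With \<open>q = 0\<close> both \<open>f 0\<close> and \<open>f L\<close> would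
      equal exp (1 / 2), although the maximum is strict.\<close>
    have "q \<noteq> 0"
    proof
      assume "q = 0"
      then have "2 * ln (f 0) - 1 = 0" using energy f0 by simp
      then have half: "ln (f 0) = 1 / 2" by simp
      have "f 0 = exp (ln (f 0))" using pos[of 0] L by simp
      then have "f 0 = exp (1 / 2)" by (simp only: half)
      with fL \<open>q = 0\<close> max[of L] L show False by simp
    qed
    then have "- 3 / 4 * q\<^sup>2 * (f L)\<^sup>2 < 0" using fLpos by simp
    then have "2 * ln (f 0) - 1 < 0" using energy f0 by (metis mult_less_0_iff not_less_iff_gr_or_eq)
    then show ?thesis by simp
  qed
  define t0 where "t0 = - 2 * ln (f 0)"
  have t0: "- 1 < t0" "t0 < 0" using lnf0 \<open>ln (f 0) < 1 / 2\<close> by (auto simp: t0_def)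
  define \<rho> where "\<rho> = - amp t0"
  have \<rho>: "0 < \<rho>" "\<rho> < 1"
    using strict_monoD[OF strict_mono_amp t0(1)] strict_monoD[OF strict_mono_amp t0(2)]
    by (auto simp: \<rho>_def amp_minus_one)
  have f0\<rho>: "f 0 = exp (- amp_inv (- \<rho>) / 2)"
    using pos[of 0] L by (simp add: \<rho>_def t0_def)
  note bd = rho_cos_bounds[OF less_imp_le[OF \<rho>(1)] \<rho>(2)]
  obtain \<theta> \<phi> where \<theta>: "\<And>x. \<theta> (- x) = - \<theta> x" "strict_mono \<theta>"
    "\<And>x. 0 \<le> x \<Longrightarrow> travel \<rho> (\<theta> x) = x" "\<And>b. 0 \<le> b \<Longrightarrow> \<theta> (travel \<rho> b) = b"
    and \<phi>: "\<And>x. \<phi> x = exp (- amp_inv (- \<rho> * cos (\<theta> x)) / 2)"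
    "\<And>x. (\<phi> has_real_derivative - \<rho> * sin (\<theta> x)) (at x)"
    "\<And>x. ((\<lambda>x. - \<rho> * sin (\<theta> x)) has_real_derivative - 2 * \<phi> x * ln (\<phi> x)) (at x)"
    by (rule ring_profile[OF \<rho>]) (rule that)
  have \<theta>0: "\<theta> 0 = 0" using \<theta>(1)[of 0] by simp
  have \<phi>pos: "\<phi> x > 0" for x by (simp add: \<phi>(1))
  have \<phi>edge: "C2_edge {- L..L} \<phi> (\<lambda>x. - \<rho> * sin (\<theta> x)) (\<lambda>x. - 2 * \<phi> x * ln (\<phi> x))"
    by (rule C2_edgeI_profile[OF \<phi>(2,3) \<phi>pos])
  have init: "f 0 = \<phi> 0" "f1 0 = - \<rho> * sin (\<theta> 0)" using f0\<rho> f10 by (auto simp: \<phi>(1) \<theta>0)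
  have eq: "f x = \<phi> x" "f1 x = - \<rho> * sin (\<theta> x)" if "x \<in> {- L..L}" for x
    using log_ode_unique[OF f \<phi>edge pos \<phi>pos init that] by auto
  define b where "b = \<theta> L"
  have b: "0 < b" using strict_monoD[OF \<theta>(2) L] by (simp add: \<theta>0 b_def)
  define tb where "tb = amp_inv (- \<rho> * cos b)"
  have fLtb: "f L = exp (- tb / 2)" using eq(1)[of L] L by (simp add: \<phi>(1) tb_def b_def)
  have qtb: "q\<^sup>2 = 1 + tb" using lnfL by (simp add: fLtb)
  have match: "\<rho> = match_amp b"
  proof -
    have "4 * (\<rho> * sin b)\<^sup>2 = (2 * f1 L)\<^sup>2"
      using eq(2)[of L] L by (simp add: b_def power_mult_distrib)
    also have "\<dots> = q\<^sup>2 * (f L)\<^sup>2" unfolding f1L by (simp add: power_mult_distrib)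
    also have "\<dots> = (1 + tb) * exp (- tb)"
      unfolding qtb fLtb by (simp add: power2_eq_square exp_add[symmetric])
    also have "\<dots> = 1 - (\<rho> * cos b)\<^sup>2"
      unfolding tb_def using amp_inv_sq[of "- \<rho> * cos b"] bd[of b] by simp
    finally show ?thesis using match_amp_iff[OF \<rho>(1)] by blast
  qed
  \<comment> \<open>At pi the matching amplitude is 1, which is no radius below 1.\<close>
  have "b \<noteq> pi" using match \<rho> by (auto simp: match_amp_def)
  moreover have "\<not> b > pi"
  proof
    assume "b > pi"
    \<comment> \<open>After angle pi the profile rises again. The cap keeps the comparison angle
      below 2 pi, so that its cosine is strictly above - 1, and \<open>\<beta> \<le> b\<close> keeps
      its position on the ring.\<close>
    define \<beta> where "\<beta> = min b (3 * pi / 2)"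
    have \<beta>: "pi < \<beta>" "\<beta> \<le> b" "\<beta> < 2 * pi" "\<beta> \<ge> 0" using \<open>b > pi\<close> pi_gt_zero by (auto simp: \<beta>_def min_def)
    define x where "x = travel \<rho> pi"
    define y where "y = travel \<rho> \<beta>"
    have \<theta>xy: "\<theta> x = pi" "\<theta> y = \<beta>" unfolding x_def y_def using \<beta> by (auto intro!: \<theta>(4))
    have xy: "0 \<le> x" "x \<le> y" "y \<le> L"
      using strict_mono_less_eq[OF \<theta>(2), of 0 x] strict_mono_less_eq[OF \<theta>(2), of x y]
        strict_mono_less_eq[OF \<theta>(2), of y L] \<beta> by (auto simp: \<theta>0 \<theta>xy b_def)
    then have "\<phi> y \<le> \<phi> x" using monotone_onD[OF anti, of x y] eq(1)[of x] eq(1)[of y] L by auto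
    then have "amp_inv \<rho> \<le> amp_inv (- \<rho> * cos \<beta>)" by (simp add: \<phi>(1) \<theta>xy)
    then have "\<rho> \<le> - \<rho> * cos \<beta>"
      using \<rho> bd[of \<beta>] by (subst (asm) amp_inv_le_iff) auto
    then have "\<rho> * (1 + cos \<beta>) \<le> 0" by (simp add: algebra_simps)
    then have "cos \<beta> \<le> - 1" using \<rho> by (simp add: mult_le_0_iff)
    then have "cos (\<beta> - pi) \<ge> 1" by (simp add: cos_diff)
    moreover have "cos (\<beta> - pi) < cos 0"
      using \<beta> by (intro cos_monotone_0_pi) auto
    ultimately show False by simp
  qed
  ultimately have bpi: "b < pi" by simp
  have "travel \<rho> b = L" using \<theta>(3)[of L] L by (simp add: b_def)
  then have "half_length b = L" by (simp only: half_length_def match[symmetric])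
  then show ?thesis using that[OF b bpi _ f10] f0\<rho> match by simp
qed

text \<open>Injectivity of the half-length identifies the two vertex angles, hence the initial
  values at 0 and the ring components. Their common vertex value then determines
  \<open>q \<ge> 0\<close> and with it the Gaussian.\<close>

lemma lobe_solution_unique:
  assumes L: "L > 0" and "lobe_solution L 0 f f1 g g1" "lobe_solution L 0 h h1 k k1"
  shows "f = h" "g = k"
proof -
  have main: "\<exists>q b. 0 \<le> q \<and> 0 < b \<and> b < pi \<and> half_length b = L \<and> f1 0 = 0 \<and>
      f 0 = exp (- amp_inv (- match_amp b) / 2) \<and> f L = exp ((1 - q\<^sup>2) / 2) \<and>
      (\<forall>x\<ge>L. g x = exp ((1 - (x - L + q)\<^sup>2) / 2))"
    if "lobe_solution L 0 f f1 g g1" for f f1 g g1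
  proof -
    have f: "C2_edge {- L..L} f f1 (\<lambda>x. - 2 * f x * ln (f x))"
      and g: "C2_edge {L..} g g1 (\<lambda>x. - 2 * g x * ln (g x))"
      using that by (auto simp: lobe_solution_def)
    have gpos: "\<And>x. x \<ge> L \<Longrightarrow> g x > 0" and ganti: "antimono_on {L..} g" and glim: "(g \<longlongrightarrow> 0) at_top"
      using that by (auto simp: lobe_solution_def monotone_on_def order_le_less)
    obtain q where q: "q \<ge> 0" "\<And>x. x \<ge> L \<Longrightarrow> g x = exp ((1 - (x - L + q)\<^sup>2) / 2)" "g1 L = - q * g L"
      by (rule halfline_gaussian[OF g gpos ganti glim], assumption, rule that)
    have fL: "f L = exp ((1 - q\<^sup>2) / 2)" using that q(2)[of L] by (simp add: lobe_solution_def)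
    have kir: "f1 L - f1 (- L) = - q * f L" using that q(3) by (simp add: lobe_solution_def)
    obtain b where "0 < b" "b < pi" "half_length b = L" "f1 0 = 0"
      "f 0 = exp (- amp_inv (- match_amp b) / 2)"
      by (rule ring_initial_value[OF L f _ _ _ fL q(1) _ kir])
         (use \<open>lobe_solution L 0 f f1 g g1\<close> in \<open>auto simp: lobe_solution_def\<close>)
    then show ?thesis using q(1,2) fL by blast
  qed
  obtain q b where qb: "0 \<le> q" "0 < b" "b < pi" "half_length b = L" "f1 0 = 0"
    "f 0 = exp (- amp_inv (- match_amp b) / 2)" "f L = exp ((1 - q\<^sup>2) / 2)"
    "\<And>x. x \<ge> L \<Longrightarrow> g x = exp ((1 - (x - L + q)\<^sup>2) / 2)"
    using main[OF assms(2)] by blast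
  obtain r d where rd: "0 \<le> r" "0 < d" "d < pi" "half_length d = L" "h1 0 = 0"
    "h 0 = exp (- amp_inv (- match_amp d) / 2)" "h L = exp ((1 - r\<^sup>2) / 2)"
    "\<And>x. x \<ge> L \<Longrightarrow> k x = exp ((1 - (x - L + r)\<^sup>2) / 2)"
    using main[OF assms(3)] by blast
  have "b = d"
    using strict_mono_on_imp_inj_on[OF half_length_strict_mono] qb rd by (auto simp: inj_on_def)
  then have init: "f 0 = h 0" "f1 0 = h1 0" using qb rd by auto
  have fh: "f x = h x" if "x \<in> {- L..L}" for x
    by (rule log_ode_unique(1)[of L f f1 h h1])
       (use assms(2,3) that init in \<open>auto simp: lobe_solution_def\<close>)
  show "f = h"
  proof
    fix x show "f x = h x"
      using fh[of x] assms(2,3) by (cases "x \<in> {- L..L}") (auto simp: lobe_solution_def)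
  qed
  have "q = r" using fh[of L] L qb(1,7) rd(1,7) by (simp add: power2_eq_iff_nonneg)
  show "g = k"
  proof
    fix x show "g x = k x"
      using qb(8)[of x] rd(8)[of x] \<open>q = r\<close> assms(2,3) by (cases "x \<ge> L") (auto simp: lobe_solution_def)
  qed
qed

section \<open>Existence\<close>

lemma C2_edge_cong:
  assumes "C2_edge T f f1 f2" "\<And>x. x \<in> T \<Longrightarrow> h x = f x" "\<And>x. x \<in> T \<Longrightarrow> h1 x = f1 x"
    "\<And>x. x \<in> T \<Longrightarrow> h2 x = f2 x"
  shows "C2_edge T h h1 h2"
proof -
  have "(h has_real_derivative h1 x) (at x within T)" if "x \<in> T" for x
    by (rule has_field_derivative_transform_within[of f _ _ _ 1])
       (use assms that in \<open>auto simp: C2_edge_def\<close>)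
  moreover have "(h1 has_real_derivative h2 x) (at x within T)" if "x \<in> T" for x
    by (rule has_field_derivative_transform_within[of f1 _ _ _ 1])
       (use assms that in \<open>auto simp: C2_edge_def\<close>)
  moreover have "continuous_on T h2"
    using assms by (auto simp: C2_edge_def cong: continuous_on_cong)
  ultimately show ?thesis by (simp add: C2_edge_def)
qed

lemma C2_edge_scale:
  "C2_edge T f f1 f2 \<Longrightarrow> C2_edge T (\<lambda>x. r * f x) (\<lambda>x. r * f1 x) (\<lambda>x. r * f2 x)"
  by (auto simp: C2_edge_def intro!: DERIV_cmult continuous_intros)

section \<open>Square integrability of the Gaussian tail\<close>

lemma L2_exp_decay:
  fixes h :: "real \<Rightarrow> real"
  assumes "continuous_on {L<..} h" "\<And>x. x > L \<Longrightarrow> \<bar>h x\<bar> \<le> C * exp (- x)"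
  shows "h \<in> L2 {L<..}"
proof -
  have meas: "h \<in> borel_measurable (lebesgue_on {L<..})"
    using assms(1) by (intro continuous_imp_measurable_on_sets_lebesgue) auto
  have "(\<lambda>x. exp (- 2 * x)) absolutely_integrable_on {L..}"
    by (intro nonnegative_absolutely_integrable_1 integrable_on_exp_minus_to_infinity) auto
  then have "set_integrable lebesgue {L<..} (\<lambda>x. exp (- 2 * x))"
    by (rule set_integrable_subset) auto
  then have "integrable (lebesgue_on {L<..}) (\<lambda>x. C\<^sup>2 * exp (- 2 * x))"
    by (simp add: integrable_restrict_space set_integrable_def)
  then have "integrable (lebesgue_on {L<..}) (\<lambda>x. (h x)\<^sup>2)"
  proof (rule Bochner_Integration.integrable_bound)
    show "(\<lambda>x. (h x)\<^sup>2) \<in> borel_measurable (lebesgue_on {L<..})" using meas by simp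
    have "(h x)\<^sup>2 \<le> C\<^sup>2 * exp (- 2 * x)" if "x > L" for x
    proof -
      have "\<bar>h x\<bar>\<^sup>2 \<le> (C * exp (- x))\<^sup>2" by (intro power_mono assms(2) that) auto
      also have "\<dots> = C\<^sup>2 * exp (- 2 * x)"
        by (simp add: power_mult_distrib power2_eq_square[of "exp (- x)"] exp_add[symmetric])
      finally show ?thesis by simp
    qed
    then show "AE x in lebesgue_on {L<..}. norm ((h x)\<^sup>2) \<le> norm (C\<^sup>2 * exp (- 2 * x))"
      by (intro AE_I2) auto
  qed
  then show ?thesis using meas by (simp add: L2_def)
qed

text \<open>Half of the Gaussian exponent absorbs the weight, by 1 + u^2 \<le> 4 exp (u^2 / 4); the
  other half beats exp (- u) up to the factor e, by (u / 2 - 1)^2 \<ge> 0.\<close>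

lemma gaussian_weight_bound:
  fixes u :: real
  shows "(1 + u\<^sup>2) * exp (- u\<^sup>2 / 2) \<le> 4 * exp 1 * exp (- u)"
proof -
  have "1 + u\<^sup>2 \<le> 4 * exp (u\<^sup>2 / 4)"
  proof -
    have "1 + u\<^sup>2 \<le> 4 * (1 + u\<^sup>2 / 4)" by simp
    also have "\<dots> \<le> 4 * exp (u\<^sup>2 / 4)"
      by (intro mult_left_mono exp_ge_add_one_self) simp
    finally show ?thesis .
  qed
  then have "(1 + u\<^sup>2) * exp (- u\<^sup>2 / 2) \<le> 4 * exp (u\<^sup>2 / 4) * exp (- u\<^sup>2 / 2)"
    by (intro mult_right_mono) auto
  also have "\<dots> = 4 * exp (- u\<^sup>2 / 4)"
    by (simp add: exp_add[symmetric])
  also have "\<dots> \<le> 4 * exp (1 - u)"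
    using zero_le_power2[of "u / 2 - 1"] by (simp add: power2_eq_square algebra_simps)
  also have "\<dots> = 4 * exp 1 * exp (- u)" by (simp add: exp_diff exp_minus divide_inverse)
  finally show ?thesis .
qed

lemma gaussian_halfline:
  fixes L q :: real
  assumes q: "q \<ge> 0" and \<psi>: "\<psi> = (\<lambda>x. exp ((1 - (x - L + q)\<^sup>2) / 2))"
  shows "C2_edge {L..} \<psi> (\<lambda>x. - (x - L + q) * \<psi> x) (\<lambda>x. - 2 * \<psi> x * ln (\<psi> x))"
    "\<psi> \<in> L2 {L<..}" "(\<lambda>x. - (x - L + q) * \<psi> x) \<in> L2 {L<..}" "(\<lambda>x. - 2 * \<psi> x * ln (\<psi> x)) \<in> L2 {L<..}"
proof -
  have d1: "(\<psi> has_real_derivative - (x - L + q) * \<psi> x) (at x)" for x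
  proof -
    have "((\<lambda>x. (1 - (x - L + q)\<^sup>2) / 2) has_real_derivative (0 - 2 * (x - L + q)) / 2) (at x)"
      by (rule derivative_eq_intros refl | simp)+
    from DERIV_chain2[OF DERIV_exp this] show ?thesis
      unfolding \<psi> by (rule DERIV_cong) simp
  qed
  have d2: "((\<lambda>x. - (x - L + q) * \<psi> x) has_real_derivative - 2 * \<psi> x * ln (\<psi> x)) (at x)" for x
  proof -
    have "((\<lambda>x. - (x - L + q) * \<psi> x) has_real_derivative - 1 * \<psi> x + - (x - L + q) * \<psi> x * - (x - L + q)) (at x)"
      by (auto intro!: derivative_eq_intros d1 simp: algebra_simps)
    also have "- 1 * \<psi> x + - (x - L + q) * \<psi> x * - (x - L + q) = - 2 * \<psi> x * ln (\<psi> x)"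
    proof -
      define u where "u = x - L + q"
      have ln\<psi>: "ln (\<psi> x) = (1 - u * u) / 2" by (simp add: \<psi> u_def power2_eq_square)
      show ?thesis unfolding u_def[symmetric] ln\<psi> by (simp add: field_simps)
    qed
    finally show ?thesis .
  qed
  show "C2_edge {L..} \<psi> (\<lambda>x. - (x - L + q) * \<psi> x) (\<lambda>x. - 2 * \<psi> x * ln (\<psi> x))"
    by (rule C2_edgeI_profile[OF d1 d2]) (simp add: \<psi>)
  define C where "C = 4 * exp 1 * exp (1 / 2) * exp (L - q)"
  have weight: "(1 + (x - L + q)\<^sup>2) * \<psi> x \<le> C * exp (- x)" for x
  proof -
    have "(1 - (x - L + q)\<^sup>2) / 2 = 1 / 2 + - (x - L + q)\<^sup>2 / 2"
      by (simp add: diff_divide_distrib)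
    then have "\<psi> x = exp (1 / 2) * exp (- (x - L + q)\<^sup>2 / 2)"
      unfolding \<psi> by (simp only: exp_add)
    then have "(1 + (x - L + q)\<^sup>2) * \<psi> x = exp (1 / 2) * ((1 + (x - L + q)\<^sup>2) * exp (- (x - L + q)\<^sup>2 / 2))"
      by (simp only: mult_ac)
    also have "\<dots> \<le> exp (1 / 2) * (4 * exp 1 * exp (- (x - L + q)))"
      by (intro mult_left_mono gaussian_weight_bound) simp
    also have "- (x - L + q) = (L - q) + - x" by simp
    also have "exp (1 / 2) * (4 * exp 1 * exp ((L - q) + - x)) = C * exp (- x)"
      unfolding C_def exp_add by (simp only: mult_ac)
    finally show ?thesis .
  qed
  \<comment> \<open>With u = x - L + q, the function and its two derivatives carry the weights 1, -
    u and u^2 - 1, all dominated by 1 + u^2.\<close>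
  have L2: "(\<lambda>x. w x * \<psi> x) \<in> L2 {L<..}"
    if w: "continuous_on {L<..} w" "\<And>x. x > L \<Longrightarrow> \<bar>w x\<bar> \<le> 1 + (x - L + q)\<^sup>2" for w
  proof (rule L2_exp_decay)
    show "continuous_on {L<..} (\<lambda>x. w x * \<psi> x)"
      unfolding \<psi> by (intro continuous_intros w) auto
    fix x assume "x > L"
    then have "\<bar>w x * \<psi> x\<bar> \<le> (1 + (x - L + q)\<^sup>2) * \<psi> x"
      using w(2)[of x] by (simp add: abs_mult \<psi>)
    also have "\<dots> \<le> C * exp (- x)" by (rule weight)
    finally show "\<bar>w x * \<psi> x\<bar> \<le> C * exp (- x)" .
  qed
  show "\<psi> \<in> L2 {L<..}" using L2[of "\<lambda>_. 1"] by simp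
  have "\<bar>- (x - L + q)\<bar> \<le> 1 + (x - L + q)\<^sup>2" for x
    using zero_le_power2[of "\<bar>x - L + q\<bar> - 1 / 2"] by (simp add: power2_diff) (simp add: power2_eq_square)
  then show "(\<lambda>x. - (x - L + q) * \<psi> x) \<in> L2 {L<..}"
    by (intro L2 continuous_intros) auto
  have "(\<lambda>x. - 2 * \<psi> x * ln (\<psi> x)) = (\<lambda>x. ((x - L + q)\<^sup>2 - 1) * \<psi> x)"
  proof
    fix x
    define v where "v = (x - L + q)\<^sup>2"
    have "ln (\<psi> x) = (1 - v) / 2" by (simp add: \<psi> v_def)
    then show "- 2 * \<psi> x * ln (\<psi> x) = ((x - L + q)\<^sup>2 - 1) * \<psi> x"
      unfolding v_def[symmetric] by (simp only:) (simp add: field_simps)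
  qed
  moreover have "(\<lambda>x. ((x - L + q)\<^sup>2 - 1) * \<psi> x) \<in> L2 {L<..}"
    by (intro L2 continuous_intros) (auto simp: abs_le_iff)
  ultimately show "(\<lambda>x. - 2 * \<psi> x * ln (\<psi> x)) \<in> L2 {L<..}" by simp
qed

lemma L2_cong:
  fixes f g :: "real \<Rightarrow> real"
  assumes "f \<in> L2 S" "\<And>x. x \<in> S \<Longrightarrow> g x = f x" "S \<in> sets lebesgue"
  shows "g \<in> L2 S"
proof -
  have sp: "space (lebesgue_on S) = S" by simp
  have "g \<in> borel_measurable (lebesgue_on S) \<longleftrightarrow> f \<in> borel_measurable (lebesgue_on S)"
    by (rule measurable_cong) (simp add: assms(2))
  moreover have "integrable (lebesgue_on S) (\<lambda>x. (norm (g x))\<^sup>2) \<longleftrightarrow>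
      integrable (lebesgue_on S) (\<lambda>x. (norm (f x))\<^sup>2)"
    by (rule Bochner_Integration.integrable_cong) (simp_all add: assms(2))
  ultimately show ?thesis using assms(1) by (simp add: L2_def)
qed

text \<open>On the right half of the ring the angle stays in \<open>{0..b}\<close> with
  \<open>b < pi\<close>, where the cosine decreases strictly; this gives the single maximum and the
  monotonicity.\<close>

lemma lobe_solution_exists:
  assumes L: "L > 0"
  obtains f f1 g g1 where "lobe_solution L 0 f f1 g g1"
    "g \<in> L2 {L<..}" "g1 \<in> L2 {L<..}" "(\<lambda>x. - 2 * g x * ln (g x)) \<in> L2 {L<..}"
proof -
  obtain b where b: "0 < b" "b < pi" "half_length b = L" by (rule half_length_surj[OF L])
  define \<rho> where "\<rho> = match_amp b"
  have \<rho>: "0 < \<rho>" "\<rho> < 1" using b by (auto simp: \<rho>_def match_amp_pos intro: match_amp_less_one)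
  note bd = rho_cos_bounds[OF less_imp_le[OF \<rho>(1)] \<rho>(2)]
  obtain \<theta> \<phi> where \<theta>: "\<And>x. \<theta> (- x) = - \<theta> x" "strict_mono \<theta>"
    "\<And>x. 0 \<le> x \<Longrightarrow> travel \<rho> (\<theta> x) = x" "\<And>b. 0 \<le> b \<Longrightarrow> \<theta> (travel \<rho> b) = b"
    and \<phi>: "\<And>x. \<phi> x = exp (- amp_inv (- \<rho> * cos (\<theta> x)) / 2)"
    "\<And>x. (\<phi> has_real_derivative - \<rho> * sin (\<theta> x)) (at x)"
    "\<And>x. ((\<lambda>x. - \<rho> * sin (\<theta> x)) has_real_derivative - 2 * \<phi> x * ln (\<phi> x)) (at x)"
    by (rule ring_profile[OF \<rho>]) (rule that)
  have \<theta>0: "\<theta> 0 = 0" using \<theta>(1)[of 0] by simp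
  have \<theta>L: "\<theta> L = b" using \<theta>(4)[of b] b by (simp add: half_length_def \<rho>_def)
  have \<phi>pos: "\<phi> x > 0" for x by (simp add: \<phi>(1))
  have \<phi>even: "\<phi> (- x) = \<phi> x" for x by (simp add: \<phi>(1) \<theta>(1))
  have \<phi>less: "\<phi> y < \<phi> x" if "0 \<le> x" "x < y" "y \<le> L" for x y
  proof -
    have "\<theta> x < \<theta> y" "0 \<le> \<theta> x" "\<theta> y \<le> b"
      using that strict_monoD[OF \<theta>(2), of x y] strict_mono_less_eq[OF \<theta>(2), of 0 x]
        strict_mono_less_eq[OF \<theta>(2), of y L] by (auto simp: \<theta>0 \<theta>L)
    then have "cos (\<theta> y) < cos (\<theta> x)" using b by (intro cos_monotone_0_pi) auto
    then have "- \<rho> * cos (\<theta> x) < - \<rho> * cos (\<theta> y)" using \<rho> by simp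
    then have "amp_inv (- \<rho> * cos (\<theta> x)) < amp_inv (- \<rho> * cos (\<theta> y))"
      using bd[of "\<theta> x"] bd[of "\<theta> y"] by (subst amp_inv_less_iff) auto
    then show ?thesis unfolding \<phi>(1) by simp
  qed
  have \<phi>max: "\<phi> x < \<phi> 0" if "x \<in> {- L..L}" "x \<noteq> 0" for x
    using \<phi>less[of 0 "\<bar>x\<bar>"] that \<phi>even[of x] by (cases "x \<ge> 0") auto
  define tb where "tb = amp_inv (- \<rho> * cos b)"
  have tb: "tb > - 1" unfolding tb_def by (rule amp_inv_gt[OF bd])
  \<comment> \<open>The choice that gives the Gaussian the height exp (- tb / 2) of the ring profile
    at the vertex.\<close>
  define q where "q = sqrt (1 + tb)"
  have q: "q > 0" "q\<^sup>2 = 1 + tb" using tb by (auto simp: q_def)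
  define \<psi> where "\<psi> = (\<lambda>x. exp ((1 - (x - L + q)\<^sup>2) / 2))"
  define \<psi>1 where "\<psi>1 = (\<lambda>x. - (x - L + q) * \<psi> x)"
  note \<psi>h = gaussian_halfline[OF less_imp_le[OF q(1)] \<psi>_def, folded \<psi>1_def]
  define f where "f = (\<lambda>x. if x \<in> {- L..L} then \<phi> x else 0)"
  define f1 where "f1 = (\<lambda>x. - \<rho> * sin (\<theta> x))"
  define g where "g = (\<lambda>x. if x \<in> {L..} then \<psi> x else 0)"
  have f: "f x = \<phi> x" if "x \<in> {- L..L}" for x using that by (simp add: f_def)
  have g: "g x = \<psi> x" if "x \<in> {L..}" for x using that by (simp add: g_def)
  have \<psi>less: "\<psi> y < \<psi> x" if "L \<le> x" "x < y" for x y
  proof -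
    have "(x - L + q)\<^sup>2 < (y - L + q)\<^sup>2" using that q(1) by (intro power_strict_mono) auto
    then show ?thesis by (simp add: \<psi>_def)
  qed
  have glue: "\<phi> L = \<psi> L" by (simp add: \<phi>(1) \<psi>_def \<theta>L q(2) tb_def)
  have edge_f: "C2_edge {- L..L} f f1 (\<lambda>x. 0 * f x - 2 * f x * ln (f x))"
    by (rule C2_edge_cong[OF C2_edgeI_profile[OF \<phi>(2,3) \<phi>pos]]) (auto simp: f f1_def)
  have edge_g: "C2_edge {L..} g \<psi>1 (\<lambda>x. 0 * g x - 2 * g x * ln (g x))"
    by (rule C2_edge_cong[OF \<psi>h(1)]) (auto simp: g)
  have "((\<lambda>x. exp ((1 - (x - L + q)\<^sup>2) / 2)) \<longlongrightarrow> 0) at_top" by real_asymp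
  moreover have "\<forall>\<^sub>F x in at_top. \<psi> x = g x"
    using eventually_ge_at_top[of L] by eventually_elim (simp add: g)
  ultimately have lim: "(g \<longlongrightarrow> 0) at_top"
    unfolding \<psi>_def by (rule Lim_transform_eventually)
  have kir: "f1 L - f1 (- L) = \<psi>1 L"
  proof -
    have "(2 * (\<rho> * sin b))\<^sup>2 = (q * exp (- tb / 2))\<^sup>2"
    proof -
      have "(2 * (\<rho> * sin b))\<^sup>2 = 1 - (\<rho> * cos b)\<^sup>2"
        using match_amp_iff[OF \<rho>(1), of b] by (simp add: \<rho>_def power_mult_distrib)
      also have "\<dots> = (1 + tb) * exp (- tb)"
        unfolding tb_def using amp_inv_sq[of "- \<rho> * cos b"] bd[of b] by simp
      also have "\<dots> = (q * exp (- tb / 2))\<^sup>2"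
      proof -
        have "exp (- tb) = (exp (- tb / 2))\<^sup>2"
          by (simp add: power2_eq_square exp_add[symmetric])
        then show ?thesis by (simp only: power_mult_distrib q(2))
      qed
      finally show ?thesis .
    qed
    \<comment> \<open>The amplitude condition fixes the slopes only up to sign;
      \<open>b < pi\<close> makes \<open>sin b\<close> positive, so the roots agree.\<close>
    then have "2 * (\<rho> * sin b) = q * exp (- tb / 2)"
      by (rule power2_eq_imp_eq) (use \<rho> q(1) sin_gt_zero[OF b(1,2)] in auto)
    then show ?thesis by (simp add: f1_def \<psi>1_def \<psi>_def \<theta>(1) \<theta>L q(2))
  qed
  have "lobe_solution L 0 f f1 g \<psi>1"
    unfolding lobe_solution_def
  proof (intro conjI edge_f edge_g lim kir)
    show "f L = f (- L)" "f (- L) = g L" using L by (simp_all add: f g \<phi>even glue)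
    show "\<forall>x\<in>{- L..L}. 0 < f x" "\<forall>x\<in>{L..}. 0 < g x" by (simp_all add: f g \<phi>pos \<psi>_def)
    show "\<forall>x\<in>{- L..L}. x \<noteq> 0 \<longrightarrow> f x < f 0" using L by (auto simp: f \<phi>max)
    show "\<forall>x\<in>{L..}. g x < f 0"
    proof
      fix x assume x: "x \<in> {L..}"
      then have "\<psi> x \<le> \<psi> L" using \<psi>less[of L x] by (cases "x = L") auto
      also have "\<dots> < \<phi> 0" unfolding glue[symmetric] using L by (intro \<phi>max) auto
      finally show "g x < f 0" using x L by (simp add: f g)
    qed
    show "antimono_on {0..L} f"
    proof (rule monotone_onI)
      fix x y assume "x \<in> {0..L}" "y \<in> {0..L}" "x \<le> y"
      then show "f y \<le> f x" using \<phi>less[of x y] by (cases "x = y") (auto simp: f)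
    qed
    show "strict_antimono_on {L..} g"
      by (rule monotone_onI) (use \<psi>less in \<open>auto simp: g\<close>)
  qed (auto simp: f_def g_def)
  moreover have "g \<in> L2 {L<..}" by (rule L2_cong[OF \<psi>h(2)]) (auto simp: g)
  moreover have "(\<lambda>x. - 2 * g x * ln (g x)) \<in> L2 {L<..}" by (rule L2_cong[OF \<psi>h(4)]) (auto simp: g)
  ultimately show ?thesis using \<psi>h(3) that by blast
qed

lemma lobe_solution_scale:
  assumes "lobe_solution L c f f1 g g1" "r > 0"
  shows "lobe_solution L (c + 2 * ln r) (\<lambda>x. r * f x) (\<lambda>x. r * f1 x) (\<lambda>x. r * g x) (\<lambda>x. r * g1 x)"
proof -
  have rhs: "(c + 2 * ln r) * (r * y) - 2 * (r * y) * ln (r * y) = r * (c * y - 2 * y * ln y)"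
    if "y > 0" for y
    using that assms(2) by (simp add: ln_mult algebra_simps)
  have "C2_edge {- L..L} (\<lambda>x. r * f x) (\<lambda>x. r * f1 x)
      (\<lambda>x. (c + 2 * ln r) * (r * f x) - 2 * (r * f x) * ln (r * f x))"
    by (rule C2_edge_cong[OF C2_edge_scale[of _ f f1 "\<lambda>x. c * f x - 2 * f x * ln (f x)" r]])
       (use assms(1) in \<open>auto simp: lobe_solution_def rhs\<close>)
  moreover have "C2_edge {L..} (\<lambda>x. r * g x) (\<lambda>x. r * g1 x)
      (\<lambda>x. (c + 2 * ln r) * (r * g x) - 2 * (r * g x) * ln (r * g x))"
    by (rule C2_edge_cong[OF C2_edge_scale[of _ g g1 "\<lambda>x. c * g x - 2 * g x * ln (g x)" r]])
       (use assms(1) in \<open>auto simp: lobe_solution_def rhs\<close>)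
  moreover have "((\<lambda>x. r * g x) \<longlongrightarrow> 0) at_top"
    using tendsto_mult_right_zero[of g at_top r] assms(1) by (simp add: lobe_solution_def)
  moreover have "r * f1 L - r * f1 (- L) = r * g1 L"
    using assms(1) by (simp add: lobe_solution_def right_diff_distrib[symmetric])
  ultimately show ?thesis
    using assms by (auto simp: lobe_solution_def monotone_on_def)
qed

section \<open>The curve of states\<close>

lemma L2_continuous_Icc:
  fixes f :: "real \<Rightarrow> real"
  assumes "continuous_on {a..b} f"
  shows "f \<in> L2 {a<..<b}"
proof -
  have "continuous_on {a<..<b} f"
    by (rule continuous_on_subset[OF assms]) auto
  then have "f \<in> borel_measurable (lebesgue_on {a<..<b})"
    by (intro continuous_imp_measurable_on_sets_lebesgue) auto
  moreover have "set_integrable lebesgue {a..b} (\<lambda>x. (f x)\<^sup>2)"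
    by (intro absolutely_integrable_continuous_real continuous_intros assms)
  then have "set_integrable lebesgue {a<..<b} (\<lambda>x. (f x)\<^sup>2)"
    by (rule set_integrable_subset) auto
  then have "integrable (lebesgue_on {a<..<b}) (\<lambda>x. (f x)\<^sup>2)"
    by (simp add: integrable_restrict_space set_integrable_def)
  ultimately show ?thesis by (simp add: L2_def)
qed

lemma L2_scale: "f \<in> L2 S \<Longrightarrow> (\<lambda>x. r * f x) \<in> L2 S" for f :: "real \<Rightarrow> real"
  by (auto simp: L2_def power_mult_distrib)

lemma L2_norm_scale: "L2_norm S (\<lambda>x. r * f x) = \<bar>r\<bar> * L2_norm S f" for f :: "real \<Rightarrow> real"
  by (simp add: L2_norm_def power_mult_distrib real_sqrt_mult)

lemma L2_norm_cong_AE: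
  fixes f g :: "real \<Rightarrow> real"
  assumes "f \<in> L2 S" "g \<in> L2 S" "AE x in lebesgue_on S. f x = g x"
  shows "L2_norm S f = L2_norm S g"
proof -
  have "(LINT x|lebesgue_on S. (norm (f x))\<^sup>2) = (LINT x|lebesgue_on S. (norm (g x))\<^sup>2)"
    by (rule integral_cong_AE) (use assms in \<open>auto simp: L2_def\<close>)
  then show ?thesis by (simp add: L2_norm_def)
qed

text \<open>\<open>weak_deriv\<close> picks an unspecified representative, and uniqueness up to null
  sets ties it to any known weak derivative.\<close>

lemma weak_deriv_AE:
  fixes f g :: "real \<Rightarrow> real"
  assumes "open S" "g \<in> L2 S" "is_weak_deriv n S f g"
  shows "weak_deriv n S f \<in> L2 S" "AE x in lebesgue_on S. weak_deriv n S f x = g x"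
proof -
  have wd: "weak_deriv n S f \<in> L2 S \<and> is_weak_deriv n S f (weak_deriv n S f)"
    unfolding weak_deriv_def by (rule someI[of _ g]) (use assms in auto)
  then show "weak_deriv n S f \<in> L2 S" by simp
  show "AE x in lebesgue_on S. weak_deriv n S f x = g x"
    by (rule weak_deriv_unique_AE[OF assms(1)]) (use wd assms in auto)
qed

lemma C2_edge_weak_derivs:
  fixes f :: "real \<Rightarrow> real"
  assumes S: "open S" "is_interval S" "S \<noteq> {}" "S \<subseteq> T" and f: "C2_edge T f f1 f2"
  shows "is_weak_deriv 1 S f f1" "is_weak_deriv 2 S f f2"
proof -
  have int: "x \<in> interior T" if "x \<in> S" for x
    using S(1,4) that interior_maximal by blast
  have w1: "is_weak_deriv (Suc 0) S f f1"
    by (rule is_weak_deriv_Suc[OF S(1-3) is_weak_deriv_0])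
       (use int C2_edge_DERIV[OF f] continuous_on_subset[OF C2_edge_continuous(2)[OF f] S(4)] in auto)
  then show "is_weak_deriv 1 S f f1" by simp
  show "is_weak_deriv 2 S f f2"
    unfolding numeral_2_eq_2
    by (rule is_weak_deriv_Suc[OF S(1-3) w1])
       (use int C2_edge_DERIV[OF f] f continuous_on_subset[OF _ S(4)] in \<open>auto simp: C2_edge_def\<close>)
qed

text \<open>The norm is expressed by classical derivatives, which scale pointwise, whereas the
  representatives chosen for \<open>f\<close> and for a multiple of it are unrelated on null
  sets.\<close>

lemma C2_edge_sobolev:
  fixes f :: "real \<Rightarrow> real"
  assumes S: "open S" "is_interval S" "S \<noteq> {}" "S \<subseteq> T" and f: "C2_edge T f f1 f2"
    and L2: "f \<in> L2 S" "f1 \<in> L2 S" "f2 \<in> L2 S"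
  shows "f \<in> sobolev 2 S"
    "sobolev_norm 2 S f = sqrt ((L2_norm S f)\<^sup>2 + (L2_norm S f1)\<^sup>2 + (L2_norm S f2)\<^sup>2)"
proof -
  note w = is_weak_deriv_0[of S f] C2_edge_weak_derivs[OF S f]
  have "\<exists>g\<in>L2 S. is_weak_deriv k S f g" if "k \<le> 2" for k
  proof -
    from that have "k = 0 \<or> k = 1 \<or> k = 2" by auto
    then show ?thesis using w L2 by blast
  qed
  then show "f \<in> sobolev 2 S" using L2 by (simp add: sobolev_def)
  have norm_eq: "L2_norm S (weak_deriv n S f) = L2_norm S g" if "g \<in> L2 S" "is_weak_deriv n S f g" for n g
    by (rule L2_norm_cong_AE) (use weak_deriv_AE[OF S(1) that] that in auto)
  show "sobolev_norm 2 S f = sqrt ((L2_norm S f)\<^sup>2 + (L2_norm S f1)\<^sup>2 + (L2_norm S f2)\<^sup>2)"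
    using norm_eq[OF L2(1) w(1)] norm_eq[OF L2(2) w(2)] norm_eq[OF L2(3) w(3)]
    by (simp add: sobolev_norm_def numeral_2_eq_2 atMost_Suc add_ac)
qed

lemma lobe_solution_edges_L2:
  assumes "lobe_solution L c f f1 g g1"
  shows "f \<in> L2 {-L<..<L}" "f1 \<in> L2 {-L<..<L}" "(\<lambda>x. c * f x - 2 * f x * ln (f x)) \<in> L2 {-L<..<L}"
proof -
  have f: "C2_edge {-L..L} f f1 (\<lambda>x. c * f x - 2 * f x * ln (f x))"
    using assms by (simp add: lobe_solution_def)
  note c = C2_edge_continuous[OF f]
  have "continuous_on {-L..L} (\<lambda>x. c * f x - 2 * f x * ln (f x))" using f by (simp add: C2_edge_def)
  with c show "f \<in> L2 {-L<..<L}" "f1 \<in> L2 {-L<..<L}"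
      "(\<lambda>x. c * f x - 2 * f x * ln (f x)) \<in> L2 {-L<..<L}"
    by (auto intro: L2_continuous_Icc)
qed

text \<open>All conditions in \<open>D0\<close> are linear, so every real multiple qualifies; this
  covers both the states and the derivative of the curve.\<close>

lemma lobe_solution_scale_D0:
  assumes L: "L > 0" and lobe: "lobe_solution L c f f1 g g1"
    and L2: "g \<in> L2 {L<..}" "g1 \<in> L2 {L<..}" "(\<lambda>x. c * g x - 2 * g x * ln (g x)) \<in> L2 {L<..}"
  shows "((\<lambda>x. r * f x), (\<lambda>x. r * g x)) \<in> D0 L"
proof -
  have f: "C2_edge {-L..L} f f1 (\<lambda>x. c * f x - 2 * f x * ln (f x))"
    and g: "C2_edge {L..} g g1 (\<lambda>x. c * g x - 2 * g x * ln (g x))"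
    using lobe by (auto simp: lobe_solution_def)
  note fr = C2_edge_scale[OF f, of r] and gr = C2_edge_scale[OF g, of r]
  have "(\<lambda>x. r * f x) \<in> sobolev 2 {-L<..<L}"
    by (rule C2_edge_sobolev(1)[OF _ _ _ _ fr])
       (use L lobe_solution_edges_L2[OF lobe] in \<open>auto intro: L2_scale\<close>)
  moreover have "(\<lambda>x. r * g x) \<in> sobolev 2 {L<..}"
    by (rule C2_edge_sobolev(1)[OF _ _ _ _ gr]) (use L2 in \<open>auto intro: L2_scale\<close>)
  moreover have "vector_derivative (\<lambda>x. r * f x) (at L within {-L..L}) = r * f1 L"
    by (rule vector_derivative_edge[where y = 0]) (use fr L in \<open>auto simp: C2_edge_def is_interval_cc\<close>)
  moreover have "vector_derivative (\<lambda>x. r * f x) (at (-L) within {-L..L}) = r * f1 (-L)"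
    by (rule vector_derivative_edge[where y = 0]) (use fr L in \<open>auto simp: C2_edge_def is_interval_cc\<close>)
  moreover have "vector_derivative (\<lambda>x. r * g x) (at L within {L..}) = r * g1 L"
    by (rule vector_derivative_edge[where y = "L + 1"]) (use gr L in \<open>auto simp: C2_edge_def is_interval_ci\<close>)
  moreover have "r * f1 L - r * f1 (- L) = r * g1 L"
    using lobe by (simp add: lobe_solution_def right_diff_distrib[symmetric])
  ultimately show ?thesis
    using C2_edge_continuous(1)[OF fr] C2_edge_continuous(1)[OF gr] lobe
    by (simp add: D0_def graph_sobolev_def lobe_solution_def)
qed

lemma lobe_solution_imp_state:
  assumes L: "L > 0" and lobe: "lobe_solution L c f f1 g g1"
    and L2: "g \<in> L2 {L<..}" "g1 \<in> L2 {L<..}" "(\<lambda>x. c * g x - 2 * g x * ln (g x)) \<in> L2 {L<..}"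
  shows "positive_single_lobe_state L c (f, g)"
proof -
  have f: "C2_edge {-L..L} f f1 (\<lambda>x. c * f x - 2 * f x * ln (f x))"
    and g: "C2_edge {L..} g g1 (\<lambda>x. c * g x - 2 * g x * ln (g x))"
    and pos: "\<And>x. x \<in> {-L..L} \<Longrightarrow> f x > 0" "\<And>x. x \<in> {L..} \<Longrightarrow> g x > 0"
    using lobe by (auto simp: lobe_solution_def)
  have ln2: "h * ln (\<bar>h\<bar>\<^sup>2) = 2 * h * ln h" if "h > 0" for h :: real
    using that by (simp add: ln_realpow)
  have eqn: "AE x in lebesgue_on S. - weak_deriv 2 S h x + c * h x - h x * ln (\<bar>h x\<bar>\<^sup>2) = 0"
    if S: "open S" "is_interval S" "S \<noteq> {}" "S \<subseteq> T"
      and h: "C2_edge T h h1 (\<lambda>x. c * h x - 2 * h x * ln (h x))"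
      "(\<lambda>x. c * h x - 2 * h x * ln (h x)) \<in> L2 S" "\<And>x. x \<in> T \<Longrightarrow> h x > 0"
    for S T and h h1 :: "real \<Rightarrow> real"
  proof -
    have "AE x in lebesgue_on S. x \<in> S" using S(1) by (intro AE_I2) auto
    with weak_deriv_AE(2)[OF S(1) h(2) C2_edge_weak_derivs(2)[OF S h(1)]] show ?thesis
    proof eventually_elim
      case (elim x)
      then have "h x > 0" using h(3) S(4) by blast
      with elim ln2[of "h x"] show ?case by simp
    qed
  qed
  have "NLS_log L c (f, g)"
    unfolding NLS_log_def laplacian_def fst_conv snd_conv
    by (intro conjI eqn[OF _ _ _ _ f] eqn[OF _ _ _ _ g])
       (use L pos L2 lobe_solution_edges_L2[OF lobe] in auto)
  moreover have "(f, g) \<in> D0 L" using lobe_solution_scale_D0[OF L lobe L2, of 1] by simp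
  ultimately show ?thesis
    using lobe pos by (simp add: positive_single_lobe_state_def lobe_solution_def)
qed

theorem theorem5p1:
  fixes L :: real
  assumes "L > 0"
  shows "(\<forall>c. \<exists>!u. positive_single_lobe_state L c u) \<and>
         (\<forall>\<Theta>. (\<forall>c. positive_single_lobe_state L c (\<Theta> c)) \<longrightarrow>
            C1_curve_D0 L \<Theta> \<and>
            (\<forall>c. \<exists>m>0. ((\<lambda>s. mass L (\<Theta> s)) has_real_derivative m) (at c)))"
proof -
  obtain F F1 G G1 where base: "lobe_solution L 0 F F1 G G1"
    and L2: "G \<in> L2 {L<..}" "G1 \<in> L2 {L<..}" "(\<lambda>x. - 2 * G x * ln (G x)) \<in> L2 {L<..}"
    by (rule lobe_solution_exists[OF assms])
  have L2': "(\<lambda>x. 0 * G x - 2 * G x * ln (G x)) \<in> L2 {L<..}" using L2(3) by simp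
  have Gpos: "G x > 0" if "x \<in> {L..}" for x using base that by (simp add: lobe_solution_def)
  have Fpos: "F x > 0" if "x \<in> {-L..L}" for x using base that by (simp add: lobe_solution_def)
  \<comment> \<open>All states lie on the line spanned by \<open>(F, G)\<close>. Differences and
    difference quotients are again values of \<open>U\<close>, their norm is a constant times an
    absolute value, and regularity of the curve becomes calculus of exp (c / 2).\<close>
  define U where "U r = (\<lambda>x. r * F x, \<lambda>x. r * G x)" for r
  have U_D0: "U r \<in> D0 L" for r
    unfolding U_def by (rule lobe_solution_scale_D0[OF assms base L2(1,2) L2'])
  have state: "positive_single_lobe_state L c (U (exp (c / 2)))" for c
  proof -
    have lobe: "lobe_solution L c (\<lambda>x. exp (c / 2) * F x) (\<lambda>x. exp (c / 2) * F1 x)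
        (\<lambda>x. exp (c / 2) * G x) (\<lambda>x. exp (c / 2) * G1 x)"
      using lobe_solution_scale[OF base, of "exp (c / 2)"] by simp
    have "(\<lambda>x. c * (exp (c / 2) * G x) - 2 * (exp (c / 2) * G x) * ln (exp (c / 2) * G x)) \<in> L2 {L<..}"
      by (rule L2_cong[OF L2_scale[OF L2(3), of "exp (c / 2)"]])
         (auto simp: ln_mult Gpos less_imp_le algebra_simps)
    then show ?thesis
      unfolding U_def by (intro lobe_solution_imp_state[OF assms lobe] L2_scale L2)
  qed
  have unique: "u = U (exp (c / 2))" if st: "positive_single_lobe_state L c u" for c u
  proof -
    obtain f1 g1 where lobe: "lobe_solution L c (fst u) f1 (snd u) g1"
      by (rule state_imp_lobe_solution[OF assms st])
    have "lobe_solution L 0 (\<lambda>x. exp (- c / 2) * fst u x) (\<lambda>x. exp (- c / 2) * f1 x)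
        (\<lambda>x. exp (- c / 2) * snd u x) (\<lambda>x. exp (- c / 2) * g1 x)"
      using lobe_solution_scale[OF lobe, of "exp (- c / 2)"] by simp
    from lobe_solution_unique[OF assms this base]
    have "F = (\<lambda>x. exp (- c / 2) * fst u x)" "G = (\<lambda>x. exp (- c / 2) * snd u x)" by auto
    then have "exp (c / 2) * F x = fst u x" "exp (c / 2) * G x = snd u x" for x
      by (simp_all add: exp_minus)
    then show ?thesis by (simp add: U_def prod_eq_iff fun_eq_iff)
  qed
  define N where "N = graph_sobolev_norm 2 L (U 1)"
  have norm_U: "graph_sobolev_norm 2 L (U r) = \<bar>r\<bar> * N" for r
  proof -
    have F: "C2_edge {-L..L} F F1 (\<lambda>x. 0 * F x - 2 * F x * ln (F x))"
      and G: "C2_edge {L..} G G1 (\<lambda>x. 0 * G x - 2 * G x * ln (G x))"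
      using base by (auto simp: lobe_solution_def)
    note FL2 = lobe_solution_edges_L2[OF base]
    have nF: "sobolev_norm 2 {-L<..<L} (\<lambda>x. r * F x) = sqrt ((\<bar>r\<bar> * L2_norm {-L<..<L} F)\<^sup>2
      + (\<bar>r\<bar> * L2_norm {-L<..<L} F1)\<^sup>2 + (\<bar>r\<bar> * L2_norm {-L<..<L} (\<lambda>x. 0 * F x - 2 * F x * ln (F x)))\<^sup>2)" for r
      unfolding L2_norm_scale[symmetric]
      by (rule C2_edge_sobolev(2)[OF _ _ _ _ C2_edge_scale[OF F]
            L2_scale[OF FL2(1)] L2_scale[OF FL2(2)] L2_scale[OF FL2(3)]]) (use assms in auto)
    have nG: "sobolev_norm 2 {L<..} (\<lambda>x. r * G x) = sqrt ((\<bar>r\<bar> * L2_norm {L<..} G)\<^sup>2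
      + (\<bar>r\<bar> * L2_norm {L<..} G1)\<^sup>2 + (\<bar>r\<bar> * L2_norm {L<..} (\<lambda>x. 0 * G x - 2 * G x * ln (G x)))\<^sup>2)" for r
      unfolding L2_norm_scale[symmetric]
      by (rule C2_edge_sobolev(2)[OF _ _ _ _ C2_edge_scale[OF G]
            L2_scale[OF L2(1)] L2_scale[OF L2(2)] L2_scale[OF L2']]) auto
    have "(graph_sobolev_norm 2 L (U r))\<^sup>2 = (\<bar>r\<bar> * N)\<^sup>2"
      unfolding N_def graph_sobolev_norm_def U_def fst_conv snd_conv nF nG
      by (simp add: power_mult_distrib algebra_simps)
    then show ?thesis
      by (rule power2_eq_imp_eq) (auto simp: N_def graph_sobolev_norm_def)
  qed
  have U_diff: "graph_diff (U r) (U s) = U (r - s)" and U_scale: "graph_scale r (U s) = U (r * s)" for r s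
    by (simp_all add: U_def graph_diff_def graph_scale_def left_diff_distrib mult.assoc)
  have C1: "C1_curve_D0 L (\<lambda>c. U (exp (c / 2)))"
    unfolding C1_curve_D0_def
  proof (intro conjI exI[of _ "\<lambda>c. U (exp (c / 2) / 2)"] allI U_D0)
    fix c :: real
    have "((\<lambda>c. exp (c / 2)) has_real_derivative exp (c / 2) / 2) (at c)"
      by (auto intro!: derivative_eq_intros)
    then have "((\<lambda>h. (exp ((c + h) / 2) - exp (c / 2)) / h) \<longlongrightarrow> exp (c / 2) / 2) (at 0)"
      by (simp add: DERIV_def)
    then have "((\<lambda>h. \<bar>1 / h * (exp ((c + h) / 2) - exp (c / 2)) - exp (c / 2) / 2\<bar> * N) \<longlongrightarrow>
        \<bar>exp (c / 2) / 2 - exp (c / 2) / 2\<bar> * N) (at 0)"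
      by (intro tendsto_intros) simp
    then show "((\<lambda>h. graph_sobolev_norm 2 L (graph_diff (graph_scale (1 / h)
        (graph_diff (U (exp ((c + h) / 2))) (U (exp (c / 2))))) (U (exp (c / 2) / 2)))) \<longlongrightarrow> 0) (at 0)"
      by (simp add: U_diff U_scale norm_U)
    have "((\<lambda>s. \<bar>exp (s / 2) / 2 - exp (c / 2) / 2\<bar> * N) \<longlongrightarrow>
        \<bar>exp (c / 2) / 2 - exp (c / 2) / 2\<bar> * N) (at c)"
      by (intro tendsto_intros) auto
    then show "((\<lambda>s. graph_sobolev_norm 2 L (graph_diff (U (exp (s / 2) / 2)) (U (exp (c / 2) / 2)))) \<longlongrightarrow> 0)
        (at c)"
      by (simp add: U_diff norm_U)
  qed
  define M where "M = mass L (U 1)"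
  have mass_U: "mass L (U r) = r\<^sup>2 * M" for r
    by (simp add: M_def mass_def graph_L2_norm_def U_def L2_norm_scale power_mult_distrib distrib_left)
  have "L2_norm {-L<..<L} F > 0"
  proof -
    have contF: "continuous_on {-L..L} F"
      using base by (auto simp: lobe_solution_def intro: C2_edge_continuous)
    have int: "integrable (lebesgue_on {-L<..<L}) (\<lambda>x. (F x)\<^sup>2)"
      using lobe_solution_edges_L2(1)[OF base] by (simp add: L2_def)
    \<comment> \<open>\<open>F\<close> is positive on an interval of positive measure, so its square
      cannot vanish almost everywhere.\<close>
    have "(LINT x|lebesgue_on {-L<..<L}. (F x)\<^sup>2) \<noteq> 0"
    proof
      assume "(LINT x|lebesgue_on {-L<..<L}. (F x)\<^sup>2) = 0"
      then have "AE x in lebesgue_on {-L<..<L}. (F x)\<^sup>2 = 0"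
        using integral_nonneg_eq_0_iff_AE[OF int] by simp
      moreover have "AE x in lebesgue_on {-L<..<L}. (F x)\<^sup>2 \<noteq> 0"
        using Fpos by (intro AE_I2) (auto simp: less_imp_neq[symmetric])
      ultimately have "AE x in lebesgue_on {-L<..<L}. False" by eventually_elim auto
      then have "emeasure (lebesgue_on {-L<..<L}) (space (lebesgue_on {-L<..<L})) = 0"
        by (simp only: eventually_False ae_filter_eq_bot_iff)
      then have "emeasure lebesgue {-L<..<L} = 0"
        by (simp add: emeasure_restrict_space)
      then show False using assms by simp
    qed
    moreover have "(LINT x|lebesgue_on {-L<..<L}. (F x)\<^sup>2) \<ge> 0" by (rule integral_nonneg_AE) auto
    ultimately have "(LINT x|lebesgue_on {-L<..<L}. (F x)\<^sup>2) > 0"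
      unfolding order_less_le by simp
    then show ?thesis by (simp add: L2_norm_def)
  qed
  then have M: "M > 0"
    by (auto simp: M_def mass_def graph_L2_norm_def U_def add_pos_nonneg)
  have "\<exists>m>0. ((\<lambda>s. mass L (U (exp (s / 2)))) has_real_derivative m) (at c)" for c
  proof -
    have "((\<lambda>s. mass L (U (exp (s / 2)))) has_real_derivative exp c * M) (at c)"
      unfolding mass_U
      by (auto intro!: derivative_eq_intros simp: power2_eq_square exp_add[symmetric])
    then show ?thesis using M by (intro exI[of _ "exp c * M"]) auto
  qed
  \<comment> \<open>Uniqueness identifies an arbitrary family of states with the explicit curve, for
    which the claims are established.\<close>
  with C1 state unique show ?thesis
    by (metis (no_types, lifting) ext)
qed

end
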